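(* Suppose a group $G \in \mathcal{G}$ admits a pointy action. Then $A \wr G \in \mathcal{G}$ for all finitely generated abelian groups $A$.
   Context: For a finite set (alphabet) $\Sigma$, the full shift $\Sigma^{\mathbb{Z}}$ carries the product topology and the shift homeomorphism $\sigma(x)_i = x_{i+1}$. $\mathrm{Aut}(\Sigma^{\mathbb{Z}})$ is the group (under composition) of homeomorphisms $f:\Sigma^{\mathbb{Z}}\to\Sigma^{\mathbb{Z}}$ with $f\circ\sigma=\sigma\circ f$. $\mathcal{G}$ is the class of groups that embed (as abstract groups) in $\mathrm{Aut}(\Sigma^{\mathbb{Z}})$, where $\Sigma$ is a finite alphabet with at least two elements; it is known that this class does not depend on the choice of such $\Sigma$. If the alphabet $\Sigma$ contains a distinguished symbol $0$, then $\mathrm{Aut}_0(\Sigma^{\mathbb{Z}})$ is the stabilizer of the constant point $0^{\mathbb{Z}}$ in $\mathrm{Aut}(\Sigma^{\mathbb{Z}})$, and a point $x\in\Sigma^{\mathbb{Z}}$ is $0$-finite if $\{i\in\mathbb{Z} : x_i\neq 0\}$ is finite. A subgroup $H\le \mathrm{Aut}_0(\Sigma^{\mathbb{Z}})$ is pointy if some $0$-finite $x_0\in\Sigma^{\mathbb{Z}}$ has free orbit under $H$, i.e. the map $h\mapsto h x_0$ is injective on $H$. A group $G$ admits a pointy action if, for some finite alphabet $\Sigma\ni 0$, there is an embedding of $G$ into $\mathrm{Aut}_0(\Sigma^{\mathbb{Z}})$ whose image is pointy. For groups $K,H$, the wreath product $K \wr H$ is the restricted one: the semidirect product $K^{(H)}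 \rtimes H$, where $K^{(H)}$ is the group of finitely supported functions $H\to K$ and $H$ acts by the regular action on coordinates. *)

theory Defs
  imports
    "HOL-Analysis.Analysis"
    "HOL-Algebra.Bij"
    "HOL-Algebra.Generated_Groups"
    "HOL-Algebra.Product_Groups"
begin

definition full_shift :: "'s set \<Rightarrow> (int \<Rightarrow> 's) topology" where
  "full_shift S = product_topology (\<lambda>_. discrete_topology S) UNIV"

definition shift :: "(int \<Rightarrow> 's) \<Rightarrow> int \<Rightarrow> 's" where
  "shift x = (\<lambda>i. x (i + 1))"

(* As in BijGroup, maps are undefined outside the full shift, so that
   equality of group elements is equality of maps on the full shift. *)
definition shift_aut :: "'s set \<Rightarrow> ((int \<Rightarrow> 's) \<Rightarrow> (int \<Rightarrow> 's)) monoid" where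
  "shift_aut S = (BijGroup (topspace (full_shift S)))
     \<lparr>carrier := {f \<in> Bij (topspace (full_shift S)).
        homeomorphic_map (full_shift S) (full_shift S) f \<and>
        (\<forall>x \<in> topspace (full_shift S). f (shift x) = shift (f x))}\<rparr>"

(* z plays the role of the distinguished symbol 0. *)
definition shift_aut0 :: "'s set \<Rightarrow> 's \<Rightarrow> ((int \<Rightarrow> 's) \<Rightarrow> (int \<Rightarrow> 's)) monoid" where
  "shift_aut0 S z = (shift_aut S)
     \<lparr>carrier := {f \<in> carrier (shift_aut S). f (\<lambda>_. z) = (\<lambda>_. z)}\<rparr>"

definition finite_point :: "'s \<Rightarrow> (int \<Rightarrow> 's) \<Rightarrow> bool" where
  "finite_point z x \<longleftrightarrow> finite {i. x i \<noteq> z}"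

definition pointy :: "'s set \<Rightarrow> 's \<Rightarrow> ((int \<Rightarrow> 's) \<Rightarrow> (int \<Rightarrow> 's)) set \<Rightarrow> bool" where
  "pointy S z H \<longleftrightarrow> subgroup H (shift_aut0 S z) \<and>
     (\<exists>x \<in> topspace (full_shift S). finite_point z x \<and> inj_on (\<lambda>h. h x) H)"

(* Alphabets range over the finite sets of natural numbers; every finite alphabet
   is in bijection with one of these, and types cannot be quantified existentially. *)
definition class_G :: "('g, 'm) monoid_scheme \<Rightarrow> bool" where
  "class_G G \<longleftrightarrow> group G \<and>
     (\<exists>S :: nat set. finite S \<and> card S \<ge> 2 \<and> (\<exists>\<phi>. \<phi> \<in> mon G (shift_aut S)))"

definition admits_pointy_action :: "('g, 'm) monoid_scheme \<Rightarrow> bool" where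
  "admits_pointy_action G \<longleftrightarrow>
     (\<exists>(S :: nat set) z. finite S \<and> z \<in> S \<and>
        (\<exists>\<phi> \<in> mon G (shift_aut0 S z). pointy S z (\<phi> ` carrier G)))"

definition semidirect_product ::
  "('n, 'm) monoid_scheme \<Rightarrow> ('h, 'k) monoid_scheme \<Rightarrow> ('h \<Rightarrow> 'n \<Rightarrow> 'n) \<Rightarrow> ('n \<times> 'h) monoid" where
  "semidirect_product N H \<alpha> =
     \<lparr>carrier = carrier N \<times> carrier H,
      mult = (\<lambda>(n, h) (n', h'). (n \<otimes>\<^bsub>N\<^esub> \<alpha> h n', h \<otimes>\<^bsub>H\<^esub> h')),
      one = (\<one>\<^bsub>N\<^esub>, \<one>\<^bsub>H\<^esub>)\<rparr>"

definition wreath_product ::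
  "('a, 'm) monoid_scheme \<Rightarrow> ('h, 'k) monoid_scheme \<Rightarrow> (('h \<Rightarrow> 'a) \<times> 'h) monoid" where
  "wreath_product K H =
     semidirect_product (sum_group (carrier H) (\<lambda>_. K)) H
       (\<lambda>h u. \<lambda>x \<in> carrier H. u (inv\<^bsub>H\<^esub> h \<otimes>\<^bsub>H\<^esub> x))"

definition finitely_generated :: "('a, 'm) monoid_scheme \<Rightarrow> bool" where
  "finitely_generated A \<longleftrightarrow> (\<exists>X. finite X \<and> X \<subseteq> carrier A \<and> generate A X = carrier A)"

end

theory Submission
  imports Defs "HOL-Algebra.FiniteProduct" "HOL-Number_Theory.Cong"
begin

text \<open>
Actions on two full shifts combine to an action on the full shift over the product alphabet, and an
element that acts trivially there acts trivially on both factors. It is therefore enough to treat the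
characters of \<open>A\<close> one at a time: a finitely generated abelian group has finitely many characters, with
values in \<open>\<int>\<close> or in some \<open>\<int>/n\<close>, whose common kernel is trivial (\<open>separating_characters\<close>). For one
character \<open>\<theta>\<close> the task is to let the wreath product act in such a way that a pair \<open>(u, h)\<close> acts trivially
only if \<open>h = 1\<close> and \<open>\<theta>\<close> vanishes at all values of \<open>u\<close> (\<open>wreath_action\<close>).

Let \<open>r\<close> be the finite point whose orbit under \<open>G\<close> is free. One would like the lamp at the identity to act
on a configuration exactly if it is equal to \<open>r\<close>, and to obtain the lamp at \<open>g\<close> by conjugation with \<open>g\<close>.
A local rule cannot decide this: it sees a window of fixed size, and a point of the orbit that
agrees with \<open>r\<close> on the window may differ from \<open>r\<close> far away. What helps is that \<open>r\<close> is finite and that \<open>G\<close>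
fixes the zero point. An automaton of radius \<open>R\<close> which fixes the zero point moves the border of a blank
stretch by at most \<open>R\<close> cells (\<open>blank_spreads\<close>). Cells can thus carry flags which claim that
everything ahead is blank, and a local rule keeps the flags correct. A copy of \<open>r\<close> between two flags
is recognised from a window.

The flags are correct on a subshift only, whereas the action has to be defined on a full shift. Each
cell carries two symbols and two flags. It is live if its flags are compatible with those of its
neighbours, and the other cells are never changed. A maximal run of live cells is read as a conveyor
belt: to the right along one symbol of each cell, to the left along the other, turning round at the
ends of the run. The group \<open>G\<close> acts on the contents of the belts, and the flags are recomputed. This does
not change which cells are live (\<open>live_update\<close>), it is compatible with composition
(\<open>belt_map_belt_map\<close>), and it is local (\<open>belt_map_local\<close>).

The point \<open>r\<close> is given a marker that \<open>G\<close> does not move. A run is at home if the flags certify that it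
holds one copy of \<open>r\<close>, with any label on the marker, and nothing else. The lamp \<open>a\<close> at
the identity acts on the runs at home. If \<open>\<theta>\<close> is integer valued, it slides the content of the belt by
\<open>\<theta> a\<close> places; if \<open>\<theta>\<close> has values in \<open>\<int>/n\<close>, it adds \<open>\<theta> a\<close> to the label. These
operations commute with \<open>G\<close> and do not take a run away from home or bring it there, so that lamps at
different elements of \<open>G\<close> commute and the wreath product acts. The lamps are local because a run at
home is blank away from the copy of \<open>r\<close>. On a two-sided infinite run with content \<open>k r\<close>, the element
\<open>(u, h)\<close> acts by \<open>h\<close> and the single lamp \<open>u (h k)\<close>, since the orbit of \<open>r\<close> is free and the marker rules out translates of \<open>r\<close>; this gives
faithfulness (\<open>act_faithful\<close>).
\<close>

section \<open>Continuous maps of full shifts\<close>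

abbreviation points :: "'s set \<Rightarrow> (int \<Rightarrow> 's) set" where
  "points S \<equiv> topspace (full_shift S)"

lemma mem_full_shift: "x \<in> points S \<longleftrightarrow> (\<forall>i. x i \<in> S)"
  by (auto simp: full_shift_def PiE_iff)

lemma openin_cylinder:
  assumes "x \<in> points S"
  shows "openin (full_shift S) {y \<in> points S. \<forall>k. \<bar>k - j\<bar> \<le> M \<longrightarrow> y k = x k}"
proof -
  let ?V = "\<lambda>k. if \<bar>k - j\<bar> \<le> M then {x k} else S"
  have "{k. \<bar>k - j\<bar> \<le> M} \<subseteq> {j - M..j + M}" by auto
  then have fin: "finite {k. \<bar>k - j\<bar> \<le> M}" using finite_subset by blast
  have "finite {k \<in> UNIV. ?V k \<noteq> topspace (discrete_topology S)}"
    by (rule finite_subset[OF _ fin]) auto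
  moreover have "openin (discrete_topology S) (?V k)" for k
    using assms by (auto simp: mem_full_shift)
  ultimately have "openin (full_shift S) (PiE UNIV ?V)"
    unfolding full_shift_def by (intro openin_PiE_gen[THEN iffD2]) auto
  moreover have "PiE UNIV ?V = {y \<in> points S. \<forall>k. \<bar>k - j\<bar> \<le> M \<longrightarrow> y k = x k}"
    using assms by (auto simp: PiE_iff mem_full_shift split: if_splits)
  ultimately show ?thesis by simp
qed

definition has_radius :: "'s set \<Rightarrow> ((int \<Rightarrow> 's) \<Rightarrow> int \<Rightarrow> 't) \<Rightarrow> int \<Rightarrow> bool" where
  "has_radius S f M \<longleftrightarrow> 0 \<le> M \<and> (\<forall>x\<in>points S. \<forall>y\<in>points S. \<forall>j.
     (\<forall>k. \<bar>k - j\<bar> \<le> M \<longrightarrow> x k = y k) \<longrightarrow> f x j = f y j)"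

definition window_local :: "'s set \<Rightarrow> ((int \<Rightarrow> 's) \<Rightarrow> int \<Rightarrow> 't) \<Rightarrow> bool" where
  "window_local S f \<longleftrightarrow> (\<exists>M. has_radius S f M)"

lemma has_radiusI:
  assumes "0 \<le> M" "\<And>x y j. x \<in> points S \<Longrightarrow> y \<in> points S \<Longrightarrow>
    (\<And>k. \<bar>k - j\<bar> \<le> M \<Longrightarrow> x k = y k) \<Longrightarrow> f x j = f y j"
  shows "has_radius S f M"
  unfolding has_radius_def using assms(1) by (intro conjI ballI allI impI assms(2)) blast+

lemma has_radiusD:
  assumes "has_radius S f M" "x \<in> points S" "y \<in> points S" "\<And>k. \<bar>k - j\<bar> \<le> M \<Longrightarrow> x k = y k"
  shows "f x j = f y j"
proof -
  have "\<forall>k. \<bar>k - j\<bar> \<le> M \<longrightarrow> x k = y k" using assms(4) by blast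
  then show ?thesis using assms(1-3) unfolding has_radius_def by blast
qed

lemma has_radius_nonneg: "has_radius S f M \<Longrightarrow> 0 \<le> M"
  by (simp add: has_radius_def)

lemma continuous_if_local:
  assumes maps: "\<And>x. x \<in> points S \<Longrightarrow> f x \<in> points S'"
    and local: "window_local S f"
  shows "continuous_map (full_shift S) (full_shift S') f"
proof -
  have "continuous_map (full_shift S) (discrete_topology S') (\<lambda>x. f x j)" for j
    unfolding continuous_map_def
  proof (intro conjI allI impI)
    show "(\<lambda>x. f x j) \<in> points S \<rightarrow> topspace (discrete_topology S')"
      using maps by (auto simp: mem_full_shift)
    fix U assume "openin (discrete_topology S') U"
    obtain M where M: "has_radius S f M" using local by (auto simp: window_local_def)
    show "openin (full_shift S) {x \<in> points S. f x j \<in> U}"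
    proof (subst openin_subopen, intro ballI)
      fix x assume x: "x \<in> {x \<in> points S. f x j \<in> U}"
      let ?C = "{y \<in> points S. \<forall>k. \<bar>k - j\<bar> \<le> M \<longrightarrow> y k = x k}"
      have "?C \<subseteq> {x \<in> points S. f x j \<in> U}"
      proof
        fix y assume y: "y \<in> ?C"
        then have "f y j = f x j" using x by (intro has_radiusD[OF M]) auto
        then show "y \<in> {x \<in> points S. f x j \<in> U}" using x y by simp
      qed
      moreover have "openin (full_shift S) ?C" using x by (intro openin_cylinder) simp
      ultimately show "\<exists>T. openin (full_shift S) T \<and> x \<in> T \<and>
          T \<subseteq> {x \<in> points S. f x j \<in> U}" using x by (intro exI[of _ ?C]) auto
    qed
  qed
  then show ?thesis
    unfolding full_shift_def[of S'] by (simp add: continuous_map_componentwise_UNIV)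
qed

text \<open>
By compactness, finitely many cylinders on which \<open>f x 0\<close> is constant cover the full shift. This is
the nontrivial half of the Curtis-Hedlund-Lyndon theorem.
\<close>

lemma local_at_0_if_continuous:
  assumes fin: "finite S" and cont: "continuous_map (full_shift S) (full_shift S') f"
  shows "\<exists>M\<ge>0. \<forall>x\<in>points S. \<forall>y\<in>points S.
        (\<forall>k. \<bar>k\<bar> \<le> M \<longrightarrow> x k = y k) \<longrightarrow> f x 0 = f y 0"
proof -
  let ?P = "points S"
  define C where "C M x = {y \<in> ?P. \<forall>k. \<bar>k\<bar> \<le> M \<longrightarrow> y k = x k}" for M :: int and x
  have Co: "openin (full_shift S) (C M x)" if "x \<in> ?P" for M x
    using openin_cylinder[OF that, of 0 M] by (simp add: C_def)
  have "\<exists>M. 0 \<le> M \<and> (\<forall>y\<in>C M x. f y 0 = f x 0)" if x: "x \<in> ?P" for x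
  proof -
    have c0: "continuous_map (full_shift S) (discrete_topology S') (\<lambda>y. f y 0)"
      using cont unfolding full_shift_def[of S'] by (simp add: continuous_map_componentwise_UNIV)
    have "f x 0 \<in> S'" using c0 x by (auto simp: continuous_map_def)
    then have "openin (full_shift S) {y \<in> ?P. f y 0 \<in> {f x 0}}"
      using c0 by (intro openin_continuous_map_preimage[OF c0]) simp
    then have "\<forall>y\<in>{y \<in> ?P. f y 0 \<in> {f x 0}}. \<exists>V. finite {i \<in> UNIV. V i \<noteq> topspace (discrete_topology S)} \<and>
        (\<forall>i\<in>UNIV. openin (discrete_topology S) (V i)) \<and> y \<in> PiE UNIV V \<and>
        PiE UNIV V \<subseteq> {y \<in> ?P. f y 0 \<in> {f x 0}}"
      unfolding full_shift_def by (rule openin_product_topology_alt[THEN iffD1])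
    from this[rule_format, of x] x obtain V where V: "finite {i. V i \<noteq> S}" "x \<in> PiE UNIV V"
        "PiE UNIV V \<subseteq> {y \<in> ?P. f y 0 \<in> {f x 0}}"
      by auto
    define M where "M = Max (insert 0 (abs ` {i. V i \<noteq> S}))"
    have M: "\<bar>i\<bar> \<le> M" if "V i \<noteq> S" for i
      using that V(1) by (auto simp: M_def intro: Max_ge)
    have "0 \<le> M" using V(1) by (simp add: M_def)
    moreover have "f y 0 = f x 0" if "y \<in> C M x" for y
    proof -
      have "y i \<in> V i" for i
        using that M[of i] V(2) by (cases "V i = S") (auto simp: C_def mem_full_shift PiE_iff)
      then show ?thesis using V(3) by (auto simp: PiE_iff)
    qed
    ultimately show ?thesis by blast
  qed
  then obtain M where M: "\<And>x. x \<in> ?P \<Longrightarrow> 0 \<le> M x" "\<And>x y. x \<in> ?P \<Longrightarrow> y \<in> C (M x) x \<Longrightarrow> f y 0 = f x 0"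
    by metis
  have "compact_space (full_shift S)"
    unfolding full_shift_def
    using fin by (simp add: compact_space_product_topology compact_space_discrete_topology)
  moreover have "\<forall>U\<in>(\<lambda>x. C (M x) x) ` ?P. openin (full_shift S) U" using Co by blast
  moreover have "?P \<subseteq> \<Union>((\<lambda>x. C (M x) x) ` ?P)" by (auto simp: C_def)
  ultimately obtain \<F> where \<F>: "finite \<F>" "\<F> \<subseteq> (\<lambda>x. C (M x) x) ` ?P" "?P \<subseteq> \<Union>\<F>"
    unfolding compact_space_alt by meson
  then obtain X where X: "finite X" "X \<subseteq> ?P" "\<F> = (\<lambda>x. C (M x) x) ` X"
    using finite_subset_image[OF \<F>(1,2)] by blast
  define N where "N = Max (insert 0 (M ` X))"
  have "0 \<le> N" using X by (simp add: N_def)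
  moreover have "f x 0 = f y 0"
    if x: "x \<in> ?P" and y: "y \<in> ?P" and eq: "\<forall>k. \<bar>k\<bar> \<le> N \<longrightarrow> x k = y k" for x y
  proof -
    obtain p where p: "p \<in> X" "x \<in> C (M p) p" using \<F>(3) X(3) x by blast
    have "M p \<le> N" using p X(1) by (auto simp: N_def intro: Max_ge)
    then have "y \<in> C (M p) p" using p(2) y eq by (auto simp: C_def)
    then show ?thesis using M(2) p X(2) by (metis subsetD)
  qed
  ultimately show ?thesis by blast
qed

lemma commutes_with_translation:
  assumes sh: "\<And>x. x \<in> points S \<Longrightarrow> f (shift x) = shift (f x)" and x: "x \<in> points S"
  shows "f (\<lambda>i. x (i + t)) = (\<lambda>i. f x (i + t))"
proof -
  have sh': "f (\<lambda>i. x (i + t + 1)) = (\<lambda>i. f (\<lambda>i. x (i + t)) (i + 1))" for t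
    using sh[of "\<lambda>i. x (i + t)"] x by (simp add: mem_full_shift shift_def algebra_simps)
  show ?thesis
  proof (induction t rule: int_induct[of _ 0])
    case (step1 t)
    then show ?case using sh'[of t] by (simp add: algebra_simps)
  next
    case (step2 t)
    have "(\<lambda>i. f x (i + t)) = (\<lambda>i. f (\<lambda>i. x (i + (t - 1))) (i + 1))"
      using sh'[of "t - 1"] step2 by (simp add: algebra_simps)
    then have "f x (i - 1 + t) = f (\<lambda>i. x (i + (t - 1))) (i - 1 + 1)" for i
      by (rule fun_cong)
    then show ?case by (simp add: fun_eq_iff algebra_simps)
  qed simp
qed

lemma local_if_continuous:
  assumes fin: "finite S" and cont: "continuous_map (full_shift S) (full_shift S') f"
    and sh: "\<And>x. x \<in> points S \<Longrightarrow> f (shift x) = shift (f x)"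
  shows "window_local S f"
proof -
  obtain M where M: "0 \<le> M" "\<forall>x\<in>points S. \<forall>y\<in>points S. (\<forall>k. \<bar>k\<bar> \<le> M \<longrightarrow> x k = y k) \<longrightarrow> f x 0 = f y 0"
    using local_at_0_if_continuous[OF fin cont] by blast
  have "has_radius S f M"
  proof (rule has_radiusI[OF M(1)])
    fix x y j assume x: "x \<in> points S" and y: "y \<in> points S"
      and eq: "\<And>k. \<bar>k - j\<bar> \<le> M \<Longrightarrow> x k = y k"
    have "(\<lambda>i. x (i + j)) \<in> points S" "(\<lambda>i. y (i + j)) \<in> points S"
      using x y by (simp_all add: mem_full_shift)
    moreover have "\<forall>k. \<bar>k\<bar> \<le> M \<longrightarrow> x (k + j) = y (k + j)" using eq by simp
    ultimately have "f (\<lambda>i. x (i + j)) 0 = f (\<lambda>i. y (i + j)) 0"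
      by (rule M(2)[THEN bspec, THEN bspec, THEN mp])
    then show "f x j = f y j"
      using commutes_with_translation[of S f x j, OF sh x]
        commutes_with_translation[of S f y j, OF sh y] by simp
  qed
  then show ?thesis unfolding window_local_def by blast
qed

section \<open>Group actions by automorphisms of a full shift\<close>

text \<open>
Locality takes the place of continuity; over a finite alphabet the two are equivalent for maps that
commute with the shift (\<open>local_if_continuous\<close>, \<open>continuous_if_local\<close>). The maps may take any values
outside the full shift, so that actions can be given by plain formulas; \<open>shift_action_mon\<close> restricts
them.
\<close>

definition shift_action ::
  "('h, 'k) monoid_scheme \<Rightarrow> 's set \<Rightarrow> ('h \<Rightarrow> (int \<Rightarrow> 's) \<Rightarrow> int \<Rightarrow> 's) \<Rightarrow> bool" where
  "shift_action H S \<Phi> \<longleftrightarrow>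
     (\<forall>h\<in>carrier H. window_local S (\<Phi> h)) \<and>
     (\<forall>x\<in>points S. \<Phi> \<one>\<^bsub>H\<^esub> x = x \<and>
        (\<forall>h\<in>carrier H. \<Phi> h x \<in> points S \<and> \<Phi> h (shift x) = shift (\<Phi> h x) \<and>
           (\<forall>k\<in>carrier H. \<Phi> (h \<otimes>\<^bsub>H\<^esub> k) x = \<Phi> h (\<Phi> k x))))"

definition action_kernel ::
  "('h, 'k) monoid_scheme \<Rightarrow> 's set \<Rightarrow> ('h \<Rightarrow> (int \<Rightarrow> 's) \<Rightarrow> int \<Rightarrow> 's) \<Rightarrow> 'h set" where
  "action_kernel H S \<Phi> = {h \<in> carrier H. \<forall>x\<in>points S. \<Phi> h x = x}"

lemma shift_action_radius:
  "shift_action H S \<Phi> \<Longrightarrow> h \<in> carrier H \<Longrightarrow> \<exists>M. has_radius S (\<Phi> h) M"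
  by (simp add: shift_action_def window_local_def)

lemma shift_action_maps:
  "shift_action H S \<Phi> \<Longrightarrow> h \<in> carrier H \<Longrightarrow> x \<in> points S \<Longrightarrow>
     \<Phi> h x \<in> points S"
  by (simp add: shift_action_def)

lemma shift_aut_simps:
  "carrier (shift_aut S) = {f \<in> Bij (points S).
        homeomorphic_map (full_shift S) (full_shift S) f \<and>
        (\<forall>x \<in> points S. f (shift x) = shift (f x))}"
  "f \<in> carrier (shift_aut S) \<Longrightarrow> g \<in> carrier (shift_aut S) \<Longrightarrow>
     f \<otimes>\<^bsub>shift_aut S\<^esub> g = compose (points S) f g"
  by (auto simp: shift_aut_def BijGroup_def)

lemma shift_action_mon:
  assumes H: "group H" and act: "shift_action H S \<Phi>" and ker: "action_kernel H S \<Phi> = {\<one>\<^bsub>H\<^esub>}"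
  shows "(\<lambda>h. restrict (\<Phi> h) (points S)) \<in> mon H (shift_aut S)"
proof -
  interpret H: group H by (rule H)
  let ?P = "points S" and ?f = "\<lambda>h. restrict (\<Phi> h) (points S)"
  have cont: "continuous_map (full_shift S) (full_shift S) (\<Phi> h)" if "h \<in> carrier H" for h
    using act that by (intro continuous_if_local) (simp_all add: shift_action_def)
  have mult: "\<Phi> (h \<otimes>\<^bsub>H\<^esub> k) x = \<Phi> h (\<Phi> k x)"
    if "h \<in> carrier H" "k \<in> carrier H" "x \<in> ?P" for h k x
    using act that by (simp add: shift_action_def)
  have one: "\<Phi> \<one>\<^bsub>H\<^esub> x = x" if "x \<in> ?P" for x
    using act that by (simp add: shift_action_def)
  have inv: "\<Phi> (inv\<^bsub>H\<^esub> h) (\<Phi> h x) = x" "\<Phi> h (\<Phi> (inv\<^bsub>H\<^esub> h) x) = x"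
    if "h \<in> carrier H" "x \<in> ?P" for h x
    using mult[of "inv\<^bsub>H\<^esub> h" h x] mult[of h "inv\<^bsub>H\<^esub> h" x] one that by simp_all
  have maps: "\<Phi> h x \<in> ?P" if "h \<in> carrier H" "x \<in> ?P" for h x
    using shift_action_maps[OF act that] .
  have sh: "shift x \<in> ?P" if "x \<in> ?P" for x using that by (simp add: mem_full_shift shift_def)
  have car: "?f h \<in> carrier (shift_aut S)" if h: "h \<in> carrier H" for h
  proof -
    have "homeomorphic_maps (full_shift S) (full_shift S) (\<Phi> h) (\<Phi> (inv\<^bsub>H\<^esub> h))"
      using cont h inv[OF h] by (simp add: homeomorphic_maps_def)
    then have hm: "homeomorphic_map (full_shift S) (full_shift S) (\<Phi> h)"
      using homeomorphic_maps_map by blast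
    have "homeomorphic_map (full_shift S) (full_shift S) (?f h)"
      by (rule homeomorphic_map_eq[OF hm]) simp
    moreover have "bij_betw (\<Phi> h) ?P ?P"
      unfolding bij_betw_def
      using homeomorphic_imp_injective_map[OF hm] homeomorphic_imp_surjective_map[OF hm] by (rule conjI)
    then have "bij_betw (?f h) ?P ?P" by (simp add: bij_betw_def inj_on_def)
    moreover have "?f h (shift x) = shift (?f h x)" if "x \<in> ?P" for x
      using that sh[OF that] act h by (simp add: shift_action_def)
    ultimately show ?thesis by (simp add: shift_aut_simps(1) Bij_def)
  qed
  have "?f \<in> hom H (shift_aut S)"
  proof (rule homI)
    fix h k assume hk: "h \<in> carrier H" "k \<in> carrier H"
    show "?f (h \<otimes>\<^bsub>H\<^esub> k) = ?f h \<otimes>\<^bsub>shift_aut S\<^esub> ?f k"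
      using hk car maps mult by (simp add: shift_aut_simps(2) compose_def fun_eq_iff restrict_def)
  qed (rule car)
  moreover have "inj_on ?f (carrier H)"
  proof (rule inj_onI)
    fix h k assume hk: "h \<in> carrier H" "k \<in> carrier H" and eq: "?f h = ?f k"
    have "\<Phi> (inv\<^bsub>H\<^esub> h \<otimes>\<^bsub>H\<^esub> k) x = x" if x: "x \<in> ?P" for x
    proof -
      have "\<Phi> h x = \<Phi> k x" using fun_cong[OF eq, of x] x by simp
      then show ?thesis using hk x mult inv(1)[of h x] by simp
    qed
    then have "inv\<^bsub>H\<^esub> h \<otimes>\<^bsub>H\<^esub> k \<in> action_kernel H S \<Phi>" using hk by (simp add: action_kernel_def)
    then have "inv\<^bsub>H\<^esub> h \<otimes>\<^bsub>H\<^esub> k = \<one>\<^bsub>H\<^esub>" using ker by simp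
    then show "h = k" using hk by (metis H.inv_closed H.inv_equality H.inv_inv)
  qed
  ultimately show ?thesis by (simp add: mon_def)
qed

lemma hom_shift_aut_action:
  assumes H: "group H" and fin: "finite S" and hom: "\<phi> \<in> hom H (shift_aut S)"
  shows "shift_action H S \<phi>"
proof -
  interpret H: group H by (rule H)
  let ?P = "points S"
  have car: "\<phi> h \<in> carrier (shift_aut S)" if "h \<in> carrier H" for h
    using hom that by (auto simp: hom_def)
  have mult: "\<phi> (h \<otimes>\<^bsub>H\<^esub> k) x = \<phi> h (\<phi> k x)" if "h \<in> carrier H" "k \<in> carrier H" "x \<in> ?P" for h k x
  proof -
    have "\<phi> (h \<otimes>\<^bsub>H\<^esub> k) = \<phi> h \<otimes>\<^bsub>shift_aut S\<^esub> \<phi> k" using hom that by (simp add: hom_def)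
    then show ?thesis using that by (simp add: shift_aut_simps(2)[OF car car] compose_def)
  qed
  have one: "\<phi> \<one>\<^bsub>H\<^esub> x = x" if x: "x \<in> ?P" for x
  proof -
    have b: "bij_betw (\<phi> \<one>\<^bsub>H\<^esub>) ?P ?P" using car[OF H.one_closed] by (simp add: shift_aut_simps(1) Bij_def)
    then have "\<phi> \<one>\<^bsub>H\<^esub> x \<in> ?P" using x by (auto simp: bij_betw_def)
    moreover have "\<phi> \<one>\<^bsub>H\<^esub> (\<phi> \<one>\<^bsub>H\<^esub> x) = \<phi> \<one>\<^bsub>H\<^esub> x" using mult[of "\<one>\<^bsub>H\<^esub>" "\<one>\<^bsub>H\<^esub>" x] x by simp
    ultimately show ?thesis using b x unfolding bij_betw_def by (meson inj_onD)
  qed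
  have cont: "continuous_map (full_shift S) (full_shift S) (\<phi> h)"
    and sh: "\<And>x. x \<in> ?P \<Longrightarrow> \<phi> h (shift x) = shift (\<phi> h x)" if "h \<in> carrier H" for h
    using car[OF that] by (auto simp: shift_aut_simps(1) homeomorphic_imp_continuous_map)
  have maps: "\<phi> h x \<in> ?P" if "h \<in> carrier H" "x \<in> ?P" for h x
    using cont[OF that(1)] that(2) by (auto simp: continuous_map_def)
  have "window_local S (\<phi> h)" if "h \<in> carrier H" for h
    by (rule local_if_continuous[OF fin cont[OF that]]) (rule sh[OF that])
  then show ?thesis using maps sh mult one by (simp add: shift_action_def)
qed

definition pair_action ::
  "('h \<Rightarrow> (int \<Rightarrow> 's) \<Rightarrow> int \<Rightarrow> 's) \<Rightarrow> ('h \<Rightarrow> (int \<Rightarrow> 't) \<Rightarrow> int \<Rightarrow> 't) \<Rightarrow>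
     'h \<Rightarrow> (int \<Rightarrow> 's \<times> 't) \<Rightarrow> int \<Rightarrow> 's \<times> 't" where
  "pair_action \<Phi> \<Psi> h x = (\<lambda>i. (\<Phi> h (\<lambda>i. fst (x i)) i, \<Psi> h (\<lambda>i. snd (x i)) i))"

lemma mem_full_shift_Times:
  "x \<in> points (S \<times> S') \<longleftrightarrow>
     (\<lambda>i. fst (x i)) \<in> points S \<and> (\<lambda>i. snd (x i)) \<in> points S'"
  by (auto simp: mem_full_shift mem_Times_iff)

lemma shift_action_pair:
  assumes act: "shift_action H S \<Phi>" "shift_action H S' \<Psi>"
  shows "shift_action H (S \<times> S') (pair_action \<Phi> \<Psi>)"
  unfolding shift_action_def
proof (intro conjI ballI)
  fix h assume h: "h \<in> carrier H"
  obtain M M' where M: "has_radius S (\<Phi> h) M" and M': "has_radius S' (\<Psi> h) M'"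
    using shift_action_radius[OF act(1) h] shift_action_radius[OF act(2) h] by blast
  have nn: "0 \<le> M" "0 \<le> M'" using M M' has_radius_nonneg by blast+
  have "has_radius (S \<times> S') (pair_action \<Phi> \<Psi> h) (M + M')"
  proof (rule has_radiusI)
    fix x y j assume xy: "x \<in> points (S \<times> S')" "y \<in> points (S \<times> S')"
      and eq: "\<And>k. \<bar>k - j\<bar> \<le> M + M' \<Longrightarrow> x k = y k"
    have "\<Phi> h (\<lambda>i. fst (x i)) j = \<Phi> h (\<lambda>i. fst (y i)) j"
      using xy nn by (intro has_radiusD[OF M]) (auto simp: mem_full_shift_Times eq)
    moreover have "\<Psi> h (\<lambda>i. snd (x i)) j = \<Psi> h (\<lambda>i. snd (y i)) j"
      using xy nn by (intro has_radiusD[OF M']) (auto simp: mem_full_shift_Times eq)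
    ultimately show "pair_action \<Phi> \<Psi> h x j = pair_action \<Phi> \<Psi> h y j" by (simp add: pair_action_def)
  qed (use nn in simp)
  then show "window_local (S \<times> S') (pair_action \<Phi> \<Psi> h)" unfolding window_local_def by blast
next
  fix x assume x: "x \<in> points (S \<times> S')"
  then have x': "(\<lambda>i. fst (x i)) \<in> points S" "(\<lambda>i. snd (x i)) \<in> points S'"
    by (simp_all add: mem_full_shift_Times)
  then show "pair_action \<Phi> \<Psi> \<one>\<^bsub>H\<^esub> x = x"
    using act by (simp add: pair_action_def shift_action_def)
  fix h assume h: "h \<in> carrier H"
  show "pair_action \<Phi> \<Psi> h x \<in> points (S \<times> S')"
    using act h x' by (simp add: pair_action_def shift_action_def mem_full_shift_Times)
  have "shift (\<lambda>i. fst (x i)) = (\<lambda>i. fst (shift x i))" "shift (\<lambda>i. snd (x i)) = (\<lambda>i. snd (shift x i))"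
    by (simp_all add: shift_def)
  moreover have "\<Phi> h (shift (\<lambda>i. fst (x i))) = shift (\<Phi> h (\<lambda>i. fst (x i)))"
    "\<Psi> h (shift (\<lambda>i. snd (x i))) = shift (\<Psi> h (\<lambda>i. snd (x i)))"
    using act h x' by (simp_all add: shift_action_def)
  ultimately show "pair_action \<Phi> \<Psi> h (shift x) = shift (pair_action \<Phi> \<Psi> h x)"
    by (simp add: pair_action_def) (simp add: shift_def)
  fix k assume "k \<in> carrier H"
  then show "pair_action \<Phi> \<Psi> (h \<otimes>\<^bsub>H\<^esub> k) x = pair_action \<Phi> \<Psi> h (pair_action \<Phi> \<Psi> k x)"
    using act h x' by (simp add: pair_action_def shift_action_def)
qed

text \<open>
Alphabets are nonempty here because a point of one factor has to be completed to a point of the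
product.
\<close>

lemma action_kernel_pair:
  assumes "S \<noteq> {}" "S' \<noteq> {}"
  shows "action_kernel H (S \<times> S') (pair_action \<Phi> \<Psi>) \<subseteq> action_kernel H S \<Phi> \<inter> action_kernel H S' \<Psi>"
proof
  fix h assume "h \<in> action_kernel H (S \<times> S') (pair_action \<Phi> \<Psi>)"
  then have h: "h \<in> carrier H" and id: "\<And>x. x \<in> points (S \<times> S') \<Longrightarrow> pair_action \<Phi> \<Psi> h x = x"
    by (auto simp: action_kernel_def)
  obtain s s' where s: "s \<in> S" "s' \<in> S'" using assms by blast
  have "\<Phi> h x = x \<and> \<Psi> h y = y" if "x \<in> points S" "y \<in> points S'" for x y
  proof -
    have "pair_action \<Phi> \<Psi> h (\<lambda>i. (x i, y i)) = (\<lambda>i. (x i, y i))"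
      using that by (intro id) (simp add: mem_full_shift)
    then show ?thesis by (simp add: pair_action_def fun_eq_iff)
  qed
  moreover have "(\<lambda>_. s) \<in> points S" "(\<lambda>_. s') \<in> points S'"
    using s by (simp_all add: mem_full_shift)
  ultimately show "h \<in> action_kernel H S \<Phi> \<inter> action_kernel H S' \<Psi>"
    using h unfolding action_kernel_def by blast
qed

text \<open>
The alphabets in \<open>class_G\<close> consist of natural numbers, while the constructions below produce other
types of symbols.
\<close>

lemma shift_action_nat:
  assumes fin: "finite S" and act: "shift_action H S \<Phi>"
  shows "\<exists>(S' :: nat set) \<Psi>. finite S' \<and> card S' = card S \<and> shift_action H S' \<Psi> \<and>
    action_kernel H S' \<Psi> \<subseteq> action_kernel H S \<Phi>"
proof -
  obtain e where e: "bij_betw e S {0..<card S}" using ex_bij_betw_finite_nat[OF fin] by blast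
  define d where "d = inv_into S e"
  let ?S = "{0..<card S}"
  have dS: "n \<in> ?S \<Longrightarrow> d n \<in> S" and ed: "n \<in> ?S \<Longrightarrow> e (d n) = n" for n
    using e by (auto simp: d_def bij_betw_def inv_into_into f_inv_into_f)
  have eS: "s \<in> S \<Longrightarrow> e s \<in> ?S" and de: "s \<in> S \<Longrightarrow> d (e s) = s" for s
    using e by (auto simp: d_def bij_betw_def)
  define \<Psi> where "\<Psi> h x = (\<lambda>i. e (\<Phi> h (\<lambda>i. d (x i)) i))" for h x
  have dx: "(\<lambda>i. d (x i)) \<in> points S" if "x \<in> points ?S" for x
    using that dS by (simp add: mem_full_shift)
  have d\<Psi>: "(\<lambda>i. d (\<Psi> h x i)) = \<Phi> h (\<lambda>i. d (x i))"
    if "h \<in> carrier H" "x \<in> points ?S" for h x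
    using shift_action_maps[OF act that(1) dx[OF that(2)]] by (simp add: \<Psi>_def mem_full_shift de)
  have "shift_action H ?S \<Psi>"
    unfolding shift_action_def
  proof (intro conjI ballI)
    fix h assume h: "h \<in> carrier H"
    obtain M where M: "has_radius S (\<Phi> h) M"
      using shift_action_radius[OF act h] by blast
    have "has_radius ?S (\<Psi> h) M"
      unfolding \<Psi>_def
    proof (rule has_radiusI[OF has_radius_nonneg[OF M]])
      fix x y j assume "x \<in> points ?S" "y \<in> points ?S" "\<And>k. \<bar>k - j\<bar> \<le> M \<Longrightarrow> x k = y k"
      then show "e (\<Phi> h (\<lambda>i. d (x i)) j) = e (\<Phi> h (\<lambda>i. d (y i)) j)"
        by (intro arg_cong[of _ _ e] has_radiusD[OF M] dx) simp_all
    qed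
    then show "window_local ?S (\<Psi> h)" unfolding window_local_def by blast
  next
    fix x assume x: "x \<in> points ?S"
    show "\<Psi> \<one>\<^bsub>H\<^esub> x = x"
      using act dx[OF x] x ed by (simp add: \<Psi>_def shift_action_def mem_full_shift)
    fix h assume h: "h \<in> carrier H"
    show "\<Psi> h x \<in> points ?S"
      using shift_action_maps[OF act h dx[OF x]] eS unfolding mem_full_shift \<Psi>_def by blast
    have "\<Phi> h (shift (\<lambda>i. d (x i))) = shift (\<Phi> h (\<lambda>i. d (x i)))"
      using act h dx[OF x] by (simp add: shift_action_def)
    then show "\<Psi> h (shift x) = shift (\<Psi> h x)" by (simp add: \<Psi>_def shift_def)
    fix k assume k: "k \<in> carrier H"
    have "\<Phi> (h \<otimes>\<^bsub>H\<^esub> k) (\<lambda>i. d (x i)) = \<Phi> h (\<Phi> k (\<lambda>i. d (x i)))"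
      using act h k dx[OF x] by (simp add: shift_action_def)
    then show "\<Psi> (h \<otimes>\<^bsub>H\<^esub> k) x = \<Psi> h (\<Psi> k x)"
      unfolding \<Psi>_def[of h "\<Psi> k x"] d\<Psi>[OF k x] by (simp add: \<Psi>_def)
  qed
  moreover have "action_kernel H ?S \<Psi> \<subseteq> action_kernel H S \<Phi>"
  proof
    fix h assume "h \<in> action_kernel H ?S \<Psi>"
    then have h: "h \<in> carrier H" and id: "\<And>x. x \<in> points ?S \<Longrightarrow> \<Psi> h x = x"
      by (auto simp: action_kernel_def)
    have "\<Phi> h x = x" if x: "x \<in> points S" for x
    proof -
      have ex: "(\<lambda>i. e (x i)) \<in> points ?S" using x eS unfolding mem_full_shift by blast
      have "(\<lambda>i. d (e (x i))) = x" using x de by (simp add: mem_full_shift)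
      then show ?thesis using d\<Psi>[OF h ex] id[OF ex] by simp
    qed
    then show "h \<in> action_kernel H S \<Phi>" using h by (simp add: action_kernel_def)
  qed
  ultimately show ?thesis by (intro exI[of _ ?S] exI[of _ \<Psi>]) simp
qed

section \<open>Characters of finitely generated abelian groups\<close>

text \<open>
A pair \<open>(n, \<theta>)\<close> represents a character with values in \<open>\<int>/n\<close>; for \<open>n = 0\<close> its values are integers.
\<close>

definition separating :: "('a, 'm) monoid_scheme \<Rightarrow> 'a set \<Rightarrow> (int \<times> ('a \<Rightarrow> int)) list \<Rightarrow> bool" where
  "separating A B cs \<longleftrightarrow>
     (\<forall>(n, \<theta>)\<in>set cs. 0 \<le> n \<and> (\<forall>a\<in>B. \<forall>b\<in>B. [\<theta> (a \<otimes>\<^bsub>A\<^esub> b) = \<theta> a + \<theta> b] (mod n))) \<and>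
     (\<forall>a\<in>B. (\<forall>(n, \<theta>)\<in>set cs. n dvd \<theta> a) \<longrightarrow> a = \<one>\<^bsub>A\<^esub>)"

lemma separating_mono: "separating A B cs \<Longrightarrow> B' \<subseteq> B \<Longrightarrow> separating A B' cs"
  unfolding separating_def by fast

lemma exponents_in_subgroup:
  fixes A (structure)
  assumes A: "group A" and B: "subgroup B A" and c: "c \<in> carrier A"
  shows "\<exists>m\<ge>0. \<forall>k. c [^] (k::int) \<in> B \<longleftrightarrow> m dvd k"
proof (cases "\<exists>k::int. k \<noteq> 0 \<and> c [^] k \<in> B")
  case False
  interpret A: group A by (rule A)
  have "c [^] (0::int) \<in> B" using B by (simp add: subgroup.one_closed)
  then show ?thesis using False by (intro exI[of _ 0]) auto
next
  case True
  interpret A: group A by (rule A)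
  define P where "P k \<longleftrightarrow> 0 < k \<and> c [^] (int k) \<in> B" for k :: nat
  have neg: "c [^] (- k) \<in> B" if "c [^] k \<in> B" for k :: int
    using that c B by (simp add: A.int_pow_neg subgroup.m_inv_closed)
  obtain k :: int where k: "k \<noteq> 0" "c [^] k \<in> B" using True by blast
  then have "P (nat \<bar>k\<bar>)" using neg[of k] by (cases "0 \<le> k") (auto simp: P_def)
  then have m: "P (LEAST k. P k)" by (rule LeastI)
  define m where "m = int (LEAST k. P k)"
  have m0: "0 < m" and mB: "c [^] m \<in> B" using m by (auto simp: m_def P_def)
  have mult: "c [^] (m * q) \<in> B" for q :: int
    using A.int_pow_closed A.subgroup_int_pow_closed[OF B mB] c by (simp add: A.int_pow_pow)
  have "m dvd k" if kB: "c [^] k \<in> B" for k :: int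
  proof (rule ccontr)
    assume "\<not> m dvd k"
    then have r: "0 < k mod m" "k mod m < m"
      using pos_mod_sign[OF m0, of k] pos_mod_bound[OF m0, of k] by (simp_all add: dvd_eq_mod_eq_0)
    have "k mod m = k + m * (- (k div m))" by (simp add: minus_mult_div_eq_mod[symmetric])
    then have "c [^] (k mod m) = c [^] k \<otimes> c [^] (m * (- (k div m)))"
      using A.int_pow_mult[OF c] by presburger
    then have "c [^] (k mod m) \<in> B"
      using subgroup.m_closed[OF B kB mult[of "- (k div m)"]] by (simp only:)
    then have "P (nat (k mod m))" using r by (simp add: P_def)
    then have "(LEAST k. P k) \<le> nat (k mod m)" by (rule Least_le)
    then show False using r by (simp add: m_def)
  qed
  moreover have "c [^] k \<in> B" if "m dvd k" for k using that mult by (auto simp: dvd_def)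
  ultimately show ?thesis using m0 by (intro exI[of _ m]) auto
qed

text \<open>
Let \<open>m\<close> generate the group of exponents \<open>k\<close> with \<open>c\<^sup>k \<in> B\<close>. In \<open>b c\<^sup>k\<close> the exponent is determined
modulo \<open>m\<close>, and this new character vanishes exactly on \<open>B\<close>. A character \<open>\<theta>\<close> of \<open>B\<close> with values in \<open>\<int>/n\<close>
extends if its value at \<open>c\<^sup>m\<close> can be divided by \<open>m\<close>. Instead of dividing, \<open>\<theta>\<close> is multiplied by \<open>m\<close> and
regarded modulo \<open>n m\<close>, which does not change its kernel.
\<close>

lemma separating_extend:
  fixes A (structure)
  assumes A: "comm_group A" and B: "subgroup B A" and c: "c \<in> carrier A" and cs: "separating A B cs"
  shows "\<exists>cs'. separating A {b \<otimes> c [^] (k::int) |b k. b \<in> B} cs'"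
proof -
  interpret A: comm_group A by (rule A)
  let ?Y = "{b \<otimes> c [^] (k::int) |b k. b \<in> B}"
  have BA: "b \<in> carrier A" if "b \<in> B" for b using B that by (rule subgroup.mem_carrier)
  have pc: "c [^] k \<in> carrier A" for k :: int using c by simp
  obtain m where m0: "0 \<le> m" and m: "\<And>k. c [^] (k::int) \<in> B \<longleftrightarrow> m dvd k"
    using exponents_in_subgroup[OF A.group_axioms B c] by blast
  define b0 where "b0 = c [^] m"
  have b0: "b0 \<in> B" using m by (simp add: b0_def)
  have b0q: "b0 [^] q = c [^] (m * q)" for q :: int using c by (simp add: b0_def A.int_pow_pow)
  have b0qB: "b0 [^] (q::int) \<in> B" for q using A.subgroup_int_pow_closed[OF B b0] .
  define rp where "rp y = (SOME p. fst p \<in> B \<and> y = fst p \<otimes> c [^] (snd p :: int))" for y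
  define \<beta> \<kappa> where "\<beta> y = fst (rp y)" and "\<kappa> y = snd (rp y)" for y
  have rp: "\<beta> y \<in> B \<and> y = \<beta> y \<otimes> c [^] \<kappa> y" if yY: "y \<in> ?Y" for y
  proof -
    obtain b k where "b \<in> B" "y = b \<otimes> c [^] (k::int)" using yY by blast
    then have "\<exists>p. fst p \<in> B \<and> y = fst p \<otimes> c [^] (snd p :: int)"
      by (intro exI[of _ "(b, k)"]) simp
    from someI_ex[OF this] show ?thesis unfolding \<beta>_def \<kappa>_def rp_def .
  qed
  have \<beta>: "\<beta> y \<in> B" if "y \<in> ?Y" for y using rp[OF that] by (rule conjunct1)
  have \<kappa>: "y = \<beta> y \<otimes> c [^] \<kappa> y" if "y \<in> ?Y" for y using rp[OF that] by (rule conjunct2)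
  \<comment> \<open>two representations of one element differ by a power of \<open>b0\<close>\<close>
  have rep: "\<exists>q. k' = k + m * q \<and> b' \<otimes> b0 [^] q = b \<and> (m = 0 \<longrightarrow> q = 0)"
    if b: "b \<in> B" "b' \<in> B" and eq: "b \<otimes> c [^] k = b' \<otimes> c [^] (k'::int)" for b b' k k'
  proof -
    have "b' \<otimes> c [^] (k' - k) \<otimes> c [^] k = b \<otimes> c [^] k"
      using eq b BA pc c A.int_pow_mult[OF c, of "k' - k" k] by (simp add: A.m_assoc)
    then have d: "b' \<otimes> c [^] (k' - k) = b"
      using b BA pc A.right_cancel[of "c [^] k" "b' \<otimes> c [^] (k' - k)" b] by simp
    then have "c [^] (k' - k) = inv b' \<otimes> b"
      using b BA pc A.inv_solve_left[of "c [^] (k' - k)" b' b] by simp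
    then have "c [^] (k' - k) \<in> B" using b B by (simp add: subgroup.m_closed subgroup.m_inv_closed)
    then obtain q where q: "k' - k = m * q" using m by (auto simp: dvd_def)
    show ?thesis
    proof (cases "m = 0")
      case True
      then show ?thesis using d q b BA by (intro exI[of _ 0]) simp
    next
      case False
      then show ?thesis using d q by (intro exI[of _ q]) (simp add: b0q)
    qed
  qed
  have \<theta>_pow: "[\<theta> (b0 [^] (q::int)) = q * \<theta> b0] (mod n)" if "(n, \<theta>) \<in> set cs" for n \<theta> q
  proof -
    have add: "[\<theta> (a \<otimes> b) = \<theta> a + \<theta> b] (mod n)" if "a \<in> B" "b \<in> B" for a b
      using cs that \<open>(n, \<theta>) \<in> set cs\<close> unfolding separating_def by blast
    have one: "[\<theta> \<one> = 0] (mod n)"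
      using add[of "\<one>" "\<one>"] subgroup.one_closed[OF B] by (simp add: cong_iff_dvd_diff)
    have step: "[\<theta> (b0 [^] (q + 1)) = \<theta> (b0 [^] q) + \<theta> b0] (mod n)" for q :: int
      using add[OF b0qB b0] A.int_pow_mult[OF BA[OF b0], of q 1] BA[OF b0] by simp
    show ?thesis
    proof (induction q rule: int_induct[of _ 0])
      case (step1 q)
      have "[\<theta> (b0 [^] (q + 1)) = q * \<theta> b0 + \<theta> b0] (mod n)"
        using step[of q] cong_add[OF step1(2) cong_refl] by (rule cong_trans)
      then show ?case by (simp add: distrib_right)
    next
      case (step2 q)
      have "[\<theta> (b0 [^] (q - 1)) + \<theta> b0 = q * \<theta> b0] (mod n)"
        using step[of "q - 1"] step2(2) by (metis cong_sym cong_trans diff_add_cancel)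
      then have "[\<theta> (b0 [^] (q - 1)) + \<theta> b0 = (q - 1) * \<theta> b0 + \<theta> b0] (mod n)"
        by (simp add: left_diff_distrib)
      then show ?case by (simp add: cong_add_rcancel)
    qed (use one in simp)
  qed
  \<comment> \<open>If \<open>m = 0\<close>, then every character of \<open>B\<close> extends by zero; multiplication by \<open>0\<close> would lose it.\<close>
  define M where "M = (if m = 0 then 1 else m)"
  have M0: "0 < M" using m0 by (simp add: M_def)
  define lift where "lift = (\<lambda>(n, \<theta>). (n * M, \<lambda>y. M * \<theta> (\<beta> y) + \<kappa> y * \<theta> b0))"
  have "separating A ?Y ((m, \<kappa>) # map lift cs)"
    unfolding separating_def
  proof (intro conjI ballI impI)
    fix p assume p: "p \<in> set ((m, \<kappa>) # map lift cs)"
    have sum: "\<exists>q. \<kappa> x + \<kappa> y = \<kappa> (x \<otimes> y) + m * q \<and> \<beta> x \<otimes> \<beta> y \<otimes> b0 [^] q = \<beta> (x \<otimes> y) \<and> (m = 0 \<longrightarrow> q = 0)"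
      if xy: "x \<in> ?Y" "y \<in> ?Y" for x y
    proof -
      have b: "\<beta> x \<in> carrier A" "\<beta> y \<in> carrier A" using \<beta> xy BA by auto
      have "x \<otimes> y = (\<beta> x \<otimes> c [^] \<kappa> x) \<otimes> (\<beta> y \<otimes> c [^] \<kappa> y)"
        using \<kappa>[OF xy(1)] \<kappa>[OF xy(2)] by simp
      also have "\<dots> = (\<beta> x \<otimes> \<beta> y) \<otimes> c [^] (\<kappa> x + \<kappa> y)"
        using b pc by (simp add: A.int_pow_mult[OF c] A.m_ac)
      finally have e: "x \<otimes> y = (\<beta> x \<otimes> \<beta> y) \<otimes> c [^] (\<kappa> x + \<kappa> y)" .
      have bb: "\<beta> x \<otimes> \<beta> y \<in> B" using \<beta> xy B by (simp add: subgroup.m_closed)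
      then have Y: "x \<otimes> y \<in> ?Y" using e by blast
      show ?thesis
        using rep[of "\<beta> (x \<otimes> y)" "\<beta> x \<otimes> \<beta> y" "\<kappa> (x \<otimes> y)" "\<kappa> x + \<kappa> y"] \<beta>[OF Y] bb e \<kappa>[OF Y]
        by metis
    qed
    show "case p of (n, \<theta>) \<Rightarrow> 0 \<le> n \<and> (\<forall>x\<in>?Y. \<forall>y\<in>?Y. [\<theta> (x \<otimes> y) = \<theta> x + \<theta> y] (mod n))"
    proof (cases "p = (m, \<kappa>)")
      case True
      have "[\<kappa> (x \<otimes> y) = \<kappa> x + \<kappa> y] (mod m)" if "x \<in> ?Y" "y \<in> ?Y" for x y
        using sum[OF that] by (auto simp: cong_iff_dvd_diff)
      then show ?thesis using True m0 by simp
    next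
      case False
      then obtain n \<theta> where n\<theta>: "(n, \<theta>) \<in> set cs" and p: "p = lift (n, \<theta>)" using p by auto
      have n0: "0 \<le> n" and add: "\<And>a b. a \<in> B \<Longrightarrow> b \<in> B \<Longrightarrow> [\<theta> (a \<otimes> b) = \<theta> a + \<theta> b] (mod n)"
        using cs n\<theta> unfolding separating_def by blast+
      have "[M * \<theta> (\<beta> (x \<otimes> y)) + \<kappa> (x \<otimes> y) * \<theta> b0
          = (M * \<theta> (\<beta> x) + \<kappa> x * \<theta> b0) + (M * \<theta> (\<beta> y) + \<kappa> y * \<theta> b0)] (mod n * M)"
        if xy: "x \<in> ?Y" "y \<in> ?Y" for x y
      proof -
        obtain q where q: "\<kappa> x + \<kappa> y = \<kappa> (x \<otimes> y) + m * q"
            "\<beta> x \<otimes> \<beta> y \<otimes> b0 [^] q = \<beta> (x \<otimes> y)" "m = 0 \<longrightarrow> q = 0"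
          using sum[OF xy] by blast
        have mq: "m * q = M * q" using q(3) by (simp add: M_def)
        have bb: "\<beta> x \<otimes> \<beta> y \<in> B" using \<beta> xy B by (simp add: subgroup.m_closed)
        have "[\<theta> (\<beta> (x \<otimes> y)) = \<theta> (\<beta> x \<otimes> \<beta> y) + \<theta> (b0 [^] q)] (mod n)"
          using add[OF bb b0qB[of q]] q(2) by simp
        also have "[\<theta> (\<beta> x \<otimes> \<beta> y) + \<theta> (b0 [^] q) = (\<theta> (\<beta> x) + \<theta> (\<beta> y)) + q * \<theta> b0] (mod n)"
          using add \<beta> xy \<theta>_pow[OF n\<theta>] by (intro cong_add) auto
        finally have "n dvd \<theta> (\<beta> (x \<otimes> y)) - ((\<theta> (\<beta> x) + \<theta> (\<beta> y)) + q * \<theta> b0)"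
          by (simp add: cong_iff_dvd_diff)
        then have "n * M dvd (\<theta> (\<beta> (x \<otimes> y)) - ((\<theta> (\<beta> x) + \<theta> (\<beta> y)) + q * \<theta> b0)) * M"
          by (rule mult_dvd_mono) simp
        moreover have k: "\<kappa> (x \<otimes> y) = \<kappa> x + \<kappa> y - M * q" using q(1) mq by simp
        ultimately show ?thesis
          unfolding cong_iff_dvd_diff k by (simp add: algebra_simps)
      qed
      then show ?thesis using p n0 M0 by (simp add: lift_def)
    qed
  next
    fix y assume y: "y \<in> ?Y" and all: "\<forall>p\<in>set ((m, \<kappa>) # map lift cs). case p of (n, \<theta>) \<Rightarrow> n dvd \<theta> y"
    have "m dvd \<kappa> y" using all by simp
    then have "c [^] \<kappa> y \<in> B" using m by blast
    then have yB: "y \<in> B" using \<kappa>[OF y] \<beta>[OF y] B by (metis subgroup.m_closed)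
    have "n dvd \<theta> y" if n\<theta>: "(n, \<theta>) \<in> set cs" for n \<theta>
    proof -
      have add: "\<And>a b. a \<in> B \<Longrightarrow> b \<in> B \<Longrightarrow> [\<theta> (a \<otimes> b) = \<theta> a + \<theta> b] (mod n)"
        using cs n\<theta> unfolding separating_def by blast
      have "y \<otimes> c [^] (0::int) = \<beta> y \<otimes> c [^] \<kappa> y"
        using \<kappa>[OF y] BA[OF yB] by simp
      then obtain q where q: "\<kappa> y = 0 + m * q" "\<beta> y \<otimes> b0 [^] q = y" "m = 0 \<longrightarrow> q = 0"
        using rep[OF yB \<beta>[OF y]] by blast
      have mq: "m * q = M * q" using q(3) by (simp add: M_def)
      have "[\<theta> y = \<theta> (\<beta> y) + \<theta> (b0 [^] q)] (mod n)" using add[OF \<beta>[OF y] b0qB[of q]] q(2) by simp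
      also have "[\<theta> (\<beta> y) + \<theta> (b0 [^] q) = \<theta> (\<beta> y) + q * \<theta> b0] (mod n)"
        using \<theta>_pow[OF n\<theta>] by (intro cong_add) auto
      finally have d: "n dvd \<theta> y - (\<theta> (\<beta> y) + q * \<theta> b0)" by (simp add: cong_iff_dvd_diff)
      have "n * M dvd M * \<theta> (\<beta> y) + \<kappa> y * \<theta> b0" using all n\<theta> by (force simp: lift_def)
      also have "M * \<theta> (\<beta> y) + \<kappa> y * \<theta> b0 = (\<theta> (\<beta> y) + q * \<theta> b0) * M"
        using q(1) mq by (simp add: algebra_simps)
      finally have "n dvd \<theta> (\<beta> y) + q * \<theta> b0" using M0 by simp
      from dvd_add[OF d this] show ?thesis by simp
    qed
    then show "y = \<one>" using cs yB unfolding separating_def by blast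
  qed
  then show ?thesis by blast
qed

lemma generate_insert_subset:
  fixes A (structure)
  assumes A: "comm_group A" and X: "X \<subseteq> carrier A" and c: "c \<in> carrier A"
  shows "generate A (insert c X) \<subseteq> {b \<otimes> c [^] (k::int) |b k. b \<in> generate A X}"
proof -
  interpret A: comm_group A by (rule A)
  let ?B = "generate A X" and ?Y = "{b \<otimes> c [^] (k::int) |b k. b \<in> generate A X}"
  have B: "subgroup ?B A" using X by (rule A.generate_is_subgroup)
  have BA: "b \<in> carrier A" if "b \<in> ?B" for b using B that by (rule subgroup.mem_carrier)
  have "subgroup ?Y A"
  proof (rule A.subgroupI)
    show "?Y \<subseteq> carrier A" using BA c by auto
    show "?Y \<noteq> {}" using subgroup.one_closed[OF B] by blast
  next
    fix y assume "y \<in> ?Y"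
    then obtain b k where y: "b \<in> ?B" "y = b \<otimes> c [^] (k::int)" by blast
    then have "inv y = inv b \<otimes> c [^] (- k)"
      using BA c by (simp add: A.inv_mult A.int_pow_neg)
    then show "inv y \<in> ?Y" using subgroup.m_inv_closed[OF B y(1)] by blast
  next
    fix x y assume "x \<in> ?Y" "y \<in> ?Y"
    then obtain b k b' k' where xy: "b \<in> ?B" "x = b \<otimes> c [^] (k::int)"
      "b' \<in> ?B" "y = b' \<otimes> c [^] (k'::int)" by blast
    then have "x \<otimes> y = (b \<otimes> b') \<otimes> c [^] (k + k')"
      using BA c by (simp add: A.int_pow_mult A.m_ac)
    then show "x \<otimes> y \<in> ?Y" using subgroup.m_closed[OF B xy(1,3)] by blast
  qed
  moreover have "insert c X \<subseteq> ?Y"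
  proof
    fix x assume "x \<in> insert c X"
    then consider "x = c" | "x \<in> X" by blast
    then show "x \<in> ?Y"
    proof cases
      case 1
      then have "x = \<one> \<otimes> c [^] (1::int)" using c by simp
      then show ?thesis using subgroup.one_closed[OF B] by blast
    next
      case 2
      then have "x \<in> ?B" by (rule generate.incl)
      moreover have "x = x \<otimes> c [^] (0::int)" using 2 X by auto
      ultimately show ?thesis by blast
    qed
  qed
  ultimately show ?thesis using A.generate_subgroup_incl by blast
qed

lemma separating_characters:
  fixes A (structure)
  assumes A: "comm_group A" and fg: "finitely_generated A"
  shows "\<exists>cs. separating A (carrier A) cs"
proof -
  interpret A: comm_group A by (rule A)
  have "\<exists>cs. separating A (generate A X) cs" if "finite X" "X \<subseteq> carrier A" for X
    using that
  proof (induction X rule: finite_induct)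
    case empty
    have "separating A (generate A {}) []" by (auto simp: separating_def A.generate_empty)
    then show ?case by blast
  next
    case (insert c X)
    then obtain cs where "separating A (generate A X) cs" by blast
    have X: "X \<subseteq> carrier A" and c: "c \<in> carrier A" using insert by auto
    obtain cs' where "separating A {b \<otimes> c [^] (k::int) |b k. b \<in> generate A X} cs'"
      using separating_extend[OF A A.generate_is_subgroup[OF X] c] \<open>separating A (generate A X) cs\<close> by blast
    then show ?case using separating_mono generate_insert_subset[OF A X c] by blast
  qed
  then show ?thesis using fg unfolding finitely_generated_def by metis
qed

section \<open>Restricted wreath products\<close>

locale wreath = A: comm_group A + G: group G
  for A :: "('a, 'm) monoid_scheme" (structure) and G :: "('g, 'n) monoid_scheme"
begin

definition lamps :: "('g \<Rightarrow> 'a) set" where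
  "lamps = carrier (sum_group (carrier G) (\<lambda>_. A))"

lemma lamps_iff:
  "u \<in> lamps \<longleftrightarrow> u \<in> carrier G \<rightarrow>\<^sub>E carrier A \<and> finite {g \<in> carrier G. u g \<noteq> \<one>}"
  unfolding lamps_def by (subst carrier_sum_group) (auto simp: A.group_axioms)

lemma lamps_closed: "u \<in> lamps \<Longrightarrow> g \<in> carrier G \<Longrightarrow> u g \<in> carrier A"
  by (auto simp: lamps_iff)

definition lamp_mult :: "('g \<Rightarrow> 'a) \<Rightarrow> ('g \<Rightarrow> 'a) \<Rightarrow> 'g \<Rightarrow> 'a" where
  "lamp_mult u u' = (\<lambda>g\<in>carrier G. u g \<otimes> u' g)"

definition lamp_move :: "'g \<Rightarrow> ('g \<Rightarrow> 'a) \<Rightarrow> 'g \<Rightarrow> 'a" where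
  "lamp_move h u = (\<lambda>g\<in>carrier G. u (inv\<^bsub>G\<^esub> h \<otimes>\<^bsub>G\<^esub> g))"

lemma lamp_mult_closed:
  assumes "u \<in> lamps" "u' \<in> lamps" shows "lamp_mult u u' \<in> lamps"
proof -
  interpret W: group "sum_group (carrier G) (\<lambda>_. A)" by (simp add: A.group_axioms)
  show ?thesis using W.m_closed[of u u'] assms by (simp add: lamps_def lamp_mult_def)
qed

lemma lamp_move_closed:
  assumes "u \<in> lamps" "h \<in> carrier G" shows "lamp_move h u \<in> lamps"
proof -
  have "{g \<in> carrier G. lamp_move h u g \<noteq> \<one>} \<subseteq> (\<lambda>g. h \<otimes>\<^bsub>G\<^esub> g) ` {g \<in> carrier G. u g \<noteq> \<one>}"
  proof
    fix g assume g: "g \<in> {g \<in> carrier G. lamp_move h u g \<noteq> \<one>}"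
    then have "g = h \<otimes>\<^bsub>G\<^esub> (inv\<^bsub>G\<^esub> h \<otimes>\<^bsub>G\<^esub> g)"
      using assms by (simp add: G.m_assoc[symmetric] G.r_inv)
    then show "g \<in> (\<lambda>g. h \<otimes>\<^bsub>G\<^esub> g) ` {g \<in> carrier G. u g \<noteq> \<one>}"
      using g assms by (intro image_eqI) (auto simp: lamp_move_def)
  qed
  then have "finite {g \<in> carrier G. lamp_move h u g \<noteq> \<one>}"
    by (rule finite_surj[rotated]) (use assms in \<open>simp add: lamps_iff\<close>)
  moreover have "lamp_move h u \<in> carrier G \<rightarrow>\<^sub>E carrier A"
    using assms by (auto simp: lamp_move_def lamps_closed)
  ultimately show ?thesis unfolding lamps_iff by blast
qed

lemma carrier_wreath: "carrier (wreath_product A G) = lamps \<times> carrier G"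
  by (simp add: wreath_product_def semidirect_product_def lamps_def)

lemma mult_wreath:
  "(u, h) \<otimes>\<^bsub>wreath_product A G\<^esub> (u', h') = (lamp_mult u (lamp_move h u'), h \<otimes>\<^bsub>G\<^esub> h')"
  by (simp add: wreath_product_def semidirect_product_def lamp_mult_def lamp_move_def)

lemma one_wreath: "\<one>\<^bsub>wreath_product A G\<^esub> = (\<lambda>g\<in>carrier G. \<one>, \<one>\<^bsub>G\<^esub>)"
  by (simp add: wreath_product_def semidirect_product_def)

lemma lamps_ext:
  assumes "u \<in> lamps" "v \<in> lamps" "\<And>g. g \<in> carrier G \<Longrightarrow> u g = v g"
  shows "u = v"
  using assms by (auto simp: lamps_iff intro: PiE_ext)

lemma one_lamps: "(\<lambda>g\<in>carrier G. \<one>) \<in> lamps"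
proof -
  have "{g \<in> carrier G. (\<lambda>g\<in>carrier G. \<one>) g \<noteq> \<one>} = {}" by auto
  then have "finite {g \<in> carrier G. (\<lambda>g\<in>carrier G. \<one>) g \<noteq> \<one>}" by (simp only: finite.emptyI)
  then show ?thesis unfolding lamps_iff by simp
qed

lemma inv_lamps:
  assumes "u \<in> lamps" shows "(\<lambda>g\<in>carrier G. inv (u g)) \<in> lamps"
proof -
  have "{g \<in> carrier G. (\<lambda>g\<in>carrier G. inv (u g)) g \<noteq> \<one>} \<subseteq> {g \<in> carrier G. u g \<noteq> \<one>}"
    by auto
  then have "finite {g \<in> carrier G. (\<lambda>g\<in>carrier G. inv (u g)) g \<noteq> \<one>}"
    using assms finite_subset unfolding lamps_iff by blast
  then show ?thesis using lamps_closed[OF assms] unfolding lamps_iff by simp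
qed

lemma group_wreath: "group (wreath_product A G)"
proof (rule groupI)
  fix p q assume p: "p \<in> carrier (wreath_product A G)" and q: "q \<in> carrier (wreath_product A G)"
  obtain u h v k where pq: "p = (u, h)" "q = (v, k)" by fastforce
  show "p \<otimes>\<^bsub>wreath_product A G\<^esub> q \<in> carrier (wreath_product A G)"
    using p q by (simp add: pq carrier_wreath mult_wreath lamp_mult_closed lamp_move_closed)
  fix s assume s: "s \<in> carrier (wreath_product A G)"
  obtain w l where sw: "s = (w, l)" by fastforce
  have mem: "u \<in> lamps" "v \<in> lamps" "w \<in> lamps" "h \<in> carrier G" "k \<in> carrier G" "l \<in> carrier G"
    using p q s by (simp_all add: pq sw carrier_wreath)
  have "lamp_mult (lamp_mult u (lamp_move h v)) (lamp_move (h \<otimes>\<^bsub>G\<^esub> k) w)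
      = lamp_mult u (lamp_move h (lamp_mult v (lamp_move k w)))"
  proof (rule lamps_ext)
    fix g assume g: "g \<in> carrier G"
    then show "lamp_mult (lamp_mult u (lamp_move h v)) (lamp_move (h \<otimes>\<^bsub>G\<^esub> k) w) g
        = lamp_mult u (lamp_move h (lamp_mult v (lamp_move k w))) g"
      using mem by (simp add: lamp_mult_def lamp_move_def lamps_closed A.m_assoc G.inv_mult_group G.m_assoc)
  qed (use mem in \<open>simp_all add: lamp_mult_closed lamp_move_closed\<close>)
  then show "p \<otimes>\<^bsub>wreath_product A G\<^esub> q \<otimes>\<^bsub>wreath_product A G\<^esub> s
      = p \<otimes>\<^bsub>wreath_product A G\<^esub> (q \<otimes>\<^bsub>wreath_product A G\<^esub> s)"
    using mem by (simp add: pq sw mult_wreath G.m_assoc)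
next
  show "\<one>\<^bsub>wreath_product A G\<^esub> \<in> carrier (wreath_product A G)"
    by (simp add: one_wreath carrier_wreath one_lamps)
next
  fix p assume p: "p \<in> carrier (wreath_product A G)"
  obtain u h where pu: "p = (u, h)" by fastforce
  have mem: "u \<in> lamps" "h \<in> carrier G" using p by (simp_all add: pu carrier_wreath)
  have "lamp_mult (\<lambda>g\<in>carrier G. \<one>) (lamp_move \<one>\<^bsub>G\<^esub> u) = u"
  proof (rule lamps_ext)
    fix g assume "g \<in> carrier G"
    then show "lamp_mult (\<lambda>g\<in>carrier G. \<one>) (lamp_move \<one>\<^bsub>G\<^esub> u) g = u g"
      using mem by (simp add: lamp_mult_def lamp_move_def lamps_closed)
  qed (use mem in \<open>simp_all add: lamp_mult_closed lamp_move_closed one_lamps\<close>)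
  then show "\<one>\<^bsub>wreath_product A G\<^esub> \<otimes>\<^bsub>wreath_product A G\<^esub> p = p"
    using mem by (simp add: pu one_wreath mult_wreath)
  define v where "v = lamp_move (inv\<^bsub>G\<^esub> h) (\<lambda>g\<in>carrier G. inv (u g))"
  have v: "v \<in> lamps" using mem by (simp add: v_def lamp_move_closed inv_lamps)
  have "lamp_mult v (lamp_move (inv\<^bsub>G\<^esub> h) u) = (\<lambda>g\<in>carrier G. \<one>)"
  proof (rule lamps_ext)
    fix g assume "g \<in> carrier G"
    then show "lamp_mult v (lamp_move (inv\<^bsub>G\<^esub> h) u) g = (\<lambda>g\<in>carrier G. \<one>) g"
      using mem by (simp add: v_def lamp_mult_def lamp_move_def lamps_closed A.l_inv)
  qed (use mem v in \<open>simp_all add: lamp_mult_closed lamp_move_closed one_lamps\<close>)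
  then have "(v, inv\<^bsub>G\<^esub> h) \<otimes>\<^bsub>wreath_product A G\<^esub> p = \<one>\<^bsub>wreath_product A G\<^esub>"
    using mem by (simp add: pu one_wreath mult_wreath G.l_inv)
  moreover have "(v, inv\<^bsub>G\<^esub> h) \<in> carrier (wreath_product A G)"
    using mem v by (simp add: carrier_wreath)
  ultimately show "\<exists>q\<in>carrier (wreath_product A G). q \<otimes>\<^bsub>wreath_product A G\<^esub> p = \<one>\<^bsub>wreath_product A G\<^esub>"
    by blast
qed

end

section \<open>Walks on conveyor belts\<close>

definition dir :: "bool \<Rightarrow> int" where
  "dir b = (if b then 1 else - 1)"

lemma dir_simps [simp]: "dir True = 1" "dir False = - 1" "dir (\<not> b) = - dir b"
    "dir b * dir b = 1" "\<bar>dir b\<bar> = 1"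
  by (cases b; simp add: dir_def)+

text \<open>
Side \<open>True\<close> of a cell is traversed to the right and side \<open>False\<close> to the left. The walk changes sides
where the run of cells with property \<open>L\<close> ends, so that it stays within the run.
\<close>

definition belt_step :: "(int \<Rightarrow> bool) \<Rightarrow> int \<times> bool \<Rightarrow> int \<times> bool" where
  "belt_step L = (\<lambda>(i, b). if L i \<and> L (i + dir b) then (i + dir b, b) else (i, \<not> b))"

definition belt_back :: "(int \<Rightarrow> bool) \<Rightarrow> int \<times> bool \<Rightarrow> int \<times> bool" where
  "belt_back L = (\<lambda>(i, b). if L i \<and> L (i - dir b) then (i - dir b, b) else (i, \<not> b))"

lemma belt_back_step [simp]: "belt_back L (belt_step L p) = p"
  by (cases p) (auto simp: belt_step_def belt_back_def)

lemma belt_step_back [simp]: "belt_step L (belt_back L p) = p"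
  by (cases p) (auto simp: belt_step_def belt_back_def)

definition walk :: "(int \<Rightarrow> bool) \<Rightarrow> int \<Rightarrow> int \<times> bool \<Rightarrow> int \<times> bool" where
  "walk L t p = (if 0 \<le> t then (belt_step L ^^ nat t) p else (belt_back L ^^ nat (- t)) p)"

lemma walk_0 [simp]: "walk L 0 p = p"
  by (simp add: walk_def)

lemma walk_succ: "walk L (t + 1) p = belt_step L (walk L t p)"
proof (cases "0 \<le> t")
  case True
  then have "nat (t + 1) = Suc (nat t)" by simp
  with True show ?thesis by (simp add: walk_def)
next
  case False
  then have "nat (- t) = Suc (nat (- (t + 1)))" by simp
  with False show ?thesis
    by (cases "t = - 1") (simp_all add: walk_def)
qed

lemma walk_pred: "walk L (t - 1) p = belt_back L (walk L t p)"
  using walk_succ[of L "t - 1" p] by simp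

lemma walk_add: "walk L (s + t) p = walk L s (walk L t p)"
proof (induction s rule: int_induct[of _ 0])
  case (step1 i)
  then show ?case using walk_succ[of L "i + t" p] walk_succ[of L i "walk L t p"]
    by (simp add: algebra_simps)
next
  case (step2 i)
  then show ?case using walk_pred[of L "i + t" p] walk_pred[of L i "walk L t p"]
    by (simp add: algebra_simps)
qed simp

definition linked :: "(int \<Rightarrow> bool) \<Rightarrow> int \<Rightarrow> int \<Rightarrow> bool" where
  "linked L i j \<longleftrightarrow> (\<forall>k\<in>{min i j..max i j}. L k)"

lemma linked_refl: "linked L i i \<longleftrightarrow> L i"
  by (simp add: linked_def)

lemma linked_sym: "linked L i j \<Longrightarrow> linked L j i"
  by (simp add: linked_def min.commute max.commute)

lemma linked_trans: "linked L i j \<Longrightarrow> linked L j k \<Longrightarrow> linked L i k"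
  unfolding linked_def by (auto simp: min_def max_def split: if_splits)

lemma linked_ends: "linked L i j \<Longrightarrow> L i" "linked L i j \<Longrightarrow> L j"
  by (auto simp: linked_def)

lemma linked_step: "L i \<Longrightarrow> L (i + dir b) \<Longrightarrow> linked L i (i + dir b)"
proof -
  assume L: "L i" "L (i + dir b)"
  have "{min i (i + dir b)..max i (i + dir b)} = {i, i + dir b}"
    by (cases b) auto
  with L show ?thesis by (auto simp: linked_def)
qed

lemma linked_ahead_Suc:
  assumes "0 \<le> n"
  shows "linked L i (i + (n + 1) * dir b) \<longleftrightarrow> L i \<and> linked L (i + dir b) (i + dir b + n * dir b)"
proof -
  have "{min i (i + (n + 1) * dir b)..max i (i + (n + 1) * dir b)}
      = insert i {min (i + dir b) (i + dir b + n * dir b)..max (i + dir b) (i + dir b + n * dir b)}"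
    using assms by (cases b) auto
  then show ?thesis by (simp add: linked_def)
qed

lemma linked_between:
  assumes "linked L i (i + n * dir b)" "0 \<le> m" "m \<le> n"
  shows "linked L i (i + m * dir b)" "linked L (i + m * dir b) (i + n * dir b)"
  using assms by (cases b; auto simp: linked_def)+

lemma walk_linked_dist:
  assumes "L i"
  shows "linked L i (fst (walk L t (i, b))) \<and> \<bar>fst (walk L t (i, b)) - i\<bar> \<le> \<bar>t\<bar>"
proof (induction t rule: int_induct[of _ 0])
  case base
  show ?case using assms by (simp add: linked_refl)
next
  case (step1 t)
  obtain j c where w: "walk L t (i, b) = (j, c)" by fastforce
  show ?case
  proof (cases "L j \<and> L (j + dir c)")
    case True
    then show ?thesis using step1 w linked_trans[of L i j] linked_step[of L j c]
      by (cases c) (auto simp: walk_succ belt_step_def)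
  qed (use step1 w in \<open>auto simp: walk_succ belt_step_def\<close>)
next
  case (step2 t)
  obtain j c where w: "walk L t (i, b) = (j, c)" by fastforce
  show ?case
  proof (cases "L j \<and> L (j - dir c)")
    case True
    then show ?thesis using step2 w linked_trans[of L i j] linked_step[of L j "\<not> c"]
      by (cases c) (auto simp: walk_pred belt_back_def)
  qed (use step2 w in \<open>auto simp: walk_pred belt_back_def\<close>)
qed

lemmas walk_linked = walk_linked_dist[THEN conjunct1]
  and walk_dist = walk_linked_dist[THEN conjunct2]

lemma walk_cong:
  assumes "\<And>k. \<bar>k - i\<bar> \<le> \<bar>t\<bar> + 1 \<Longrightarrow> L k = L' k" "L i"
  shows "walk L t (i, b) = walk L' t (i, b)"
  using assms(1)
proof (induction t rule: int_induct[of _ 0])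
  case (step1 t)
  obtain j c where w: "walk L t (i, b) = (j, c)" by fastforce
  have "\<bar>j - i\<bar> \<le> \<bar>t\<bar>" using walk_dist[of L i t b] w assms(2) by simp
  then have "L j = L' j" "L (j + dir c) = L' (j + dir c)"
    using step1 by (cases c; simp)+
  moreover have "walk L' t (i, b) = (j, c)"
    using step1 w by simp
  ultimately show ?case using w by (simp add: walk_succ belt_step_def)
next
  case (step2 t)
  obtain j c where w: "walk L t (i, b) = (j, c)" by fastforce
  have "\<bar>j - i\<bar> \<le> \<bar>t\<bar>" using walk_dist[of L i t b] w assms(2) by simp
  then have "L j = L' j" "L (j - dir c) = L' (j - dir c)"
    using step2 by (cases c; simp)+
  moreover have "walk L' t (i, b) = (j, c)"
    using step2 w by simp
  ultimately show ?case using w by (simp add: walk_pred belt_back_def)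
qed simp

lemma walk_shift:
  "walk (\<lambda>k. L (k + 1)) t (i, b) = (fst (walk L t (i + 1, b)) - 1, snd (walk L t (i + 1, b)))"
proof (induction t rule: int_induct[of _ 0])
  case (step1 t)
  then show ?case by (auto simp: walk_succ belt_step_def split: prod.splits)
next
  case (step2 t)
  then show ?case by (auto simp: walk_pred belt_back_def split: prod.splits)
qed simp

lemma walk_everywhere:
  assumes "\<And>k. L k"
  shows "walk L t (i, b) = (i + t * dir b, b)"
proof (induction t rule: int_induct[of _ 0])
  case (step1 t)
  then show ?case using assms
    unfolding walk_succ step1 belt_step_def by (simp add: algebra_simps)
next
  case (step2 t)
  then show ?case using assms
    unfolding walk_pred step2 belt_back_def by (simp add: algebra_simps)
qed simp

lemma constant_on_links:
  assumes "\<And>k. L k \<Longrightarrow> L (k + 1) \<Longrightarrow> f k = f (k + 1)" and "linked L i j"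
  shows "f i = f j"
proof -
  have up: "f i = f (i + n)" if "0 \<le> n" "linked L i (i + n)" for i n
    using that
  proof (induction n rule: int_ge_induct)
    case (step n)
    have "linked L i (i + n)" "L (i + n)" "L (i + n + 1)"
      using step by (auto simp: linked_def)
    then show ?case using step assms(1)[of "i + n"] by (simp add: algebra_simps)
  qed simp
  show ?thesis
  proof (cases "i \<le> j")
    case True
    then show ?thesis using up[of "j - i" i] assms(2) by simp
  next
    case False
    then show ?thesis using up[of "i - j" j] linked_sym[OF assms(2)] by simp
  qed
qed

lemma linked_direction:
  assumes "linked L i j" shows "\<exists>b n. 0 \<le> n \<and> j = i + n * dir b"
proof (cases "i \<le> j")
  case True then show ?thesis by (intro exI[of _ True] exI[of _ "j - i"]) simp
next
  case False then show ?thesis by (intro exI[of _ False] exI[of _ "i - j"]) simp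
qed

lemma linked_near_ahead:
  assumes "linked L i j" "\<bar>j - k\<bar> \<le> R" "k = i + n * dir b" "R \<le> n"
  shows "\<exists>m\<ge>n - R. j = i + m * dir b"
  using assms by (intro exI[of _ "(j - i) * dir b"]) (cases b; simp)

lemma linked_or_end:
  assumes "L i" "0 \<le> n"
  shows "linked L i (i + n * dir b) \<or>
    (\<exists>m\<ge>0. m < n \<and> linked L i (i + m * dir b) \<and> \<not> L (i + (m + 1) * dir b))"
  using assms(2)
proof (induction n rule: int_ge_induct)
  case (step n)
  show ?case
  proof (cases "linked L i (i + n * dir b)")
    case True
    show ?thesis
    proof (cases "L (i + n * dir b + dir b)")
      case L': True
      have "linked L (i + n * dir b) (i + n * dir b + dir b)"
        using linked_ends(2)[OF True] L' by (rule linked_step)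
      then have "linked L i (i + n * dir b + dir b)" using True linked_trans by blast
      then show ?thesis by (simp add: algebra_simps)
    next
      case False
      then show ?thesis using True step(1) by (intro disjI2 exI[of _ n]) (simp add: algebra_simps)
    qed
  next
    case False
    then obtain m where "0 \<le> m" "m < n" "linked L i (i + m * dir b)" "\<not> L (i + (m + 1) * dir b)"
      using step by blast
    then show ?thesis by (intro disjI2 exI[of _ m]) simp
  qed
qed (use assms in \<open>simp add: linked_refl\<close>)

lemma linked_cong:
  assumes "\<And>k. \<bar>k - i\<bar> \<le> M \<Longrightarrow> L k = L' k" "\<bar>n\<bar> \<le> M"
  shows "linked L i (i + n * dir b) = linked L' i (i + n * dir b)"
proof -
  have "L k = L' k" if "k \<in> {min i (i + n * dir b)..max i (i + n * dir b)}" for k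
    using that assms(2) by (intro assms(1)) (cases b; auto simp: min_def max_def split: if_splits)
  then show ?thesis unfolding linked_def by (intro ball_cong) auto
qed

lemma linked_shift: "linked (\<lambda>k. L (k + 1)) i j \<longleftrightarrow> linked L (i + 1) (j + 1)"
proof
  assume *: "linked (\<lambda>k. L (k + 1)) i j"
  show "linked L (i + 1) (j + 1)"
    unfolding linked_def
  proof
    fix k assume "k \<in> {min (i + 1) (j + 1)..max (i + 1) (j + 1)}"
    then have "k - 1 \<in> {min i j..max i j}" by auto
    then have "L (k - 1 + 1)" using * unfolding linked_def by blast
    then show "L k" by simp
  qed
next
  assume *: "linked L (i + 1) (j + 1)"
  show "linked (\<lambda>k. L (k + 1)) i j"
    unfolding linked_def
  proof
    fix k assume "k \<in> {min i j..max i j}"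
    then have "k + 1 \<in> {min (i + 1) (j + 1)..max (i + 1) (j + 1)}" by auto
    then show "L (k + 1)" using * unfolding linked_def by blast
  qed
qed

section \<open>Flags that certify blank stretches\<close>

text \<open>
A cell holds, for each of the two directions, the symbol that is read in this direction and a flag
claiming that this cell and all cells ahead in this direction are blank.
\<close>

type_synonym 's cell = "bool \<Rightarrow> 's \<times> bool"

definition letter :: "(int \<Rightarrow> 's cell) \<Rightarrow> int \<Rightarrow> bool \<Rightarrow> 's" where
  "letter w i b = fst (w i b)"

definition flag :: "(int \<Rightarrow> 's cell) \<Rightarrow> int \<Rightarrow> bool \<Rightarrow> bool" where
  "flag w i b = snd (w i b)"

locale belts =
  fixes S :: "'s set" and z :: 's
  assumes finite_S: "finite S" and z_in_S: "z \<in> S"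
begin

definition blank :: "(int \<Rightarrow> bool \<Rightarrow> 's) \<Rightarrow> int \<Rightarrow> bool" where
  "blank c i \<longleftrightarrow> (\<forall>b. c i b = z)"

definition agrees :: "(int \<Rightarrow> 's cell) \<Rightarrow> int \<Rightarrow> bool \<Rightarrow> bool" where
  "agrees w i b \<longleftrightarrow> (flag w i b \<longleftrightarrow> blank (letter w) i \<and> flag w (i + dir b) b)"

text \<open>
Both cells that take part in a violation of the rule for flags are frozen. A violation therefore
persists as long as frozen cells are left alone.
\<close>

definition live :: "(int \<Rightarrow> 's cell) \<Rightarrow> int \<Rightarrow> bool" where
  "live w i \<longleftrightarrow> (\<forall>b. agrees w i b \<and> agrees w (i + dir b) (\<not> b))"

definition cleared :: "(int \<Rightarrow> bool) \<Rightarrow> (int \<Rightarrow> bool \<Rightarrow> 's) \<Rightarrow> int \<Rightarrow> bool \<Rightarrow> bool" where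
  "cleared L c i b \<longleftrightarrow> (\<forall>n\<ge>0. linked L i (i + n * dir b) \<longrightarrow> blank c (i + n * dir b))"

text \<open>
The part of the information in the flags that does not depend on the symbols. If the run of \<open>i\<close> ends in
direction \<open>b\<close>, this is the flag of the frozen cell at the end. If the run is infinite in this
direction, it says that some flag ahead is set, that is, that the run is certified to be
eventually blank. It is constant along runs (\<open>open_end_linked\<close>).
\<close>

definition open_end :: "(int \<Rightarrow> 's cell) \<Rightarrow> int \<Rightarrow> bool \<Rightarrow> bool" where
  "open_end w i b \<longleftrightarrow> (\<exists>n\<ge>0. (n = 0 \<or> linked (live w) i (i + (n - 1) * dir b)) \<and>
     flag w (i + n * dir b) b)"

lemma flag_live: "live w i \<Longrightarrow> flag w i b \<longleftrightarrow> blank (letter w) i \<and> flag w (i + dir b) b"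
  by (simp add: live_def agrees_def)

lemma open_endI_flag: "flag w i b \<Longrightarrow> open_end w i b"
  unfolding open_end_def by (rule exI[of _ 0]) simp

lemma open_end_step:
  assumes "live w i"
  shows "open_end w i b \<longleftrightarrow> open_end w (i + dir b) b"
proof
  assume "open_end w i b"
  then obtain n where n: "0 \<le> n" "n = 0 \<or> linked (live w) i (i + (n - 1) * dir b)"
      "flag w (i + n * dir b) b"
    by (auto simp: open_end_def)
  show "open_end w (i + dir b) b"
  proof (cases "n = 0")
    case True
    with n assms have "flag w (i + dir b) b" by (simp add: flag_live)
    then show ?thesis by (rule open_endI_flag)
  next
    case False
    have "n - 1 = 0 \<or> linked (live w) (i + dir b) (i + dir b + (n - 1 - 1) * dir b)"
      using n False linked_ahead_Suc[of "n - 2" "live w" i b]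
      by (cases "n = 1") (simp_all add: algebra_simps)
    moreover have "flag w (i + dir b + (n - 1) * dir b) b"
      using n by (simp add: algebra_simps)
    ultimately show ?thesis using n False
      unfolding open_end_def by (intro exI[of _ "n - 1"]) auto
  qed
next
  assume "open_end w (i + dir b) b"
  then obtain n where n: "0 \<le> n" "n = 0 \<or> linked (live w) (i + dir b) (i + dir b + (n - 1) * dir b)"
      "flag w (i + dir b + n * dir b) b"
    by (auto simp: open_end_def)
  have "linked (live w) i (i + n * dir b)"
  proof (cases "n = 0")
    case False
    then show ?thesis using n assms linked_ahead_Suc[of "n - 1" "live w" i b] by auto
  qed (use assms in \<open>simp add: linked_refl\<close>)
  moreover have "flag w (i + (n + 1) * dir b) b"
    using n by (simp add: algebra_simps)
  ultimately show "open_end w i b"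
    using n unfolding open_end_def by (intro exI[of _ "n + 1"]) auto
qed

lemma open_end_linked:
  assumes "linked (live w) i j"
  shows "open_end w i b \<longleftrightarrow> open_end w j b"
proof (rule constant_on_links[of "live w" "\<lambda>i. open_end w i b", OF _ assms])
  fix k assume "live w k" "live w (k + 1)"
  then show "open_end w k b \<longleftrightarrow> open_end w (k + 1) b"
    using open_end_step[of w k b] open_end_step[of w "k + 1" b] by (cases b) auto
qed

lemma open_end_frozen:
  assumes "\<not> live w i"
  shows "open_end w i b \<longleftrightarrow> flag w i b"
  using assms open_endI_flag unfolding open_end_def by (auto dest: linked_ends(1))

lemma cleared_step:
  assumes "L i"
  shows "cleared L c i b \<longleftrightarrow> blank c i \<and> (L (i + dir b) \<longrightarrow> cleared L c (i + dir b) b)"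
proof
  assume *: "cleared L c i b"
  have "blank c (i + dir b + n * dir b)"
    if "0 \<le> n" "linked L (i + dir b) (i + dir b + n * dir b)" for n
  proof -
    have "linked L i (i + (n + 1) * dir b)"
      using that assms linked_ahead_Suc[of n L i b] by simp
    then have "blank c (i + (n + 1) * dir b)"
      using * that by (auto simp: cleared_def)
    then show ?thesis by (simp add: algebra_simps)
  qed
  moreover have "blank c i"
    using *[unfolded cleared_def, rule_format, of 0] assms by (simp add: linked_refl)
  ultimately show "blank c i \<and> (L (i + dir b) \<longrightarrow> cleared L c (i + dir b) b)"
    by (auto simp: cleared_def)
next
  assume *: "blank c i \<and> (L (i + dir b) \<longrightarrow> cleared L c (i + dir b) b)"
  show "cleared L c i b"
    unfolding cleared_def
  proof (intro allI impI)
    fix n :: int assume n: "0 \<le> n" "linked L i (i + n * dir b)"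
    show "blank c (i + n * dir b)"
    proof (cases "n = 0")
      case False
      then have "linked L (i + dir b) (i + dir b + (n - 1) * dir b)"
        using n linked_ahead_Suc[of "n - 1" L i b] by simp
      then have "blank c (i + dir b + (n - 1) * dir b)"
        using * n False linked_ends(1) unfolding cleared_def by fastforce
      then show ?thesis by (simp add: algebra_simps)
    qed (use * in simp)
  qed
qed

text \<open>
This is what allows flags to be recomputed after the symbols of a run have changed.
\<close>

lemma flag_iff:
  assumes "live w i"
  shows "flag w i b \<longleftrightarrow> open_end w i b \<and> cleared (live w) (letter w) i b"
proof
  assume f: "flag w i b"
  have "flag w (i + n * dir b) b" if "0 \<le> n" "linked (live w) i (i + n * dir b)" for n
    using that
  proof (induction n rule: int_ge_induct)
    case (step n)
    have "linked (live w) i (i + n * dir b)"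
      using step linked_between(1)[of "live w" i "n + 1" b n] by simp
    then have "flag w (i + n * dir b) b" "live w (i + n * dir b)"
      using step linked_ends(2) by blast+
    then show ?case
      by (simp add: flag_live algebra_simps)
  qed (use f in simp)
  then show "open_end w i b \<and> cleared (live w) (letter w) i b"
    using f open_endI_flag linked_ends(2) flag_live unfolding cleared_def by blast
next
  assume *: "open_end w i b \<and> cleared (live w) (letter w) i b"
  then obtain n where n: "0 \<le> n" "n = 0 \<or> linked (live w) i (i + (n - 1) * dir b)"
      "flag w (i + n * dir b) b"
    by (auto simp: open_end_def)
  have "cleared (live w) (letter w) i b \<Longrightarrow> live w i \<Longrightarrow> flag w i b"
    using n
  proof (induction n arbitrary: i rule: int_ge_induct)
    case (step n)
    have l: "linked (live w) i (i + n * dir b)" using step by simp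
    have "flag w (i + dir b) b"
    proof (cases "n = 0")
      case False
      then have "linked (live w) (i + dir b) (i + dir b + (n - 1) * dir b)"
        using l step(1) linked_ahead_Suc[of "n - 1" "live w" i b] by simp
      then show ?thesis
        using step.IH[of "i + dir b"] step(1,3,4,5,6) cleared_step[of "live w" i "letter w" b] linked_ends(1)
        by (auto simp: algebra_simps)
    qed (use step in \<open>simp add: algebra_simps\<close>)
    moreover have "blank (letter w) i" using step cleared_step by blast
    ultimately show ?case using step flag_live by blast
  qed simp
  then show "flag w i b" using * assms by blast
qed

definition update :: "(int \<Rightarrow> 's cell) \<Rightarrow> (int \<Rightarrow> bool \<Rightarrow> 's) \<Rightarrow> int \<Rightarrow> 's cell" where
  "update w c i = (if live w i
     then (\<lambda>b. (c i b, open_end w i b \<and> cleared (live w) c i b)) else w i)"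

text \<open>
The conditions under which a change of symbols creates no violations: a run which is certified to be
eventually blank stays eventually blank, and a run is blank afterwards exactly if it was blank before.
\<close>

definition tame :: "(int \<Rightarrow> 's cell) \<Rightarrow> (int \<Rightarrow> bool \<Rightarrow> 's) \<Rightarrow> bool" where
  "tame w c \<longleftrightarrow>
     (\<forall>i b. live w i \<and> open_end w i b \<and> (\<forall>n\<ge>0. linked (live w) i (i + n * dir b)) \<longrightarrow>
        (\<exists>n\<ge>0. cleared (live w) c (i + n * dir b) b)) \<and>
     (\<forall>i. live w i \<longrightarrow>
        ((\<forall>j. linked (live w) i j \<longrightarrow> blank (letter w) j) \<longleftrightarrow> (\<forall>j. linked (live w) i j \<longrightarrow> blank c j)))"

lemma update_frozen: "\<not> live w i \<Longrightarrow> update w c i = w i"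
  by (simp add: update_def)

lemma letter_update: "live w i \<Longrightarrow> letter (update w c) i b = c i b"
  by (simp add: letter_def update_def)

lemma flag_update: "live w i \<Longrightarrow> flag (update w c) i b \<longleftrightarrow> open_end w i b \<and> cleared (live w) c i b"
  by (simp add: flag_def update_def)

lemma blank_update: "live w i \<Longrightarrow> blank (letter (update w c)) i \<longleftrightarrow> blank c i"
  by (simp add: blank_def letter_update)

lemma cleared_at_end:
  assumes "L i" "\<not> L (i + dir b)"
  shows "cleared L c i (\<not> b) \<longleftrightarrow> (\<forall>j. linked L i j \<longrightarrow> blank c j)"
proof
  assume *: "cleared L c i (\<not> b)"
  show "\<forall>j. linked L i j \<longrightarrow> blank c j"
  proof (intro allI impI)
    fix j assume j: "linked L i j"
    then obtain b' n where n: "0 \<le> n" "j = i + n * dir b'"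
      using linked_direction by blast
    have "b' = (\<not> b) \<or> n = 0"
    proof (rule ccontr)
      assume "\<not> (b' = (\<not> b) \<or> n = 0)"
      then have "linked L i (i + 1 * dir b)"
        using j n linked_between(1)[of L i n b 1] by auto
      then show False using assms linked_ends(2)[of L i "i + dir b"] by simp
    qed
    then show "blank c j" using * j n unfolding cleared_def by auto
  qed
qed (auto simp: cleared_def)

lemma agrees_update:
  assumes "tame w c" "live w i"
  shows "agrees (update w c) i b"
proof (cases "live w (i + dir b)")
  case True
  then show ?thesis
    using assms open_end_step[of w i b] cleared_step[of "live w" i c b]
    by (auto simp: agrees_def flag_update blank_update)
next
  case False
  then show ?thesis
    using assms open_end_step[of w i b] cleared_step[of "live w" i c b] open_end_frozen[of w "i + dir b" b]
    by (simp add: agrees_def flag_update blank_update) (auto simp: flag_def update_def)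
qed

text \<open>
If \<open>i\<close> is the last cell of its run, then the flag at \<open>i\<close> that looks back claims that the whole run is
blank. The rule at the frozen neighbour refers to this flag, which therefore must not change.
\<close>

lemma agrees_update_back:
  assumes "tame w c" "live w i"
  shows "agrees (update w c) (i + dir b) (\<not> b)"
proof (cases "live w (i + dir b)")
  case False
  have "flag (update w c) i (\<not> b) \<longleftrightarrow> flag w i (\<not> b)"
  proof -
    have "cleared (live w) c i (\<not> b) \<longleftrightarrow> cleared (live w) (letter w) i (\<not> b)"
      using assms False by (simp add: cleared_at_end tame_def)
    then show ?thesis using assms(2) by (simp add: flag_update flag_iff)
  qed
  moreover have "agrees w (i + dir b) (\<not> b)"
    using assms by (simp add: live_def)
  ultimately show ?thesis
    using False by (simp add: agrees_def blank_def) (simp add: letter_def flag_def update_def)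
qed (use agrees_update assms in blast)

lemma live_update:
  assumes "tame w c"
  shows "live (update w c) = live w"
proof
  fix i
  show "live (update w c) i = live w i"
  proof (cases "live w i")
    case True
    then show ?thesis
      using agrees_update[OF assms] agrees_update_back[OF assms] by (simp add: live_def)
  next
    case False
    then obtain b where b: "\<not> agrees w i b \<or> \<not> agrees w (i + dir b) (\<not> b)"
      by (auto simp: live_def)
    have "\<not> live w (i + dir b)"
    proof
      assume "live w (i + dir b)"
      then have "\<forall>b'. agrees w (i + dir b) b' \<and> agrees w (i + dir b + dir b') (\<not> b')"
        by (simp add: live_def)
      from this[rule_format, of "\<not> b"] b show False by auto
    qed
    then have "update w c i = w i" "update w c (i + dir b) = w (i + dir b)"
      using False by (simp_all add: update_frozen)
    then have "\<not> agrees (update w c) i b \<or> \<not> agrees (update w c) (i + dir b) (\<not> b)"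
      using b by (simp add: agrees_def blank_def letter_def flag_def)
    then show ?thesis using False by (auto simp: live_def)
  qed
qed

text \<open>
A run with an end keeps the flag of the frozen cell there. On an infinite run tameness provides a
blank stretch, on which the new flags are set.
\<close>

lemma open_end_update:
  assumes "tame w c" "live w i"
  shows "open_end (update w c) i b \<longleftrightarrow> open_end w i b"
proof
  assume "open_end (update w c) i b"
  then obtain n where n: "0 \<le> n" "n = 0 \<or> linked (live w) i (i + (n - 1) * dir b)"
      "flag (update w c) (i + n * dir b) b"
    by (auto simp: open_end_def live_update[OF assms(1)])
  have oe: "open_end w (i + n * dir b) b"
  proof (cases "live w (i + n * dir b)")
    case False
    then show ?thesis using n by (simp add: open_end_frozen) (simp add: flag_def update_def)
  qed (use n in \<open>simp add: flag_update\<close>)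
  show "open_end w i b"
  proof (cases "n = 0")
    case False
    then have l: "linked (live w) i (i + (n - 1) * dir b)" using n by simp
    have "open_end w (i + (n - 1) * dir b) b \<longleftrightarrow> open_end w (i + (n - 1) * dir b + dir b) b"
      using l by (intro open_end_step linked_ends(2))
    then show ?thesis using oe open_end_linked[OF l] by (simp add: algebra_simps)
  qed (use oe in simp)
next
  assume oe: "open_end w i b"
  show "open_end (update w c) i b"
  proof (cases "\<forall>n\<ge>0. linked (live w) i (i + n * dir b)")
    case True
    then obtain n where n: "0 \<le> n" "cleared (live w) c (i + n * dir b) b"
      using assms oe unfolding tame_def by blast
    have l: "linked (live w) i (i + n * dir b)" using True n by blast
    then have "flag (update w c) (i + n * dir b) b"
      using n oe linked_ends(2)[OF l] open_end_linked[OF l] by (simp add: flag_update)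
    moreover have "n = 0 \<or> linked (live w) i (i + (n - 1) * dir b)"
      using l n linked_between(1)[of "live w" i n b "n - 1"] by (cases "n = 0") simp_all
    ultimately show ?thesis
      unfolding open_end_def live_update[OF assms(1)] using n by blast
  next
    case False
    then obtain n where n: "0 \<le> n" "\<not> linked (live w) i (i + n * dir b)" by blast
    have "\<exists>n\<ge>0. linked (live w) i (i + n * dir b) \<and> \<not> live w (i + (n + 1) * dir b)"
    proof (rule ccontr)
      assume *: "\<not> ?thesis"
      have "linked (live w) i (i + n * dir b)"
        using n(1)
      proof (induction n rule: int_ge_induct)
        case (step n)
        then have "live w (i + n * dir b)" "live w (i + n * dir b + dir b)"
          using * linked_ends(2) by (auto simp: algebra_simps)
        then have "linked (live w) (i + n * dir b) (i + n * dir b + dir b)"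
          by (rule linked_step)
        with step have "linked (live w) i (i + n * dir b + dir b)"
          using linked_trans by blast
        then show ?case by (simp add: algebra_simps)
      qed (use assms in \<open>simp add: linked_refl\<close>)
      with n show False by simp
    qed
    then obtain m where m: "0 \<le> m" "linked (live w) i (i + m * dir b)"
        "\<not> live w (i + (m + 1) * dir b)" by blast
    have "open_end w (i + m * dir b) b" using oe open_end_linked[OF m(2)] by simp
    then have "open_end w (i + (m + 1) * dir b) b"
      using open_end_step[OF linked_ends(2)[OF m(2)], of b] by (simp add: algebra_simps)
    then have "flag w (i + (m + 1) * dir b) b" using m by (simp add: open_end_frozen)
    then have "flag (update w c) (i + (m + 1) * dir b) b"
      using m by (simp add: flag_def update_def)
    then show ?thesis
      unfolding open_end_def live_update[OF assms(1)] using m by (intro exI[of _ "m + 1"]) simp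
  qed
qed

lemma update_update:
  assumes "tame w c"
  shows "update (update w c) c' = update w c'"
  unfolding update_def[of "update w c"] update_def[of w c'] live_update[OF assms]
  using open_end_update[OF assms] by (auto simp: fun_eq_iff update_frozen)

lemma update_self:
  assumes "\<And>b. c i b = letter w i b" "cleared (live w) c i = cleared (live w) (letter w) i"
  shows "update w c i = w i"
  using assms flag_iff[of w i] by (auto simp: update_def fun_eq_iff letter_def flag_def prod_eq_iff)

section \<open>Cellular automata on belts\<close>

definition pts :: "(int \<Rightarrow> 's) set" where
  "pts = {x. \<forall>i. x i \<in> S}"

lemma zero_pts [simp]: "(\<lambda>_. z) \<in> pts"
  using z_in_S by (simp add: pts_def)

lemma translate_pts [simp]: "x \<in> pts \<Longrightarrow> (\<lambda>i. x (i + t)) \<in> pts"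
  by (simp add: pts_def)

text \<open>
Cellular automata that fix the zero point. The radius is a parameter since the locality of the action
on belts is proved with explicit windows.
\<close>

definition automaton :: "int \<Rightarrow> ((int \<Rightarrow> 's) \<Rightarrow> int \<Rightarrow> 's) \<Rightarrow> bool" where
  "automaton R T \<longleftrightarrow> 0 \<le> R \<and> T (\<lambda>_. z) = (\<lambda>_. z) \<and>
     (\<forall>x\<in>pts. T x \<in> pts \<and> T (shift x) = shift (T x) \<and>
        (\<forall>y\<in>pts. (\<forall>i. \<bar>i\<bar> \<le> R \<longrightarrow> x i = y i) \<longrightarrow> T x 0 = T y 0))"

lemma automaton_mono: "automaton R T \<Longrightarrow> R \<le> R' \<Longrightarrow> automaton R' T"
  unfolding automaton_def by (meson order_trans)

lemma automaton_translate:
  assumes "automaton R T" "x \<in> pts"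
  shows "T (\<lambda>i. x (i + t)) = (\<lambda>i. T x (i + t))"
proof (induction t rule: int_induct[of _ 0])
  case (step1 t)
  have "T (shift (\<lambda>i. x (i + t))) = shift (T (\<lambda>i. x (i + t)))"
    using assms by (simp add: automaton_def)
  then show ?case using step1 by (simp add: shift_def algebra_simps)
next
  case (step2 t)
  have "T (shift (\<lambda>i. x (i + (t - 1)))) = shift (T (\<lambda>i. x (i + (t - 1))))"
    using assms by (simp add: automaton_def)
  then have *: "(\<lambda>i. T x (i + t)) = (\<lambda>i. T (\<lambda>i. x (i + (t - 1))) (i + 1))"
    using step2 by (simp add: shift_def algebra_simps)
  show ?case
  proof
    fix i show "T (\<lambda>i. x (i + (t - 1))) i = T x (i + (t - 1))"
      using fun_cong[OF *, of "i - 1"] by (simp add: algebra_simps)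
  qed
qed simp

lemma automaton_at:
  assumes "automaton R T" "x \<in> pts"
  shows "T x t = T (\<lambda>i. x (i + t)) 0"
  using automaton_translate[OF assms] by simp

lemma automaton_local:
  assumes "automaton R T" "x \<in> pts" "y \<in> pts" "\<And>i. \<bar>i\<bar> \<le> R \<Longrightarrow> x i = y i"
  shows "T x 0 = T y 0"
proof -
  have "\<forall>y\<in>pts. (\<forall>i. \<bar>i\<bar> \<le> R \<longrightarrow> x i = y i) \<longrightarrow> T x 0 = T y 0"
    using assms(1,2) unfolding automaton_def by blast
  then show ?thesis using assms(3,4) by blast
qed

definition reversible :: "int \<Rightarrow> ((int \<Rightarrow> 's) \<Rightarrow> int \<Rightarrow> 's) \<Rightarrow> bool" where
  "reversible R T \<longleftrightarrow> automaton R T \<and>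
     (\<exists>U. automaton R U \<and> (\<forall>x\<in>pts. U (T x) = x \<and> T (U x) = x))"

definition read :: "(int \<Rightarrow> bool) \<Rightarrow> (int \<Rightarrow> bool \<Rightarrow> 's) \<Rightarrow> int \<Rightarrow> bool \<Rightarrow> int \<Rightarrow> 's" where
  "read L c i b t = (case walk L t (i, b) of (j, b') \<Rightarrow> c j b')"

lemma read_0 [simp]: "read L c i b 0 = c i b"
  by (simp add: read_def)

lemma read_walk:
  assumes "walk L t (i, b) = (j, b')"
  shows "read L c j b' = (\<lambda>s. read L c i b (s + t))"
  using assms by (simp add: read_def walk_add fun_eq_iff)

lemma read_pts:
  assumes "\<And>i b. c i b \<in> S" shows "read L c i b \<in> pts"
  using assms by (auto simp: pts_def read_def split: prod.splits)

lemma read_eq_zero: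
  assumes "\<And>j. linked L i j \<Longrightarrow> blank c j" "L i"
  shows "read L c i b = (\<lambda>_. z)"
proof
  fix t
  obtain j b' where j: "walk L t (i, b) = (j, b')" by fastforce
  then have "linked L i j" using walk_linked[of L i t b, OF assms(2)] by simp
  then show "read L c i b t = z" using assms(1)[of j] j by (simp add: read_def blank_def)
qed

text \<open>
A walk of at most \<open>R\<close> steps moves by at most \<open>R\<close> cells, even if it turns round at the end of the run.
From a cell that lies \<open>R\<close> cells inside a blank stretch it therefore meets blank cells only, and the
automaton cannot tell the belt from the zero point.
\<close>

lemma blank_spreads:
  assumes U: "automaton R U" and cS: "\<And>i b. c i b \<in> S" and N: "0 \<le> N"
    and cl: "\<And>m. N \<le> m \<Longrightarrow> linked L i (i + m * dir b) \<Longrightarrow> blank c (i + m * dir b)"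
    and n: "N + R \<le> n" "linked L i (i + n * dir b)"
  shows "U (read L c (i + n * dir b) b') 0 = z"
proof -
  define j where "j = i + n * dir b"
  have R: "0 \<le> R" using U by (simp add: automaton_def)
  have "read L c j b' t = z" if t: "\<bar>t\<bar> \<le> R" for t
  proof -
    obtain k b'' where k: "walk L t (j, b') = (k, b'')" by fastforce
    have Lj: "L j" using n linked_ends(2) by (simp add: j_def)
    have "linked L i k" "\<bar>k - j\<bar> \<le> R"
      using walk_linked[of L j t b', OF Lj] walk_dist[of L j t b', OF Lj] t k n linked_trans
      by (force simp: j_def)+
    then obtain m where "m \<ge> n - R" "k = i + m * dir b"
      using linked_near_ahead[of L i k j R n b] n N by (auto simp: j_def)
    then have "blank c k" using cl[of m] \<open>linked L i k\<close> n by simp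
    then show ?thesis using k by (simp add: read_def blank_def)
  qed
  then have "U (read L c j b') 0 = U (\<lambda>_. z) 0"
    using cS by (intro automaton_local[OF U] read_pts) auto
  then show ?thesis using U by (simp add: automaton_def j_def)
qed

definition configs :: "(int \<Rightarrow> 's cell) set" where
  "configs = {w. \<forall>i b. letter w i b \<in> S}"

definition cells :: "'s cell set" where
  "cells = {c. \<forall>b. fst (c b) \<in> S}"

lemma configs_eq: "configs = points cells"
  by (auto simp: configs_def mem_full_shift cells_def letter_def)

definition belt :: "(int \<Rightarrow> 's cell) \<Rightarrow> int \<Rightarrow> bool \<Rightarrow> int \<Rightarrow> 's" where
  "belt w = read (live w) (letter w)"

lemma belt_pts: "w \<in> configs \<Longrightarrow> belt w i b \<in> pts"
  unfolding belt_def by (rule read_pts) (simp add: configs_def)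

text \<open>
Different runs may be subject to different automata. This is needed for the lamps, which act on some
runs only.
\<close>

definition steady :: "(int \<Rightarrow> bool) \<Rightarrow> (int \<Rightarrow> (int \<Rightarrow> 's) \<Rightarrow> int \<Rightarrow> 's) \<Rightarrow> bool" where
  "steady L \<tau> \<longleftrightarrow> (\<forall>i. \<exists>R. reversible R (\<tau> i)) \<and> (\<forall>i. L i \<longrightarrow> L (i + 1) \<longrightarrow> \<tau> i = \<tau> (i + 1))"

lemma steady_linked: "steady L \<tau> \<Longrightarrow> linked L i j \<Longrightarrow> \<tau> i = \<tau> j"
  by (rule constant_on_links[of L \<tau>]) (auto simp: steady_def)

lemma steady_automaton:
  assumes "steady L \<tau>" obtains R where "automaton R (\<tau> i)"
  using assms unfolding steady_def reversible_def by blast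

lemma steady_const: "reversible R T \<Longrightarrow> steady L (\<lambda>_. T)"
  by (auto simp: steady_def)

definition belt_syms :: "(int \<Rightarrow> (int \<Rightarrow> 's) \<Rightarrow> int \<Rightarrow> 's) \<Rightarrow> (int \<Rightarrow> 's cell) \<Rightarrow> int \<Rightarrow> bool \<Rightarrow> 's" where
  "belt_syms \<tau> w i b = \<tau> i (belt w i b) 0"

definition belt_map :: "(int \<Rightarrow> (int \<Rightarrow> 's) \<Rightarrow> int \<Rightarrow> 's) \<Rightarrow> (int \<Rightarrow> 's cell) \<Rightarrow> int \<Rightarrow> 's cell" where
  "belt_map \<tau> w = update w (belt_syms \<tau> w)"

lemma belt_syms_S:
  assumes "w \<in> configs" "steady (live w) \<tau>"
  shows "belt_syms \<tau> w i b \<in> S"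
proof -
  obtain R where "automaton R (\<tau> i)" using assms steady_automaton by blast
  then have "\<tau> i (belt w i b) \<in> pts" using belt_pts[OF assms(1)] by (auto simp: automaton_def)
  then show ?thesis by (simp add: belt_syms_def pts_def)
qed

text \<open>
Reading the belt from another position shifts its content, and automata commute with the shift.
\<close>

lemma read_belt_syms:
  assumes "w \<in> configs" "steady (live w) \<tau>" "live w i"
  shows "read (live w) (belt_syms \<tau> w) i b = \<tau> i (belt w i b)"
proof
  fix t
  obtain R where R: "automaton R (\<tau> i)" using assms steady_automaton by blast
  obtain j b' where j: "walk (live w) t (i, b) = (j, b')" by fastforce
  have "\<tau> j = \<tau> i" using walk_linked[of "live w" i t b, OF assms(3)] j steady_linked[OF assms(2)] by fastforce
  then have "read (live w) (belt_syms \<tau> w) i b t = \<tau> i (belt w j b') 0"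
    using j by (simp add: read_def belt_syms_def)
  also have "belt w j b' = (\<lambda>s. belt w i b (s + t))"
    using read_walk[OF j] by (simp add: belt_def)
  also have "\<tau> i \<dots> 0 = \<tau> i (belt w i b) t"
    using automaton_at[OF R belt_pts[OF assms(1)]] by simp
  finally show "read (live w) (belt_syms \<tau> w) i b t = \<tau> i (belt w i b) t" .
qed

text \<open>
With this description of the old symbols, \<open>blank_spreads\<close> can be applied to the inverse automaton.
\<close>

lemma letter_from_belt_syms:
  assumes "w \<in> configs" "steady (live w) \<tau>" "linked (live w) i j" "\<forall>x\<in>pts. U (\<tau> i x) = x"
  shows "letter w j b = U (read (live w) (belt_syms \<tau> w) j b) 0"
proof -
  have "read (live w) (belt_syms \<tau> w) j b = \<tau> i (belt w j b)"
    using read_belt_syms[OF assms(1,2) linked_ends(2)[OF assms(3)]] steady_linked[OF assms(2,3)] by simp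
  then have "U (read (live w) (belt_syms \<tau> w) j b) = belt w j b"
    using assms(4) belt_pts[OF assms(1)] by simp
  then show ?thesis by (simp add: belt_def)
qed

text \<open>
Certified runs stay eventually blank by \<open>blank_spreads\<close>. A run is blank if and only if its belts hold
the zero point, which is fixed by the automaton and by its inverse.
\<close>

lemma tame_belt_syms:
  assumes w: "w \<in> configs" and st: "steady (live w) \<tau>"
  shows "tame w (belt_syms \<tau> w)"
  unfolding tame_def
proof (intro conjI allI impI)
  fix i b
  assume *: "live w i \<and> open_end w i b \<and> (\<forall>n\<ge>0. linked (live w) i (i + n * dir b))"
  then obtain n where n: "0 \<le> n" "flag w (i + n * dir b) b" by (auto simp: open_end_def)
  obtain R where R: "automaton R (\<tau> i)" using st steady_automaton by blast
  then have R0: "0 \<le> R" by (simp add: automaton_def)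
  define k where "k = i + n * dir b"
  have lk: "linked (live w) i k" using * n by (simp add: k_def)
  then have cl: "cleared (live w) (letter w) k b"
    using n flag_iff[OF linked_ends(2)[OF lk]] by (simp add: k_def)
  have "cleared (live w) (belt_syms \<tau> w) (i + (n + R) * dir b) b"
    unfolding cleared_def
  proof (intro allI impI)
    fix m :: int assume m: "0 \<le> m"
      "linked (live w) (i + (n + R) * dir b) (i + (n + R) * dir b + m * dir b)"
    have e: "i + (n + R) * dir b + m * dir b = k + (R + m) * dir b"
      by (simp add: k_def algebra_simps)
    have "linked (live w) i (i + (n + R) * dir b)" using * n R0 by simp
    then have l: "linked (live w) i (k + (R + m) * dir b)"
      using m(2) linked_trans unfolding e by blast
    then have l': "linked (live w) k (k + (R + m) * dir b)"
      using lk linked_sym linked_trans by blast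
    have "belt_syms \<tau> w (k + (R + m) * dir b) b' = z" for b'
    proof -
      have "\<tau> i (read (live w) (letter w) (k + (R + m) * dir b) b') 0 = z"
        using R cl l' m w by (intro blank_spreads[where N = 0]) (auto simp: configs_def cleared_def)
      then show ?thesis using steady_linked[OF st l] by (simp add: belt_syms_def belt_def)
    qed
    then show "blank (belt_syms \<tau> w) (i + (n + R) * dir b + m * dir b)"
      unfolding e by (simp add: blank_def)
  qed
  then show "\<exists>n\<ge>0. cleared (live w) (belt_syms \<tau> w) (i + n * dir b) b"
    using n R0 by (intro exI[of _ "n + R"]) simp
next
  fix i assume i: "live w i"
  obtain R U where R: "automaton R (\<tau> i)" "automaton R U" and U: "\<forall>x\<in>pts. U (\<tau> i x) = x"
    using st unfolding steady_def reversible_def by blast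
  show "(\<forall>j. linked (live w) i j \<longrightarrow> blank (letter w) j) \<longleftrightarrow>
      (\<forall>j. linked (live w) i j \<longrightarrow> blank (belt_syms \<tau> w) j)"
  proof (intro iffI allI impI)
    fix j assume *: "\<forall>j. linked (live w) i j \<longrightarrow> blank (letter w) j" and j: "linked (live w) i j"
    have "belt w j b = (\<lambda>_. z)" for b
      unfolding belt_def using * j linked_trans linked_ends(2) by (intro read_eq_zero) blast+
    then show "blank (belt_syms \<tau> w) j"
      using R steady_linked[OF st j] by (simp add: blank_def belt_syms_def automaton_def)
  next
    fix j assume *: "\<forall>j. linked (live w) i j \<longrightarrow> blank (belt_syms \<tau> w) j" and j: "linked (live w) i j"
    have "read (live w) (belt_syms \<tau> w) j b = (\<lambda>_. z)" for b
      using * j linked_trans linked_ends(2) by (intro read_eq_zero) blast+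
    then show "blank (letter w) j"
      using R letter_from_belt_syms[OF w st j U] by (simp add: blank_def automaton_def)
  qed
qed

lemma live_belt_map:
  assumes "w \<in> configs" "steady (live w) \<tau>" shows "live (belt_map \<tau> w) = live w"
  unfolding belt_map_def by (intro live_update tame_belt_syms assms)

lemma open_end_belt_map:
  assumes "w \<in> configs" "steady (live w) \<tau>" "live w i"
  shows "open_end (belt_map \<tau> w) i b \<longleftrightarrow> open_end w i b"
  unfolding belt_map_def by (intro open_end_update tame_belt_syms assms)

lemma belt_map_configs:
  assumes "w \<in> configs" "steady (live w) \<tau>" shows "belt_map \<tau> w \<in> configs"
  using assms belt_syms_S[OF assms] unfolding configs_def
  by (auto simp: belt_map_def) (auto simp: letter_def update_def)

lemma letter_belt_map:
  "live w i \<Longrightarrow> letter (belt_map \<tau> w) i b = \<tau> i (belt w i b) 0"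
  by (simp add: belt_map_def letter_update belt_syms_def)

lemma belt_belt_map:
  assumes "w \<in> configs" "steady (live w) \<tau>" "live w i"
  shows "belt (belt_map \<tau> w) i b = \<tau> i (belt w i b)"
proof -
  have "belt (belt_map \<tau> w) i b t = read (live w) (belt_syms \<tau> w) i b t" for t
  proof -
    obtain j b' where j: "walk (live w) t (i, b) = (j, b')" by fastforce
    have "live w j" using walk_linked[of "live w" i t b, OF assms(3)] linked_ends(2) j by fastforce
    then show ?thesis
      using j by (simp add: belt_def read_def live_belt_map[OF assms(1,2)] belt_map_def
          live_update tame_belt_syms assms letter_update)
  qed
  then show ?thesis using read_belt_syms[OF assms] by (simp add: fun_eq_iff)
qed

lemma update_cong:
  assumes "\<And>i b. live w i \<Longrightarrow> c i b = c' i b"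
  shows "update w c = update w c'"
proof -
  have "cleared (live w) c i b \<longleftrightarrow> cleared (live w) c' i b" if "live w i" for i b
    using assms linked_ends(2) unfolding cleared_def blank_def by metis
  then show ?thesis using assms by (auto simp: update_def fun_eq_iff)
qed

text \<open>
The flags are functions of the symbols and of the invariant \<open>open_end\<close>, so only the composition of
the maps of the symbols matters.
\<close>

lemma belt_map_belt_map:
  assumes "w \<in> configs" "steady (live w) \<tau>"
  shows "belt_map \<tau>' (belt_map \<tau> w) = belt_map (\<lambda>i. \<tau>' i \<circ> \<tau> i) w"
proof -
  have "belt_map \<tau>' (belt_map \<tau> w) = update w (belt_syms \<tau>' (belt_map \<tau> w))"
    unfolding belt_map_def by (intro update_update tame_belt_syms assms)
  also have "\<dots> = belt_map (\<lambda>i. \<tau>' i \<circ> \<tau> i) w"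
    unfolding belt_map_def[of "\<lambda>i. \<tau>' i \<circ> \<tau> i"]
    by (rule update_cong) (simp add: belt_syms_def belt_belt_map[OF assms])
  finally show ?thesis .
qed

lemma belt_map_cong:
  assumes "w \<in> configs" "\<And>i x. live w i \<Longrightarrow> x \<in> pts \<Longrightarrow> \<tau> i x = \<tau>' i x"
  shows "belt_map \<tau> w = belt_map \<tau>' w"
  unfolding belt_map_def
  by (rule update_cong) (simp add: belt_syms_def assms belt_pts)

lemma belt_map_id_on:
  assumes "w \<in> configs" "\<And>j x. linked (live w) i j \<Longrightarrow> x \<in> pts \<Longrightarrow> \<tau> j x = x"
  shows "belt_map \<tau> w i = w i"
proof (cases "live w i")
  case True
  have *: "belt_syms \<tau> w j b = letter w j b" if "linked (live w) i j" for j b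
    using assms that belt_pts by (simp add: belt_syms_def belt_def)
  have "cleared (live w) (belt_syms \<tau> w) i = cleared (live w) (letter w) i"
    using * by (auto simp: cleared_def blank_def fun_eq_iff)
  then show ?thesis unfolding belt_map_def
    using * True by (intro update_self) (simp_all add: linked_refl)
qed (simp add: belt_map_def update_frozen)

section \<open>Locality and shift equivariance\<close>

lemma live_local:
  assumes "\<And>k. \<bar>k - i\<bar> \<le> 1 \<Longrightarrow> w k = w' k"
  shows "live w i = live w' i"
proof -
  have "w i = w' i" "\<And>b. w (i + dir b) = w' (i + dir b)"
    using assms by (simp_all)
  then show ?thesis by (simp add: live_def agrees_def blank_def letter_def flag_def)
qed

lemma belt_local:
  assumes "\<And>k. \<bar>k - i\<bar> \<le> R + 2 \<Longrightarrow> w k = w' k" "\<bar>t\<bar> \<le> R" "live w i"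
  shows "belt w i b t = belt w' i b t"
proof -
  obtain j b' where j: "walk (live w) t (i, b) = (j, b')" by fastforce
  moreover have "walk (live w) t (i, b) = walk (live w') t (i, b)"
    using assms by (intro walk_cong live_local) auto
  then have "walk (live w') t (i, b) = (j, b')" using j by simp
  moreover have "\<bar>j - i\<bar> \<le> R" using walk_dist[of "live w" i t b, OF assms(3)] j assms(2) by simp
  then have "w j = w' j" using assms(1) by simp
  ultimately show ?thesis by (simp add: belt_def read_def letter_def)
qed

text \<open>
A flag at distance \<open>N\<close> tells that everything from there on is blank, and this flag is shared by all
configurations that agree on the window. If the run ends before distance \<open>N\<close>, the end is visible.
\<close>

lemma clearance_local:
  assumes ag: "\<And>k. \<bar>k - j\<bar> \<le> N + 2 \<Longrightarrow> w k = w' k" and N: "0 \<le> N" and lj: "live w j"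
    and oe: "open_end w j b"
    and far: "\<And>n. N \<le> n \<Longrightarrow> linked (live w) j (j + n * dir b) \<Longrightarrow> blank (letter w) (j + n * dir b)"
  shows "open_end w' j b"
    and "\<And>n. N \<le> n \<Longrightarrow> linked (live w') j (j + n * dir b) \<Longrightarrow> blank (letter w') (j + n * dir b)"
proof -
  let ?L = "live w" and ?L' = "live w'"
  have L: "?L k = ?L' k" if "\<bar>k - j\<bar> \<le> N + 1" for k
    using that ag by (intro live_local) auto
  have dist: "\<bar>j + n * dir b - j\<bar> = \<bar>n\<bar>" for n by (simp add: abs_mult)
  have link: "linked ?L j (j + n * dir b) = linked ?L' j (j + n * dir b)" if "\<bar>n\<bar> \<le> N" for n
    using that L by (intro linked_cong[of _ N]) auto
  have "open_end w' j b \<and> (\<forall>n\<ge>N. linked ?L' j (j + n * dir b) \<longrightarrow> blank (letter w') (j + n * dir b))"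
    using linked_or_end[of ?L j N b, OF lj N]
  proof
    assume lN: "linked ?L j (j + N * dir b)"
    define m where "m = j + N * dir b"
    have lm: "?L m" using lN linked_ends(2) by (simp add: m_def)
    have "cleared ?L (letter w) m b"
      unfolding cleared_def
    proof (intro allI impI)
      fix n :: int assume n: "0 \<le> n" "linked ?L m (m + n * dir b)"
      have "linked ?L j (j + (N + n) * dir b)"
        using linked_trans[OF lN] n by (simp add: m_def algebra_simps)
      then have "blank (letter w) (j + (N + n) * dir b)" using far[of "N + n"] n by simp
      then show "blank (letter w) (m + n * dir b)" by (simp add: m_def algebra_simps)
    qed
    then have "flag w m b"
      using oe open_end_linked[OF lN] flag_iff[OF lm] by (simp add: m_def)
    moreover have "w m = w' m" using dist[of N] N by (intro ag) (simp add: m_def)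
    ultimately have f': "flag w' m b" by (simp add: flag_def)
    have lN': "linked ?L' j (j + N * dir b)" using lN link[of N] N by simp
    have lm': "?L' m" using lN' linked_ends(2) by (simp add: m_def)
    have oe': "open_end w' m b" and cl': "cleared ?L' (letter w') m b"
      using f' flag_iff[OF lm'] by auto
    have "blank (letter w') (j + n * dir b)" if "N \<le> n" "linked ?L' j (j + n * dir b)" for n
    proof -
      have e: "j + n * dir b = m + (n - N) * dir b" by (simp add: m_def algebra_simps)
      have "linked ?L' m (m + (n - N) * dir b)"
        using linked_trans[OF linked_sym[OF lN'] that(2)] unfolding e by (simp add: m_def)
      then show ?thesis using cl' that unfolding e cleared_def by simp
    qed
    then show ?thesis using oe' open_end_linked[OF lN'] by (simp add: m_def)
  next
    assume "\<exists>m\<ge>0. m < N \<and> linked ?L j (j + m * dir b) \<and> \<not> ?L (j + (m + 1) * dir b)"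
    then obtain m where m: "0 \<le> m" "m < N" "linked ?L j (j + m * dir b)" "\<not> ?L (j + (m + 1) * dir b)"
      by blast
    have m1: "\<bar>j + (m + 1) * dir b - j\<bar> \<le> N" using m dist[of "m + 1"] by simp
    have "open_end w (j + (m + 1) * dir b) b"
      using oe open_end_linked[OF m(3)] open_end_step[OF linked_ends(2)[OF m(3)], of b]
      by (simp add: algebra_simps)
    then have "flag w (j + (m + 1) * dir b) b" using m by (simp add: open_end_frozen)
    then have f': "flag w' (j + (m + 1) * dir b) b"
      using ag[of "j + (m + 1) * dir b"] m1 by (simp add: flag_def)
    have nl: "\<not> ?L' (j + (m + 1) * dir b)" using m L[of "j + (m + 1) * dir b"] m1 by simp
    have l': "linked ?L' j (j + m * dir b)" using m link[of m] by simp
    have "open_end w' j b"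
      unfolding open_end_def using m l' f' by (intro exI[of _ "m + 1"]) simp
    moreover have "\<not> linked ?L' j (j + n * dir b)" if "N \<le> n" for n
    proof
      assume "linked ?L' j (j + n * dir b)"
      then have "linked ?L' j (j + (m + 1) * dir b)"
        using that m linked_between(1)[of ?L' j n b "m + 1"] by simp
      then show False using nl linked_ends(2) by blast
    qed
    ultimately show ?thesis by blast
  qed
  then show "open_end w' j b" "\<And>n. N \<le> n \<Longrightarrow> linked (live w') j (j + n * dir b) \<Longrightarrow>
      blank (letter w') (j + n * dir b)" by blast+
qed

text \<open>
If everything ahead of \<open>j\<close> is blank afterwards, the inverse automaton shows that \<open>w\<close> is blank from
distance \<open>R\<close> on. By \<open>clearance_local\<close> the same holds for \<open>w'\<close>, and then \<open>T\<close> makes \<open>w'\<close> blank from distance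
\<open>2 * R\<close> on afterwards. The cells that are closer are compared one by one.
\<close>

lemma belt_map_flag_local:
  assumes w: "w \<in> configs" "w' \<in> configs"
    and st: "steady (live w) \<tau>" "steady (live w') \<tau>'"
    and T: "automaton R T" "automaton R U" "\<forall>x\<in>pts. U (T x) = x"
    and eq: "\<tau> j = T" "\<tau>' j = T" and lj: "live w j"
    and ag: "\<And>k. \<bar>k - j\<bar> \<le> 3 * R + 4 \<Longrightarrow> w k = w' k"
    and cs: "\<And>k b. linked (live w) j k \<Longrightarrow> \<bar>k - j\<bar> \<le> 2 * R \<Longrightarrow> belt_syms \<tau> w k b = belt_syms \<tau>' w' k b"
    and oe: "open_end w j b" and cl: "cleared (live w) (belt_syms \<tau> w) j b"
  shows "open_end w' j b \<and> cleared (live w') (belt_syms \<tau>' w') j b"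
proof -
  let ?L = "live w" and ?L' = "live w'"
  have R0: "0 \<le> R" using T by (simp add: automaton_def)
  have "blank (letter w) (j + n * dir b)" if "R \<le> n" "linked ?L j (j + n * dir b)" for n
  proof -
    have "letter w (j + n * dir b) b' = U (read ?L (belt_syms \<tau> w) (j + n * dir b) b') 0" for b'
      using T eq by (intro letter_from_belt_syms[OF w(1) st(1) that(2)]) simp
    moreover have "U (read ?L (belt_syms \<tau> w) (j + n * dir b) b') 0 = z" for b'
      using T cl that belt_syms_S[OF w(1) st(1)]
      by (intro blank_spreads[where N = 0]) (auto simp: cleared_def)
    ultimately show ?thesis by (simp add: blank_def)
  qed
  note far = clearance_local[of j R w w' b, OF _ R0 lj oe this]
  have ag': "w k = w' k" if "\<bar>k - j\<bar> \<le> R + 2" for k using that R0 by (intro ag) simp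
  have "blank (belt_syms \<tau>' w') (j + n * dir b)" if n: "0 \<le> n" "linked ?L' j (j + n * dir b)" for n
  proof (cases "n \<le> 2 * R")
    case True
    have "linked ?L j (j + n * dir b) = linked ?L' j (j + n * dir b)"
      using True n ag by (intro linked_cong[of _ "2 * R"] live_local) auto
    then have l: "linked ?L j (j + n * dir b)" using n by simp
    then have "blank (belt_syms \<tau> w) (j + n * dir b)" using cl n by (simp add: cleared_def)
    then show ?thesis using cs[OF l] True n by (simp add: blank_def abs_mult)
  next
    case False
    have "T (read ?L' (letter w') (j + n * dir b) b') 0 = z" for b'
      using T far(2)[OF ag'] n False w R0 by (intro blank_spreads[where N = R]) (auto simp: configs_def)
    then show ?thesis
      using steady_linked[OF st(2) n(2)] eq by (simp add: blank_def belt_syms_def belt_def)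
  qed
  then show ?thesis using far(1)[OF ag'] by (simp add: cleared_def)
qed

text \<open>
The window consists of the cells up to distance \<open>2 * R\<close> whose new symbols are compared, of the \<open>R\<close>
further cells on which these symbols depend, and of a margin that settles which cells are live.
\<close>

lemma belt_map_local:
  assumes w: "w \<in> configs" "w' \<in> configs"
    and st: "steady (live w) \<tau>" "steady (live w') \<tau>'"
    and T: "reversible R T" and eq: "live w j \<Longrightarrow> \<tau> j = T" "live w' j \<Longrightarrow> \<tau>' j = T"
    and ag: "\<And>k. \<bar>k - j\<bar> \<le> 3 * R + 4 \<Longrightarrow> w k = w' k"
  shows "belt_map \<tau> w j = belt_map \<tau>' w' j"
proof -
  obtain U where U: "automaton R U" "\<forall>x\<in>pts. U (T x) = x" and TR: "automaton R T"
    using T unfolding reversible_def by blast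
  have R0: "0 \<le> R" using TR by (simp add: automaton_def)
  have L: "live w k = live w' k" if "\<bar>k - j\<bar> \<le> 3 * R + 3" for k
    using that ag by (intro live_local) auto
  show ?thesis
  proof (cases "live w j")
    case False
    then have "\<not> live w' j" using L[of j] R0 by simp
    then show ?thesis using False ag[of j] R0 by (simp add: belt_map_def update_frozen)
  next
    case True
    then have L'j: "live w' j" using L[of j] R0 by simp
    have cs: "belt_syms \<tau> w k b = belt_syms \<tau>' w' k b"
      if "linked (live w) j k" "linked (live w') j k" "\<bar>k - j\<bar> \<le> 2 * R" for k b
    proof -
      have "belt w k b t = belt w' k b t" if "\<bar>t\<bar> \<le> R" for t
        using that linked_ends(2)[OF \<open>linked (live w) j k\<close>] \<open>\<bar>k - j\<bar> \<le> 2 * R\<close> R0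
        by (intro belt_local[of k R] ag) auto
      then have "T (belt w k b) 0 = T (belt w' k b) 0"
        using w by (intro automaton_local[OF TR] belt_pts)
      then show ?thesis
        using steady_linked[OF st(1) that(1)] steady_linked[OF st(2) that(2)] eq True L'j
        by (simp add: belt_syms_def)
    qed
    have link: "linked (live w) j k = linked (live w') j k" if "\<bar>k - j\<bar> \<le> 2 * R" for k
    proof -
      have "k = j + (k - j) * dir True" by simp
      then show ?thesis using that L R0 linked_cong[of j "2 * R" "live w" "live w'" "k - j" True] by simp
    qed
    have "open_end w j b \<and> cleared (live w) (belt_syms \<tau> w) j b \<longleftrightarrow>
        open_end w' j b \<and> cleared (live w') (belt_syms \<tau>' w') j b" for b
    proof
      assume "open_end w j b \<and> cleared (live w) (belt_syms \<tau> w) j b"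
      then show "open_end w' j b \<and> cleared (live w') (belt_syms \<tau>' w') j b"
        using belt_map_flag_local[OF w st TR U eq(1)[OF True] eq(2)[OF L'j] True] ag cs link by blast
    next
      assume "open_end w' j b \<and> cleared (live w') (belt_syms \<tau>' w') j b"
      then show "open_end w j b \<and> cleared (live w) (belt_syms \<tau> w) j b"
        using belt_map_flag_local[OF w(2,1) st(2,1) TR U eq(2)[OF L'j] eq(1)[OF True] L'j]
          ag cs link by metis
    qed
    then show ?thesis
      using True L'j R0 cs[of j] by (simp add: belt_map_def update_def linked_refl fun_eq_iff)
  qed
qed

lemma live_shift: "live (shift w) = (\<lambda>i. live w (i + 1))"
  by (simp add: live_def agrees_def blank_def letter_def flag_def shift_def fun_eq_iff algebra_simps)

lemma letter_shift: "letter (shift w) = (\<lambda>i. letter w (i + 1))"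
  by (simp add: letter_def shift_def fun_eq_iff)

lemma flag_shift: "flag (shift w) = (\<lambda>i. flag w (i + 1))"
  by (simp add: flag_def shift_def fun_eq_iff)

lemma open_end_shift: "open_end (shift w) i b \<longleftrightarrow> open_end w (i + 1) b"
  unfolding open_end_def live_shift flag_shift linked_shift by (simp add: algebra_simps)

lemma cleared_shift: "cleared (\<lambda>i. L (i + 1)) (\<lambda>i. c (i + 1)) i b \<longleftrightarrow> cleared L c (i + 1) b"
  unfolding cleared_def linked_shift blank_def by (simp add: algebra_simps)

lemma belt_shift: "belt (shift w) i b = belt w (i + 1) b"
  unfolding belt_def read_def live_shift letter_shift walk_shift
  by (simp add: fun_eq_iff split: prod.splits)

lemma belt_map_shift: "belt_map (\<lambda>i. \<tau> (i + 1)) (shift w) = shift (belt_map \<tau> w)"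
proof -
  have "belt_syms (\<lambda>i. \<tau> (i + 1)) (shift w) = (\<lambda>i. belt_syms \<tau> w (i + 1))"
    by (simp add: belt_syms_def belt_shift fun_eq_iff)
  moreover have "update (shift w) (\<lambda>i. c (i + 1)) = shift (update w c)" for c
  proof
    fix i
    have "shift (update w c) i = update w c (i + 1)" by (simp add: shift_def)
    moreover have "shift w i = w (i + 1)" by (simp add: shift_def)
    ultimately show "update (shift w) (\<lambda>i. c (i + 1)) i = shift (update w c) i"
      by (simp only: update_def live_shift open_end_shift cleared_shift)
  qed
  ultimately show ?thesis by (simp add: belt_map_def)
qed

end

section \<open>The lamps\<close>

text \<open>
The parameters \<open>\<delta>\<close> and \<open>\<phi>\<close> say how \<open>A\<close> slides and recolours belts, \<open>\<psi>\<close> is the action of \<open>G\<close> on belts, and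
\<open>r\<close> is the finite point that the lamps look for.
\<close>

locale wreath_belts = belts S z + wreath A G
  for S :: "'s set" and z and A :: "('a, 'm) monoid_scheme" (structure) and G :: "('g, 'n) monoid_scheme" +
  fixes \<delta> :: "'a \<Rightarrow> int" and \<phi> :: "'a \<Rightarrow> 's \<Rightarrow> 's"
    and \<psi> :: "'g \<Rightarrow> (int \<Rightarrow> 's) \<Rightarrow> int \<Rightarrow> 's" and r :: "int \<Rightarrow> 's" and D :: int
  assumes \<delta>_mult: "\<And>a b. a \<in> carrier A \<Longrightarrow> b \<in> carrier A \<Longrightarrow> \<delta> (a \<otimes> b) = \<delta> a + \<delta> b"
    and \<phi>_mult: "\<And>a b s. a \<in> carrier A \<Longrightarrow> b \<in> carrier A \<Longrightarrow> s \<in> S \<Longrightarrow>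
      \<phi> (a \<otimes> b) s = \<phi> a (\<phi> b s)"
    and \<phi>_one: "\<And>s. s \<in> S \<Longrightarrow> \<phi> \<one> s = s"
    and \<phi>_S: "\<And>a s. a \<in> carrier A \<Longrightarrow> s \<in> S \<Longrightarrow> \<phi> a s \<in> S"
    and \<phi>_z: "\<And>a. a \<in> carrier A \<Longrightarrow> \<phi> a z = z"
    and \<psi>_reversible: "\<And>g. g \<in> carrier G \<Longrightarrow> \<exists>R. reversible R (\<psi> g)"
    and \<psi>_mult: "\<And>g h x. g \<in> carrier G \<Longrightarrow> h \<in> carrier G \<Longrightarrow> x \<in> pts \<Longrightarrow>
      \<psi> (g \<otimes>\<^bsub>G\<^esub> h) x = \<psi> g (\<psi> h x)"
    and \<psi>_one: "\<And>x. x \<in> pts \<Longrightarrow> \<psi> \<one>\<^bsub>G\<^esub> x = x"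
    and \<psi>_\<phi>: "\<And>g a x. g \<in> carrier G \<Longrightarrow> a \<in> carrier A \<Longrightarrow> x \<in> pts \<Longrightarrow>
      \<psi> g (\<lambda>t. \<phi> a (x t)) = (\<lambda>t. \<phi> a (\<psi> g x t))"
    and r_pts: "r \<in> pts" and r_support: "\<And>t. r t \<noteq> z \<Longrightarrow> \<bar>t\<bar> \<le> D" and r_0: "r 0 \<noteq> z"
begin

lemma D_nonneg: "0 \<le> D" using r_support[OF r_0] by simp

lemma \<delta>_one: "\<delta> \<one> = 0"
  using \<delta>_mult[of "\<one>" "\<one>"] by simp

lemma \<delta>_inv: "a \<in> carrier A \<Longrightarrow> \<delta> (inv a) = - \<delta> a"
  using \<delta>_mult[of a "inv a"] \<delta>_one by (simp add: A.r_inv)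

lemma \<phi>_inj:
  assumes "a \<in> carrier A" "s \<in> S" "s \<noteq> z" shows "\<phi> a s \<noteq> z"
proof
  assume "\<phi> a s = z"
  then have "\<phi> (inv a) (\<phi> a s) = z" using assms \<phi>_z by simp
  moreover have "\<phi> (inv a) (\<phi> a s) = s"
    using \<phi>_mult[of "inv a" a s] assms \<phi>_one by (simp add: A.l_inv)
  ultimately show False using assms by simp
qed

text \<open>
An integer valued character only slides (\<open>\<phi>\<close> is trivial), a character of finite order only recolours
(\<open>\<delta>\<close> is zero).
\<close>

definition \<omega> :: "'a \<Rightarrow> (int \<Rightarrow> 's) \<Rightarrow> int \<Rightarrow> 's" where
  "\<omega> a x = (\<lambda>t. \<phi> a (x (t + \<delta> a)))"

lemma \<omega>_mult:
  "a \<in> carrier A \<Longrightarrow> b \<in> carrier A \<Longrightarrow> x \<in> pts \<Longrightarrow> \<omega> (a \<otimes> b) x = \<omega> a (\<omega> b x)"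
  by (simp add: \<omega>_def \<phi>_mult \<delta>_mult pts_def fun_eq_iff algebra_simps)

lemma \<omega>_one: "x \<in> pts \<Longrightarrow> \<omega> \<one> x = x"
  by (simp add: \<omega>_def \<phi>_one \<delta>_one pts_def)

lemma automaton_\<omega>:
  assumes "a \<in> carrier A" shows "automaton \<bar>\<delta> a\<bar> (\<omega> a)"
proof -
  have "\<omega> a x 0 = \<omega> a y 0" if "\<forall>i. \<bar>i\<bar> \<le> \<bar>\<delta> a\<bar> \<longrightarrow> x i = y i" for x y
    using that[rule_format, of "\<delta> a"] by (simp add: \<omega>_def)
  moreover have "\<omega> a x \<in> pts" "\<omega> a (shift x) = shift (\<omega> a x)" if "x \<in> pts" for x
    using that assms by (simp_all add: \<omega>_def pts_def \<phi>_S shift_def fun_eq_iff algebra_simps)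
  moreover have "\<omega> a (\<lambda>_. z) = (\<lambda>_. z)" using assms by (simp add: \<omega>_def \<phi>_z)
  ultimately show ?thesis unfolding automaton_def by (metis abs_ge_zero)
qed

lemma reversible_\<omega>:
  assumes "a \<in> carrier A" shows "reversible \<bar>\<delta> a\<bar> (\<omega> a)"
proof -
  have "automaton \<bar>\<delta> a\<bar> (\<omega> (inv a))"
    using automaton_\<omega>[of "inv a"] assms by (simp add: \<delta>_inv)
  moreover have "\<omega> (inv a) (\<omega> a x) = x \<and> \<omega> a (\<omega> (inv a) x) = x" if "x \<in> pts" for x
    using that assms \<omega>_mult[of "inv a" a x] \<omega>_mult[of a "inv a" x] \<omega>_one
    by (simp add: A.l_inv A.r_inv)
  ultimately show ?thesis unfolding reversible_def using automaton_\<omega>[OF assms] by blast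
qed

lemma \<omega>_pts: "a \<in> carrier A \<Longrightarrow> x \<in> pts \<Longrightarrow> \<omega> a x \<in> pts"
  using automaton_\<omega> by (simp add: automaton_def)

lemma \<psi>_automaton:
  assumes "g \<in> carrier G" obtains R where "automaton R (\<psi> g)"
  using \<psi>_reversible[OF assms] unfolding reversible_def by blast

lemma \<psi>_pts: "g \<in> carrier G \<Longrightarrow> x \<in> pts \<Longrightarrow> \<psi> g x \<in> pts"
  using \<psi>_automaton unfolding automaton_def by blast

lemma \<psi>_\<omega>:
  assumes "g \<in> carrier G" "a \<in> carrier A" "x \<in> pts"
  shows "\<psi> g (\<omega> a x) = \<omega> a (\<psi> g x)"
proof -
  obtain R where "automaton R (\<psi> g)" using \<psi>_automaton assms by blast
  then show ?thesis
    using assms \<psi>_\<phi>[of g a "\<lambda>t. x (t + \<delta> a)"] automaton_translate[of R "\<psi> g" x "\<delta> a"]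
    by (simp add: \<omega>_def)
qed

text \<open>
The second condition makes the rest of the run blank. A finite run is a ring, which may be shorter than
the pattern; the same position is then reached for several \<open>t\<close>, and the values of the pattern at these
\<open>t\<close> have to coincide.
\<close>

definition placed :: "(int \<Rightarrow> 's cell) \<Rightarrow> int \<Rightarrow> bool \<Rightarrow> 'a \<Rightarrow> bool" where
  "placed w j b a \<longleftrightarrow> (\<forall>t. \<bar>t\<bar> \<le> D \<longrightarrow> belt w j b t = \<phi> a (r t)) \<and>
     (\<forall>k b'. linked (live w) j k \<and> letter w k b' \<noteq> z \<longrightarrow>
        (\<exists>t. \<bar>t\<bar> \<le> D \<and> walk (live w) t (j, b) = (k, b')))"

text \<open>
The condition on \<open>open_end\<close> guarantees that the blank rest of the run carries flags, which is what
makes being at home visible from a window around the pattern.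
\<close>

definition home :: "(int \<Rightarrow> 's cell) \<Rightarrow> int \<Rightarrow> bool" where
  "home w i \<longleftrightarrow> (\<forall>b. open_end w i b) \<and>
     (\<exists>j b. \<exists>a\<in>carrier A. linked (live w) i j \<and> placed w j b a)"

lemma home_linked:
  assumes "linked (live w) i j" shows "home w i = home w j"
  using open_end_linked[OF assms] linked_trans[OF assms] linked_trans[OF linked_sym[OF assms]]
  unfolding home_def by blast

lemma belt_walk:
  assumes "walk (live w) t (i, b) = (j, b')"
  shows "belt w j b' s = belt w i b (s + t)"
  using read_walk[OF assms] by (simp add: belt_def)

text \<open>
Sliding moves the position of the pattern, and recolouring replaces the colour \<open>a0\<close> of the pattern by
the product of \<open>a\<close> and \<open>a0\<close>.
\<close>

lemma home_\<omega>:
  assumes w: "w \<in> configs" and st: "steady (live w) \<tau>" and i: "live w i"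
    and a: "a \<in> carrier A" "\<tau> i = \<omega> a" and h: "home w i"
  shows "home (belt_map \<tau> w) i"
proof -
  let ?L = "live w" and ?w = "belt_map \<tau> w"
  obtain j b a0 where j: "a0 \<in> carrier A" "linked ?L i j" and p: "placed w j b a0"
    using h by (auto simp: home_def)
  obtain j' b' where j': "walk ?L (- \<delta> a) (j, b) = (j', b')" by fastforce
  then have l: "linked ?L j j'"
    using walk_linked[of ?L j "- \<delta> a" b, OF linked_ends(2)[OF j(2)]] by simp
  have lv: "live ?w = ?L" using live_belt_map[OF w st] .
  have bt: "belt ?w k c = \<omega> a (belt w k c)" if "linked ?L i k" for k c
    using belt_belt_map[OF w st linked_ends(2)[OF that]] steady_linked[OF st that] a by simp
  have lij': "linked ?L i j'" using j(2) l linked_trans by blast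
  have "belt ?w j' b' t = \<phi> (a \<otimes> a0) (r t)" if "\<bar>t\<bar> \<le> D" for t
    using that bt[OF lij'] p j a r_pts
    by (simp add: \<omega>_def belt_walk[OF j'] placed_def \<phi>_mult pts_def)
  moreover have "\<exists>t. \<bar>t\<bar> \<le> D \<and> walk ?L t (j', b') = (k, c)"
    if k: "linked ?L j' k" "letter ?w k c \<noteq> z" for k c
  proof -
    have lik: "linked ?L i k" using lij' k linked_trans by blast
    obtain k2 c2 where k2: "walk ?L (\<delta> a) (k, c) = (k2, c2)" by fastforce
    have "letter ?w k c = belt ?w k c 0" by (simp add: belt_def)
    also have "\<dots> = \<phi> a (letter w k2 c2)"
      using bt[OF lik] belt_walk[OF k2, of 0] by (simp add: \<omega>_def) (simp add: belt_def)
    finally have "letter w k2 c2 \<noteq> z" using k a \<phi>_z by auto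
    moreover have "linked ?L k k2"
      using walk_linked[of ?L k "\<delta> a" c, OF linked_ends(2)[OF lik]] k2 by simp
    then have "linked ?L j k2"
      using linked_trans[OF linked_trans[OF l k(1)]] by blast
    ultimately obtain t where t: "\<bar>t\<bar> \<le> D" "walk ?L t (j, b) = (k2, c2)"
      using p unfolding placed_def by blast
    have "walk ?L t (j', b') = walk ?L (t + - \<delta> a) (j, b)"
      unfolding walk_add j' ..
    also have "\<dots> = walk ?L (- \<delta> a) (walk ?L t (j, b))"
      using walk_add[of ?L "- \<delta> a" t] by (simp add: algebra_simps)
    also have "\<dots> = (k, c)" using t walk_add[of ?L "- \<delta> a" "\<delta> a" "(k, c)"] k2 by simp
    finally show ?thesis using t by blast
  qed
  ultimately have "placed ?w j' b' (a \<otimes> a0)" unfolding placed_def lv by blast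
  moreover have "open_end ?w i b" for b
    using open_end_belt_map[OF w st i] h by (simp add: home_def)
  ultimately show ?thesis
    unfolding home_def lv using lij' a j by blast
qed

lemma steady_\<omega>:
  assumes "\<And>i. l i \<in> carrier A" "\<And>i. L i \<Longrightarrow> L (i + 1) \<Longrightarrow> l i = l (i + 1)"
  shows "steady L (\<lambda>i. \<omega> (l i))"
  using assms reversible_\<omega> unfolding steady_def by metis

lemma home_\<omega>_iff:
  assumes w: "w \<in> configs" and l: "\<And>i. l i \<in> carrier A"
    "\<And>i. live w i \<Longrightarrow> live w (i + 1) \<Longrightarrow> l i = l (i + 1)" and i: "live w i"
  shows "home (belt_map (\<lambda>i. \<omega> (l i)) w) i = home w i"
proof
  show "home w i \<Longrightarrow> home (belt_map (\<lambda>i. \<omega> (l i)) w) i"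
    by (rule home_\<omega>[OF w steady_\<omega>[of l, OF l] i l(1)]) auto
  let ?w = "belt_map (\<lambda>i. \<omega> (l i)) w"
  have st: "steady (live w) (\<lambda>i. \<omega> (l i))" by (rule steady_\<omega>[of l, OF l])
  have st': "steady (live w) (\<lambda>i. \<omega> (inv (l i)))"
    using l by (intro steady_\<omega>) auto
  have lv: "live ?w = live w" using live_belt_map[OF w st] .
  have "belt_map (\<lambda>i. \<omega> (inv (l i))) ?w = belt_map (\<lambda>i. \<omega> (inv (l i)) \<circ> \<omega> (l i)) w"
    by (rule belt_map_belt_map[OF w st])
  also have "\<dots> = w"
  proof
    fix j show "belt_map (\<lambda>i. \<omega> (inv (l i)) \<circ> \<omega> (l i)) w j = w j"
      using l by (intro belt_map_id_on[OF w]) (simp add: \<omega>_mult[symmetric] A.l_inv \<omega>_one)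
  qed
  finally have e: "belt_map (\<lambda>i. \<omega> (inv (l i))) ?w = w" .
  assume "home ?w i"
  then have "home (belt_map (\<lambda>i. \<omega> (inv (l i))) ?w) i"
    using belt_map_configs[OF w st] st' i lv l
    by (intro home_\<omega>[where \<tau> = "\<lambda>i. \<omega> (inv (l i))" and a = "inv (l i)"]) simp_all
  then show "home w i" unfolding e .
qed

definition G_map :: "'g \<Rightarrow> (int \<Rightarrow> 's cell) \<Rightarrow> int \<Rightarrow> 's cell" where
  "G_map g = belt_map (\<lambda>_. \<psi> g)"

lemma steady_\<psi>: "g \<in> carrier G \<Longrightarrow> steady L (\<lambda>_. \<psi> g)"
  using \<psi>_reversible steady_const by blast

lemma G_map_configs: "g \<in> carrier G \<Longrightarrow> w \<in> configs \<Longrightarrow> G_map g w \<in> configs"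
  unfolding G_map_def by (intro belt_map_configs steady_\<psi>)

lemma live_G_map: "g \<in> carrier G \<Longrightarrow> w \<in> configs \<Longrightarrow> live (G_map g w) = live w"
  unfolding G_map_def by (intro live_belt_map steady_\<psi>)

lemma G_map_mult:
  assumes "g \<in> carrier G" "h \<in> carrier G" "w \<in> configs"
  shows "G_map g (G_map h w) = G_map (g \<otimes>\<^bsub>G\<^esub> h) w"
  unfolding G_map_def belt_map_belt_map[OF assms(3) steady_\<psi>[OF assms(2)]]
  by (rule belt_map_cong) (use assms \<psi>_mult in auto)

lemma G_map_one: "w \<in> configs \<Longrightarrow> G_map \<one>\<^bsub>G\<^esub> w = w"
  unfolding G_map_def by (rule ext, rule belt_map_id_on) (simp_all add: \<psi>_one)

text \<open>
The lamp at \<open>g\<close> is the conjugate by \<open>g\<close> of the lamp at the identity: it acts on the runs that are brought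
home by the inverse of \<open>g\<close>.
\<close>

definition load :: "('g \<Rightarrow> 'a) \<Rightarrow> (int \<Rightarrow> 's cell) \<Rightarrow> int \<Rightarrow> 'a" where
  "load u w i = finprod A u {g \<in> carrier G. u g \<noteq> \<one> \<and> home (G_map (inv\<^bsub>G\<^esub> g) w) i}"

lemma load_closed: "u \<in> lamps \<Longrightarrow> load u w i \<in> carrier A"
  unfolding load_def by (intro A.finprod_closed) (auto simp: lamps_closed)

lemma load_link:
  assumes "w \<in> configs" "linked (live w) i j"
  shows "load u w i = load u w j"
proof -
  have "home (G_map (inv\<^bsub>G\<^esub> g) w) i = home (G_map (inv\<^bsub>G\<^esub> g) w) j" if "g \<in> carrier G" for g
    using assms that by (intro home_linked) (simp add: live_G_map)
  then have "{g \<in> carrier G. u g \<noteq> \<one> \<and> home (G_map (inv\<^bsub>G\<^esub> g) w) i}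
      = {g \<in> carrier G. u g \<noteq> \<one> \<and> home (G_map (inv\<^bsub>G\<^esub> g) w) j}" by blast
  then show ?thesis by (simp add: load_def)
qed

lemma load_step:
  assumes "w \<in> configs" "live w i" "live w (i + 1)"
  shows "load u w i = load u w (i + 1)"
  using load_link[OF assms(1)] linked_step[of "live w" i True] assms by simp

definition lamp_map :: "('g \<Rightarrow> 'a) \<Rightarrow> (int \<Rightarrow> 's cell) \<Rightarrow> int \<Rightarrow> 's cell" where
  "lamp_map u w = belt_map (\<lambda>i. \<omega> (load u w i)) w"

lemma steady_load: "u \<in> lamps \<Longrightarrow> w \<in> configs \<Longrightarrow> steady (live w) (\<lambda>i. \<omega> (load u w i))"
  by (intro steady_\<omega> load_closed load_step)

lemma lamp_map_configs: "u \<in> lamps \<Longrightarrow> w \<in> configs \<Longrightarrow> lamp_map u w \<in> configs"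
  unfolding lamp_map_def by (intro belt_map_configs steady_load)

lemma G_map_lamp_map_load:
  assumes "g \<in> carrier G" "u \<in> lamps" "w \<in> configs"
  shows "G_map g (lamp_map u w) = belt_map (\<lambda>i. \<omega> (load u w i)) (G_map g w)"
proof -
  have "G_map g (lamp_map u w) = belt_map (\<lambda>i. \<psi> g \<circ> \<omega> (load u w i)) w"
    unfolding G_map_def lamp_map_def by (rule belt_map_belt_map[OF assms(3) steady_load[OF assms(2,3)]])
  also have "\<dots> = belt_map (\<lambda>i. \<omega> (load u w i) \<circ> \<psi> g) w"
    by (rule belt_map_cong) (use assms load_closed \<psi>_\<omega> in auto)
  also have "\<dots> = belt_map (\<lambda>i. \<omega> (load u w i)) (G_map g w)"
    unfolding G_map_def by (rule belt_map_belt_map[symmetric]) (use assms steady_\<psi> in auto)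
  finally show ?thesis .
qed

text \<open>
The lamps do not disturb each other: \<open>G\<close> commutes with \<open>\<omega>\<close>, and \<open>\<omega>\<close> respects being at home.
\<close>

lemma home_G_map_lamp_map:
  assumes "g \<in> carrier G" "u \<in> lamps" "w \<in> configs" "live w i"
  shows "home (G_map g (lamp_map u w)) i = home (G_map g w) i"
  unfolding G_map_lamp_map_load[OF assms(1-3)]
  using assms load_step by (intro home_\<omega>_iff G_map_configs load_closed) (auto simp: live_G_map)

lemma load_lamp_map:
  assumes "u' \<in> lamps" "w \<in> configs" "live w i"
  shows "load u (lamp_map u' w) i = load u w i"
proof -
  have "{g \<in> carrier G. u g \<noteq> \<one> \<and> home (G_map (inv\<^bsub>G\<^esub> g) (lamp_map u' w)) i}
      = {g \<in> carrier G. u g \<noteq> \<one> \<and> home (G_map (inv\<^bsub>G\<^esub> g) w) i}"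
    using home_G_map_lamp_map[OF _ assms] by auto
  then show ?thesis by (simp add: load_def)
qed

lemma load_alt:
  assumes "u \<in> lamps" "finite B" "B \<subseteq> carrier G" "{g \<in> carrier G. u g \<noteq> \<one>} \<subseteq> B"
  shows "load u w i = finprod A (\<lambda>g. if home (G_map (inv\<^bsub>G\<^esub> g) w) i then u g else \<one>) B"
  unfolding load_def
  using assms by (intro A.finprod_mono_neutral_cong_left) (auto simp: lamps_closed)

lemma load_mult:
  assumes "u \<in> lamps" "u' \<in> lamps"
  shows "load (lamp_mult u u') w i = load u w i \<otimes> load u' w i"
proof -
  define B where "B = {g \<in> carrier G. u g \<noteq> \<one>} \<union> {g \<in> carrier G. u' g \<noteq> \<one>}"
  have B: "finite B" "B \<subseteq> carrier G" using assms by (auto simp: B_def lamps_iff)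
  have s: "{g \<in> carrier G. lamp_mult u u' g \<noteq> \<one>} \<subseteq> B"
    by (auto simp: B_def lamp_mult_def)
  have "load (lamp_mult u u') w i
      = finprod A (\<lambda>g. if home (G_map (inv\<^bsub>G\<^esub> g) w) i then lamp_mult u u' g else \<one>) B"
    by (rule load_alt[OF lamp_mult_closed[OF assms] B s])
  also have "\<dots> = finprod A (\<lambda>g. (if home (G_map (inv\<^bsub>G\<^esub> g) w) i then u g else \<one>)
      \<otimes> (if home (G_map (inv\<^bsub>G\<^esub> g) w) i then u' g else \<one>)) B"
    using B assms by (intro A.finprod_cong') (auto simp: lamp_mult_def lamps_closed subset_iff)
  also have "\<dots> = load u w i \<otimes> load u' w i"
    using B assms load_alt[OF assms(1) B, of w i] load_alt[OF assms(2) B, of w i]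
    by (subst A.finprod_multf) (auto simp: B_def lamps_closed subset_iff)
  finally show ?thesis .
qed

lemma lamp_map_mult:
  assumes "u \<in> lamps" "u' \<in> lamps" "w \<in> configs"
  shows "lamp_map u (lamp_map u' w) = lamp_map (lamp_mult u u') w"
proof -
  have "lamp_map u (lamp_map u' w) = belt_map (\<lambda>i. \<omega> (load u (lamp_map u' w) i) \<circ> \<omega> (load u' w i)) w"
    unfolding lamp_map_def[of u] unfolding lamp_map_def[of u']
    by (rule belt_map_belt_map[OF assms(3) steady_load[OF assms(2,3)]])
  also have "\<dots> = lamp_map (lamp_mult u u') w"
    unfolding lamp_map_def[of "lamp_mult u u'"]
    by (rule belt_map_cong)
      (use assms in \<open>simp_all add: load_lamp_map load_mult \<omega>_mult load_closed\<close>)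
  finally show ?thesis .
qed

lemma load_move:
  assumes "u \<in> lamps" "h \<in> carrier G" "w \<in> configs"
  shows "load (lamp_move h u) (G_map h w) i = load u w i"
proof -
  let ?X = "{g \<in> carrier G. u g \<noteq> \<one> \<and> home (G_map (inv\<^bsub>G\<^esub> g) w) i}"
  have Fh: "G_map (inv\<^bsub>G\<^esub> (h \<otimes>\<^bsub>G\<^esub> g)) (G_map h w) = G_map (inv\<^bsub>G\<^esub> g) w" if "g \<in> carrier G" for g
    using that assms by (simp add: G_map_mult G.inv_mult_group G.m_assoc G.l_inv)
  have mv: "lamp_move h u (h \<otimes>\<^bsub>G\<^esub> g) = u g" if "g \<in> carrier G" for g
    using that assms by (simp add: lamp_move_def G.m_assoc[symmetric] G.l_inv)
  have X: "{g \<in> carrier G. lamp_move h u g \<noteq> \<one> \<and> home (G_map (inv\<^bsub>G\<^esub> g) (G_map h w)) i} = (\<lambda>g. h \<otimes>\<^bsub>G\<^esub> g) ` ?X"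
    (is "?Y = _")
  proof
    show "?Y \<subseteq> (\<lambda>g. h \<otimes>\<^bsub>G\<^esub> g) ` ?X"
    proof
      fix g assume g: "g \<in> ?Y"
      define g' where "g' = inv\<^bsub>G\<^esub> h \<otimes>\<^bsub>G\<^esub> g"
      have "g' \<in> carrier G" "g = h \<otimes>\<^bsub>G\<^esub> g'"
        using g assms by (simp_all add: g'_def G.m_assoc[symmetric] G.r_inv)
      then show "g \<in> (\<lambda>g. h \<otimes>\<^bsub>G\<^esub> g) ` ?X" using g Fh mv by auto
    qed
    show "(\<lambda>g. h \<otimes>\<^bsub>G\<^esub> g) ` ?X \<subseteq> ?Y" using Fh mv assms by auto
  qed
  have "load (lamp_move h u) (G_map h w) i = finprod A (lamp_move h u) ((\<lambda>g. h \<otimes>\<^bsub>G\<^esub> g) ` ?X)"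
    unfolding load_def X ..
  also have "\<dots> = finprod A (\<lambda>g. lamp_move h u (h \<otimes>\<^bsub>G\<^esub> g)) ?X"
    using assms mv by (intro A.finprod_reindex) (auto simp: inj_on_def lamps_closed)
  also have "\<dots> = load u w i"
    unfolding load_def using assms mv by (intro A.finprod_cong') (auto simp: lamps_closed)
  finally show ?thesis .
qed

lemma G_map_lamp_map:
  assumes "u \<in> lamps" "h \<in> carrier G" "w \<in> configs"
  shows "G_map h (lamp_map u w) = lamp_map (lamp_move h u) (G_map h w)"
  unfolding G_map_lamp_map_load[OF assms(2,1,3)] lamp_map_def[of "lamp_move h u"] load_move[OF assms] ..

lemma lamp_map_trivial:
  assumes "w \<in> configs" "\<And>g. g \<in> carrier G \<Longrightarrow> u g = \<one>"
  shows "lamp_map u w = w"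
proof
  have e: "{g \<in> carrier G. u g \<noteq> \<one> \<and> home (G_map (inv\<^bsub>G\<^esub> g) w) i} = {}" for i
    using assms by auto
  then have "load u w i = \<one>" for i unfolding load_def e by simp
  then show "lamp_map u w i = w i" for i
    unfolding lamp_map_def using \<omega>_one by (intro belt_map_id_on assms) auto
qed

section \<open>Continuity of the lamps\<close>

lemma local_comp:
  assumes "window_local cells \<Phi>" "window_local cells \<Psi>" "\<And>w. w \<in> configs \<Longrightarrow> \<Psi> w \<in> configs"
  shows "window_local cells (\<lambda>w. \<Phi> (\<Psi> w))"
proof -
  obtain M N where M: "has_radius cells \<Phi> M" and N: "has_radius cells \<Psi> N"
    using assms(1,2) by (auto simp: window_local_def)
  have "has_radius cells (\<lambda>w. \<Phi> (\<Psi> w)) (M + N)"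
  proof (rule has_radiusI)
    fix w w' j assume w: "w \<in> points cells" "w' \<in> points cells"
      and eq: "\<And>k. \<bar>k - j\<bar> \<le> M + N \<Longrightarrow> w k = w' k"
    have "\<Psi> w k = \<Psi> w' k" if "\<bar>k - j\<bar> \<le> M" for k
      using that by (intro has_radiusD[OF N w] eq) linarith
    then show "\<Phi> (\<Psi> w) j = \<Phi> (\<Psi> w') j"
      using assms(3) w by (intro has_radiusD[OF M]) (simp_all add: configs_eq)
  qed (use has_radius_nonneg[OF M] has_radius_nonneg[OF N] in simp)
  then show ?thesis unfolding window_local_def by blast
qed

lemma local_cong:
  assumes "window_local cells \<Phi>" "\<And>w. w \<in> configs \<Longrightarrow> \<Psi> w = \<Phi> w" shows "window_local cells \<Psi>"
  using assms unfolding window_local_def has_radius_def configs_eq by simp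

lemma local_G_map:
  assumes "g \<in> carrier G" shows "window_local cells (G_map g)"
proof -
  obtain R where R: "reversible R (\<psi> g)" using \<psi>_reversible[OF assms] by blast
  then have R0: "0 \<le> R" by (simp add: reversible_def automaton_def)
  show ?thesis
    unfolding window_local_def has_radius_def configs_eq[symmetric]
  proof (intro exI[of _ "3 * R + 4"] conjI ballI allI impI)
    show "0 \<le> 3 * R + 4" using R0 by simp
    fix w w' j assume *: "w \<in> configs" "w' \<in> configs" "\<forall>k. \<bar>k - j\<bar> \<le> 3 * R + 4 \<longrightarrow> w k = w' k"
    show "G_map g w j = G_map g w' j"
      unfolding G_map_def
      by (rule belt_map_local[OF *(1,2) steady_\<psi>[OF assms] steady_\<psi>[OF assms] R])
        (use *(3) in auto)
  qed
qed

definition single :: "'a \<Rightarrow> 'g \<Rightarrow> 'a" where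
  "single a = (\<lambda>g\<in>carrier G. if g = \<one>\<^bsub>G\<^esub> then a else \<one>)"

lemma single_lamps: "a \<in> carrier A \<Longrightarrow> single a \<in> lamps"
proof -
  assume a: "a \<in> carrier A"
  have "{g \<in> carrier G. single a g \<noteq> \<one>} \<subseteq> {\<one>\<^bsub>G\<^esub>}" by (auto simp: single_def)
  then have "finite {g \<in> carrier G. single a g \<noteq> \<one>}" using finite_subset by blast
  then show ?thesis using a unfolding lamps_iff by (auto simp: single_def)
qed

lemma load_single:
  assumes "a \<in> carrier A" "w \<in> configs"
  shows "load (single a) w i = (if home w i then a else \<one>)"
proof -
  have "load (single a) w i
      = finprod A (\<lambda>g. if home (G_map (inv\<^bsub>G\<^esub> g) w) i then single a g else \<one>) {\<one>\<^bsub>G\<^esub>}"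
    by (rule load_alt[OF single_lamps[OF assms(1)]]) (auto simp: single_def)
  also have "\<dots> = (if home w i then a else \<one>)"
    using assms by (simp add: G_map_one single_def)
  finally show ?thesis .
qed

text \<open>
The cells far away from the pattern do not see whether their run is at home. They need not know it,
since the lamp does not change them (\<open>lamp_map_single_far\<close>).
\<close>

definition near :: "int \<Rightarrow> (int \<Rightarrow> 's cell) \<Rightarrow> int \<Rightarrow> bool" where
  "near K w i \<longleftrightarrow> live w i \<and> (\<forall>b. open_end w i b) \<and>
     (\<exists>j b. \<exists>a\<in>carrier A. linked (live w) i j \<and> placed w j b a \<and> \<bar>j - i\<bar> \<le> K)"

lemma near_home: "near K w i \<Longrightarrow> home w i"
  unfolding near_def home_def by blast

lemma placed_dist:
  assumes "placed w j b a" "linked (live w) j k" "letter w k c \<noteq> z"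
  shows "\<bar>k - j\<bar> \<le> D"
proof -
  obtain t where "\<bar>t\<bar> \<le> D" "walk (live w) t (j, b) = (k, c)"
    using assms unfolding placed_def by blast
  then show ?thesis using walk_dist[of "live w" j t b, OF linked_ends(1)[OF assms(2)]] by simp
qed

text \<open>
On both sides of \<open>j\<close>, all cells at distance at least \<open>K + D + 1\<close> are blank, so \<open>clearance_local\<close> shows that
no cell outside the window can spoil the pattern.
\<close>

lemma near_local:
  assumes ag: "\<And>k. \<bar>k - j\<bar> \<le> K + 2 * D + 5 \<Longrightarrow> w k = w' k" and K: "0 \<le> K"
    and nr: "near K w j"
  shows "near K w' j"
proof -
  let ?L = "live w" and ?L' = "live w'"
  define N where "N = K + D + 1"
  have N0: "0 \<le> N" using K D_nonneg by (simp add: N_def)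
  obtain j0 b0 a0 where lj: "?L j" and oe: "\<And>b. open_end w j b" and a0: "a0 \<in> carrier A"
    and l0: "linked ?L j j0" and p: "placed w j0 b0 a0" and d0: "\<bar>j0 - j\<bar> \<le> K"
    using nr unfolding near_def by blast
  have L: "?L k = ?L' k" if "\<bar>k - j\<bar> \<le> K + 2 * D + 4" for k
    using that ag by (intro live_local) auto
  have dist: "\<bar>j + n * dir b - j\<bar> = \<bar>n\<bar>" for n b by (simp add: abs_mult)
  have link: "linked ?L j (j + n * dir b) = linked ?L' j (j + n * dir b)" if "\<bar>n\<bar> \<le> N" for n b
    using that L D_nonneg by (intro linked_cong[of _ N]) (auto simp: N_def)
  have far: "blank (letter w) (j + n * dir b)" if "N \<le> n" "linked ?L j (j + n * dir b)" for n b
  proof (rule ccontr)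
    assume "\<not> blank (letter w) (j + n * dir b)"
    then obtain c where "letter w (j + n * dir b) c \<noteq> z" by (auto simp: blank_def)
    then have "\<bar>j + n * dir b - j0\<bar> \<le> D"
      using placed_dist[OF p] linked_trans[OF linked_sym[OF l0] that(2)] by blast
    then show False using dist[of n b] d0 that N0 by (simp add: N_def)
  qed
  have side: "open_end w' j b"
    "N \<le> n \<Longrightarrow> linked ?L' j (j + n * dir b) \<Longrightarrow> blank (letter w') (j + n * dir b)" for b n
    by (rule clearance_local[OF ag N0 lj oe far]; use D_nonneg in \<open>simp add: N_def\<close>)+
  have l0': "linked ?L' j j0"
  proof -
    have "j0 = j + (j0 - j) * dir True" by simp
    then show ?thesis using l0 link[of "j0 - j" True] d0 D_nonneg by (simp add: N_def)
  qed
  have L0: "?L k = ?L' k" if "\<bar>k - j0\<bar> \<le> D + 1" for k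
    using that d0 D_nonneg by (intro L) linarith
  have "belt w' j0 b0 t = \<phi> a0 (r t)" if "\<bar>t\<bar> \<le> D" for t
  proof -
    have "belt w j0 b0 t = belt w' j0 b0 t"
      using that d0 D_nonneg linked_ends(2)[OF l0] by (intro belt_local[of j0 D] ag) auto
    then show ?thesis using p that by (simp add: placed_def)
  qed
  moreover have "\<exists>t. \<bar>t\<bar> \<le> D \<and> walk ?L' t (j0, b0) = (k, c)"
    if k: "linked ?L' j0 k" "letter w' k c \<noteq> z" for k c
  proof -
    have ljk: "linked ?L' j k" using l0' k(1) linked_trans by blast
    then obtain b n where n: "0 \<le> n" "k = j + n * dir b" using linked_direction by blast
    have nN: "n < N"
      using side(2)[of n b] ljk k(2) unfolding n(2) blank_def by (meson not_less)
    have "linked ?L j k" using ljk link[of n b] n nN by simp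
    then have "linked ?L j0 k" using linked_trans[OF linked_sym[OF l0]] by blast
    moreover have "w k = w' k" using dist[of n b] n nN D_nonneg by (intro ag) (simp add: N_def)
    then have "letter w k c \<noteq> z" using k by (simp add: letter_def)
    ultimately obtain t where t: "\<bar>t\<bar> \<le> D" "walk ?L t (j0, b0) = (k, c)"
      using p unfolding placed_def by blast
    moreover have "walk ?L t (j0, b0) = walk ?L' t (j0, b0)"
      using t L0 linked_ends(2)[OF l0] by (intro walk_cong) auto
    ultimately show ?thesis by auto
  qed
  ultimately have "placed w' j0 b0 a0" unfolding placed_def by blast
  then show ?thesis
    unfolding near_def using side(1) a0 l0' d0 linked_ends(1)[OF l0'] by blast
qed

text \<open>
Only a run at home is changed. At a cell of such a run which is far from the pattern, the symbols are
blank before and after. The flag that looks towards the pattern is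
unset before and after because the pattern is not blank, and the other flag sees blank cells only.
\<close>

lemma lamp_map_single_far:
  assumes w: "w \<in> configs" and a: "a \<in> carrier A" and nn: "\<not> near (D + \<bar>\<delta> a\<bar> + 1) w j"
  shows "lamp_map (single a) w j = w j"
proof (cases "live w j \<and> home w j")
  case False
  show ?thesis
  proof (cases "live w j")
    case True
    then have "\<not> home w j" using False by simp
    then have "load (single a) w k = \<one>" if "linked (live w) j k" for k
      using home_linked[OF that] load_single[OF a w] by simp
    then show ?thesis unfolding lamp_map_def
      by (intro belt_map_id_on[OF w]) (simp add: \<omega>_one)
  qed (simp add: lamp_map_def belt_map_def update_frozen)
next
  case True
  let ?L = "live w" and ?c = "belt_syms (\<lambda>i. \<omega> (load (single a) w i)) w"
  have lj: "?L j" using True by simp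
  obtain j0 b0 a0 where a0: "a0 \<in> carrier A" and l0: "linked ?L j j0" and p: "placed w j0 b0 a0"
    using True unfolding home_def by blast
  have d0: "D + \<bar>\<delta> a\<bar> + 1 < \<bar>j0 - j\<bar>"
    using nn True a0 l0 p unfolding near_def home_def by (meson not_less)
  have c: "?c k b = \<phi> a (belt w k b (\<delta> a))" if "linked ?L j k" for k b
    using home_linked[OF that] True load_single[OF a w] by (simp add: belt_syms_def \<omega>_def)
  have far: "letter w k b = z \<and> ?c k b = z"
    if "linked ?L j k" "D + \<bar>\<delta> a\<bar> < \<bar>k - j0\<bar>" for k b
  proof
    have l: "linked ?L j0 k" using linked_trans[OF linked_sym[OF l0] that(1)] .
    show "letter w k b = z" using placed_dist[OF p l] that(2) by fastforce
    obtain k' b' where k': "walk ?L (\<delta> a) (k, b) = (k', b')" by fastforce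
    have "linked ?L k k'" "\<bar>k' - k\<bar> \<le> \<bar>\<delta> a\<bar>"
      using walk_linked[of ?L k "\<delta> a" b, OF linked_ends(2)[OF l]]
        walk_dist[of ?L k "\<delta> a" b, OF linked_ends(2)[OF l]] k' by simp_all
    then have "letter w k' b' = z"
      using placed_dist[OF p linked_trans[OF l], of k' b'] that(2) by fastforce
    then have "belt w k b (\<delta> a) = z"
      using k' by (simp add: belt_def read_def)
    then show "?c k b = z" using c[OF that(1)] \<phi>_z[OF a] by simp
  qed
  have "linked ?L j j" using lj by (simp add: linked_refl)
  then have jz: "?c j b = letter w j b" for b using far[of j] d0 by simp
  obtain b1 n where n: "0 \<le> n" "j0 = j + n * dir b1" using linked_direction[OF l0] by blast
  have nd: "D + \<bar>\<delta> a\<bar> + 1 < n" using d0 n by (simp add: abs_mult)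
  have "cleared ?L ?c j b \<longleftrightarrow> cleared ?L (letter w) j b" for b
  proof (cases "b = b1")
    case True
    have ne: "letter w j0 b0 \<noteq> z"
    proof -
      have "belt w j0 b0 0 = \<phi> a0 (r 0)"
        using p D_nonneg unfolding placed_def by simp
      then have "letter w j0 b0 = \<phi> a0 (r 0)" by (simp add: belt_def)
      then show ?thesis using \<phi>_inj[OF a0 _ r_0] r_pts by (simp add: pts_def)
    qed
    have "\<not> blank (letter w) j0" using ne by (auto simp: blank_def)
    then have "\<not> cleared ?L (letter w) j b" using l0 n True unfolding cleared_def by blast
    moreover obtain k k_b where k: "walk ?L (- \<delta> a) (j0, b0) = (k, k_b)" by fastforce
    have lk: "linked ?L j0 k" and dk: "\<bar>k - j0\<bar> \<le> \<bar>\<delta> a\<bar>"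
      using walk_linked[of ?L j0 "- \<delta> a" b0, OF linked_ends(2)[OF l0]]
        walk_dist[of ?L j0 "- \<delta> a" b0, OF linked_ends(2)[OF l0]] k by simp_all
    have ljk: "linked ?L j k" using linked_trans[OF l0 lk] .
    have "belt w k k_b (\<delta> a) = letter w j0 b0"
      using belt_walk[OF k, of "\<delta> a"] by (simp add: belt_def)
    then have "?c k k_b \<noteq> z"
      using c[OF ljk] \<phi>_inj[OF a] ne w by (simp add: configs_def)
    then have "\<not> blank ?c k" by (auto simp: blank_def)
    moreover obtain m where "m \<ge> n - \<bar>\<delta> a\<bar>" "k = j + m * dir b1"
      using linked_near_ahead[of ?L j k j0 "\<bar>\<delta> a\<bar>" n b1, OF ljk dk n(2)] nd D_nonneg by auto
    ultimately have "\<not> cleared ?L ?c j b"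
      using ljk nd D_nonneg True unfolding cleared_def by (smt (verit))
    then show ?thesis using \<open>\<not> cleared ?L (letter w) j b\<close> by simp
  next
    case False
    then have "dir b = - dir b1" by (cases b; cases b1) auto
    then have "D + \<bar>\<delta> a\<bar> < \<bar>j + m * dir b - j0\<bar>" if "0 \<le> m" for m
      using that n nd by (cases b1) auto
    then show ?thesis using far by (auto simp: cleared_def blank_def)
  qed
  then have "cleared ?L ?c j = cleared ?L (letter w) j" by blast
  then show ?thesis unfolding lamp_map_def belt_map_def using jz by (intro update_self)
qed

lemma local_lamp_map_single:
  assumes a: "a \<in> carrier A" shows "window_local cells (lamp_map (single a))"
proof -
  define K where "K = D + \<bar>\<delta> a\<bar> + 1"
  have K0: "0 \<le> K" using D_nonneg by (simp add: K_def)
  have both: "lamp_map (single a) w j = lamp_map (single a) w' j"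
    if w: "w \<in> configs" "w' \<in> configs"
      and ag: "\<forall>k. \<bar>k - j\<bar> \<le> 3 * \<bar>\<delta> a\<bar> + 4 + K + 2 * D + 5 \<longrightarrow> w k = w' k"
      and nr: "near K w j" for w w' j
  proof -
    have "near K w' j" using ag K0 nr D_nonneg by (intro near_local[of j K w w']) auto
    then have h: "home w j" "home w' j" using nr near_home by blast+
    show ?thesis
      unfolding lamp_map_def
      by (rule belt_map_local[OF w steady_load[OF single_lamps[OF a] w(1)]
          steady_load[OF single_lamps[OF a] w(2)] reversible_\<omega>[OF a]])
        (use h load_single[OF a] w ag K0 D_nonneg in auto)
  qed
  show ?thesis
    unfolding window_local_def has_radius_def configs_eq[symmetric]
  proof (intro exI[of _ "3 * \<bar>\<delta> a\<bar> + 4 + K + 2 * D + 5"] conjI ballI allI impI)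
    show "0 \<le> 3 * \<bar>\<delta> a\<bar> + 4 + K + 2 * D + 5" using K0 D_nonneg by simp
    fix w w' j assume w: "w \<in> configs" "w' \<in> configs"
      and ag: "\<forall>k. \<bar>k - j\<bar> \<le> 3 * \<bar>\<delta> a\<bar> + 4 + K + 2 * D + 5 \<longrightarrow> w k = w' k"
    consider "near K w j" | "near K w' j" | "\<not> near K w j" "\<not> near K w' j" by blast
    then show "lamp_map (single a) w j = lamp_map (single a) w' j"
    proof cases
      case 1 then show ?thesis using both w ag by blast
    next
      case 2 then show ?thesis using both[of w' w j] w ag by simp
    next
      case 3
      have "w j = w' j" using ag[rule_format, of j] K0 D_nonneg by simp
      then show ?thesis using 3 lamp_map_single_far[OF w(1) a] lamp_map_single_far[OF w(2) a]
        by (simp add: K_def)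
    qed
  qed
qed

lemma local_lamp_map_move:
  assumes "a \<in> carrier A" "g \<in> carrier G"
  shows "window_local cells (lamp_map (lamp_move g (single a)))"
proof (rule local_cong)
  show "window_local cells (\<lambda>w. G_map g (lamp_map (single a) (G_map (inv\<^bsub>G\<^esub> g) w)))"
  proof (rule local_comp[OF local_G_map[OF assms(2)]])
    show "window_local cells (\<lambda>w. lamp_map (single a) (G_map (inv\<^bsub>G\<^esub> g) w))"
      by (rule local_comp[OF local_lamp_map_single local_G_map]) (simp_all add: assms G_map_configs)
  qed (simp add: assms G_map_configs lamp_map_configs single_lamps)
  fix w assume w: "w \<in> configs"
  then show "lamp_map (lamp_move g (single a)) w = G_map g (lamp_map (single a) (G_map (inv\<^bsub>G\<^esub> g) w))"
    using assms G_map_lamp_map[of "single a" g "G_map (inv\<^bsub>G\<^esub> g) w"] single_lamps G_map_configs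
    by (simp add: G_map_mult G.r_inv G_map_one)
qed

text \<open>
Induction on the support: an element of finite support is a product of translates of lamps at the
identity, and these are conjugates of the local maps of \<open>local_lamp_map_single\<close>.
\<close>

lemma local_lamp_map:
  assumes "u \<in> lamps" shows "window_local cells (lamp_map u)"
proof -
  have "finite {g \<in> carrier G. u g \<noteq> \<one>}" using assms by (simp add: lamps_iff)
  then show ?thesis
    using assms
  proof (induction "{g \<in> carrier G. u g \<noteq> \<one>}" arbitrary: u rule: finite_induct)
    case empty
    have "lamp_map u w = w" if "w \<in> configs" for w
      using that empty by (intro lamp_map_trivial) auto
    moreover have "window_local cells (\<lambda>w. w)" unfolding window_local_def has_radius_def by (intro exI[of _ 0]) simp
    ultimately show ?case using local_cong by blast
  next
    case (insert h B)
    define u' where "u' = (\<lambda>g\<in>carrier G. if g = h then \<one> else u g)"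
    have h: "h \<in> carrier G" using insert by auto
    have B: "B = {g \<in> carrier G. u' g \<noteq> \<one>}"
      using insert(2,4) by (auto simp: u'_def)
    have u': "u' \<in> lamps"
      using insert(1,5) B by (auto simp: lamps_iff u'_def)
    have uh: "u h \<in> carrier A" using lamps_closed insert h by blast
    have one: "inv\<^bsub>G\<^esub> h \<otimes>\<^bsub>G\<^esub> g = \<one>\<^bsub>G\<^esub> \<longleftrightarrow> g = h" if "g \<in> carrier G" for g
      using that h by (metis G.inv_closed G.inv_equality G.inv_inv G.l_inv)
    have u: "u = lamp_mult (lamp_move h (single (u h))) u'"
    proof
      fix g show "u g = lamp_mult (lamp_move h (single (u h))) u' g"
        using insert(5) uh one[of g] h lamps_closed[OF insert(5), of g]
        by (cases "g \<in> carrier G")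
          (auto simp: lamp_mult_def lamp_move_def single_def u'_def lamps_iff extensional_def PiE_def)
    qed
    have mv: "lamp_move h (single (u h)) \<in> lamps" using uh h single_lamps lamp_move_closed by blast
    show ?case
    proof (rule local_cong)
      show "window_local cells (\<lambda>w. lamp_map (lamp_move h (single (u h))) (lamp_map u' w))"
        by (rule local_comp[OF local_lamp_map_move[OF uh h] insert(3)[OF B u'] lamp_map_configs[OF u']])
      show "lamp_map u w = lamp_map (lamp_move h (single (u h))) (lamp_map u' w)" if "w \<in> configs" for w
        using arg_cong[OF u, of "\<lambda>v. lamp_map v w"] lamp_map_mult[OF mv u' that] by (rule trans[OF _ sym])
    qed
  qed
qed

lemma G_map_shift: "G_map g (shift w) = shift (G_map g w)"
  unfolding G_map_def using belt_map_shift[of "\<lambda>_. \<psi> g"] by simp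

lemma all_shift: "(\<forall>k::int. P (k + 1)) \<longleftrightarrow> (\<forall>k. P k)"
  by (metis diff_add_cancel)

lemma ex_shift: "(\<exists>k::int. P (k + 1)) \<longleftrightarrow> (\<exists>k. P k)"
  by (metis diff_add_cancel)

lemma home_shift: "home (shift w) i = home w (i + 1)"
proof -
  have l: "linked (live (shift w)) i j \<longleftrightarrow> linked (live w) (i + 1) (j + 1)" for i j
    by (simp add: live_shift linked_shift)
  have p: "placed (shift w) j b a = placed w (j + 1) b a" for j b a
  proof -
    have "walk (live (shift w)) t (j, b) = (k, b') \<longleftrightarrow> walk (live w) t (j + 1, b) = (k + 1, b')" for t k b'
      unfolding live_shift walk_shift by (auto simp: prod_eq_iff)
    then have "placed (shift w) j b a \<longleftrightarrow> (\<forall>t. \<bar>t\<bar> \<le> D \<longrightarrow> belt w (j + 1) b t = \<phi> a (r t)) \<and>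
      (\<forall>k b'. linked (live w) (j + 1) (k + 1) \<and> letter w (k + 1) b' \<noteq> z \<longrightarrow>
        (\<exists>t. \<bar>t\<bar> \<le> D \<and> walk (live w) t (j + 1, b) = (k + 1, b')))"
      unfolding placed_def l by (simp add: belt_shift letter_shift)
    also have "\<dots> = placed w (j + 1) b a"
      unfolding placed_def all_shift[of "\<lambda>k. \<forall>b'. linked (live w) (j + 1) k \<and> letter w k b' \<noteq> z \<longrightarrow>
        (\<exists>t. \<bar>t\<bar> \<le> D \<and> walk (live w) t (j + 1, b) = (k, b'))"] ..
    finally show ?thesis .
  qed
  show ?thesis
    unfolding home_def l p open_end_shift
      ex_shift[of "\<lambda>j. \<exists>b. \<exists>a\<in>carrier A. linked (live w) (i + 1) j \<and> placed w j b a"] ..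
qed

lemma lamp_map_shift: "lamp_map u (shift w) = shift (lamp_map u w)"
proof -
  have "load u (shift w) i = load u w (i + 1)" for i
    by (simp add: load_def G_map_shift home_shift)
  then show ?thesis unfolding lamp_map_def using belt_map_shift[of "\<lambda>i. \<omega> (load u w i)"] by simp
qed

section \<open>Faithfulness\<close>

definition act :: "('g \<Rightarrow> 'a) \<times> 'g \<Rightarrow> (int \<Rightarrow> 's cell) \<Rightarrow> int \<Rightarrow> 's cell" where
  "act p w = lamp_map (fst p) (G_map (snd p) w)"

lemma act_configs: "fst p \<in> lamps \<Longrightarrow> snd p \<in> carrier G \<Longrightarrow> w \<in> configs \<Longrightarrow> act p w \<in> configs"
  by (simp add: act_def lamp_map_configs G_map_configs)

lemma act_mult:
  assumes "u \<in> lamps" "h \<in> carrier G" "u' \<in> lamps" "h' \<in> carrier G" "w \<in> configs"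
  shows "act (u, h) (act (u', h') w) = act (lamp_mult u (lamp_move h u'), h \<otimes>\<^bsub>G\<^esub> h') w"
proof -
  have "act (u, h) (act (u', h') w) = lamp_map u (G_map h (lamp_map u' (G_map h' w)))"
    by (simp add: act_def)
  also have "\<dots> = lamp_map u (lamp_map (lamp_move h u') (G_map (h \<otimes>\<^bsub>G\<^esub> h') w))"
    using G_map_lamp_map[OF assms(3,2) G_map_configs[OF assms(4,5)]] G_map_mult[OF assms(2,4,5)] by simp
  also have "\<dots> = act (lamp_mult u (lamp_move h u'), h \<otimes>\<^bsub>G\<^esub> h') w"
    using lamp_map_mult[OF assms(1) lamp_move_closed[OF assms(3,2)] G_map_configs[of "h \<otimes>\<^bsub>G\<^esub> h'" w]] assms
    by (simp add: act_def)
  finally show ?thesis .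
qed

lemma act_local:
  assumes "fst p \<in> lamps" "snd p \<in> carrier G" shows "window_local cells (act p)"
  unfolding act_def
  by (rule local_comp[OF local_lamp_map[OF assms(1)] local_G_map[OF assms(2)] G_map_configs[OF assms(2)]])

lemma act_shift: "act p (shift w) = shift (act p w)"
  by (simp add: act_def G_map_shift lamp_map_shift)

lemma act_one: "w \<in> configs \<Longrightarrow> act (\<lambda>g\<in>carrier G. \<one>, \<one>\<^bsub>G\<^esub>) w = w"
  by (simp add: act_def G_map_one lamp_map_trivial)

text \<open>
A two-sided infinite run without ends. It falls into two belts, one with content \<open>x\<close> and one that is
blank.
\<close>

definition is_line :: "(int \<Rightarrow> 's cell) \<Rightarrow> (int \<Rightarrow> 's) \<Rightarrow> bool" where
  "is_line w x \<longleftrightarrow> (\<forall>i. live w i) \<and> (\<forall>i b. open_end w i b) \<and>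
     (\<forall>i. letter w i True = x i \<and> letter w i False = z)"

definition line :: "(int \<Rightarrow> 's) \<Rightarrow> int \<Rightarrow> 's cell" where
  "line x i b = (if b then x i else z, \<forall>n\<ge>0. x (i + n * dir b) = z)"

lemma line_configs: "x \<in> pts \<Longrightarrow> line x \<in> configs"
  using z_in_S by (simp add: configs_def line_def letter_def pts_def)

lemma is_line_line:
  assumes fin: "finite {i. x i \<noteq> z}"
  shows "is_line (line x) x"
proof -
  have l: "letter (line x) i b = (if b then x i else z)"
    and f: "flag (line x) i b \<longleftrightarrow> (\<forall>n\<ge>0. x (i + n * dir b) = z)" for i b
    by (simp_all add: letter_def flag_def line_def)
  have b: "blank (letter (line x)) i \<longleftrightarrow> x i = z" for i
    by (auto simp: blank_def l)
  have ag: "agrees (line x) i b" for i b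
  proof -
    have "(\<forall>n\<ge>0. x (i + n * dir b) = z) \<longleftrightarrow> x i = z \<and> (\<forall>n\<ge>0. x (i + dir b + n * dir b) = z)"
    proof (intro iffI conjI allI impI)
      assume *: "\<forall>n\<ge>0. x (i + n * dir b) = z"
      show "x i = z" using *[rule_format, of 0] by simp
      fix n :: int assume "0 \<le> n"
      then show "x (i + dir b + n * dir b) = z"
        using *[rule_format, of "n + 1"] by (simp add: algebra_simps)
    next
      fix n :: int assume *: "x i = z \<and> (\<forall>n\<ge>0. x (i + dir b + n * dir b) = z)" "0 \<le> n"
      show "x (i + n * dir b) = z"
      proof (cases "n = 0")
        case False
        then show ?thesis
          using *(1)[THEN conjunct2, rule_format, of "n - 1"] *(2) by (simp add: algebra_simps)
      qed (use * in simp)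
    qed
    then show ?thesis by (simp add: agrees_def b f)
  qed
  then have lv: "live (line x) i" for i by (simp add: live_def)
  have "open_end (line x) i b" for i b
  proof -
    obtain B where B: "\<And>k. x k \<noteq> z \<Longrightarrow> \<bar>k\<bar> \<le> B"
    proof (rule that)
      fix k assume "x k \<noteq> z"
      then show "\<bar>k\<bar> \<le> Max (abs ` {i. x i \<noteq> z})" using fin by (intro Max_ge) auto
    qed
    define n where "n = \<bar>B\<bar> + \<bar>i\<bar> + 1"
    have "x (i + n * dir b + m * dir b) = z" if "0 \<le> m" for m
    proof (rule ccontr)
      assume "x (i + n * dir b + m * dir b) \<noteq> z"
      then show False using B that by (cases b) (force simp: n_def)+
    qed
    then have "flag (line x) (i + n * dir b) b" by (simp add: f)
    moreover have "linked (live (line x)) i (i + (n - 1) * dir b)" using lv by (simp add: linked_def)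
    ultimately show ?thesis unfolding open_end_def by (intro exI[of _ n]) (simp add: n_def)
  qed
  then show ?thesis using lv by (simp add: is_line_def l)
qed

lemma belt_line:
  assumes "is_line w x"
  shows "belt w i True = (\<lambda>t. x (i + t))" "belt w i False = (\<lambda>_. z)"
  using assms walk_everywhere[of "live w"] by (simp_all add: belt_def read_def is_line_def fun_eq_iff)

lemma is_line_belt_map:
  assumes w: "w \<in> configs" and l: "is_line w x" and x: "x \<in> pts" and T: "reversible R T"
    and \<tau>: "\<And>i. \<tau> i = T"
  shows "is_line (belt_map \<tau> w) (T x)"
proof -
  have st: "steady (live w) \<tau>" using T \<tau> by (auto simp: steady_def)
  have lv: "live w i" for i using l by (simp add: is_line_def)
  have TR: "automaton R T" using T by (simp add: reversible_def)
  have "letter (belt_map \<tau> w) i True = T x i" for i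
    using letter_belt_map[OF lv, of \<tau> i True] automaton_at[OF TR x, of i] \<tau>
    by (simp add: belt_line(1)[OF l] add.commute)
  moreover have "letter (belt_map \<tau> w) i False = z" for i
    using letter_belt_map[OF lv, of \<tau> i False] TR \<tau>
    by (simp add: belt_line(2)[OF l] automaton_def)
  ultimately show ?thesis
    using l by (simp add: is_line_def live_belt_map[OF w st] open_end_belt_map[OF w st])
qed

lemma is_line_G_map:
  assumes "g \<in> carrier G" "w \<in> configs" "x \<in> pts" "is_line w x"
  shows "is_line (G_map g w) (\<psi> g x)"
proof -
  obtain R where "reversible R (\<psi> g)" using \<psi>_reversible[OF assms(1)] by blast
  then show ?thesis unfolding G_map_def by (rule is_line_belt_map[OF assms(2,4,3)]) simp
qed

lemma home_line_imp:
  assumes l: "is_line w x" and h: "home w i"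
  shows "\<exists>a\<in>carrier A. \<exists>j. x = (\<lambda>k. \<phi> a (r (k - j)))"
proof -
  obtain j b a where a: "a \<in> carrier A" and p: "placed w j b a"
    using h by (auto simp: home_def)
  have lv: "live w k" for k using l by (simp add: is_line_def)
  have lk: "linked (live w) k k'" for k k' using lv by (simp add: linked_def)
  have "b = True"
  proof (rule ccontr)
    assume "b \<noteq> True"
    then have "\<phi> a (r 0) = z"
      using p D_nonneg belt_line(2)[OF l] unfolding placed_def by force
    then show False using \<phi>_inj[OF a _ r_0] r_pts by (simp add: pts_def)
  qed
  then have near: "x (j + t) = \<phi> a (r t)" if "\<bar>t\<bar> \<le> D" for t
    using p that belt_line(1)[OF l] by (simp add: placed_def)
  have "x k = \<phi> a (r (k - j))" for k
  proof (cases "\<bar>k - j\<bar> \<le> D")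
    case False
    have "x k = z"
    proof (rule ccontr)
      assume "x k \<noteq> z"
      then have "letter w k True \<noteq> z" using l by (simp add: is_line_def)
      then obtain t where "\<bar>t\<bar> \<le> D" "walk (live w) t (j, b) = (k, True)"
        using p lk unfolding placed_def by blast
      then show False using False walk_everywhere[of "live w" t j b] lv by (cases b) auto
    qed
    moreover have "r (k - j) = z" using False r_support by blast
    ultimately show ?thesis using \<phi>_z[OF a] by simp
  qed (use near[of "k - j"] in simp)
  then show ?thesis using a by blast
qed

lemma home_line_r:
  assumes l: "is_line w r" shows "home w i"
proof -
  have lv: "live w k" for k using l by (simp add: is_line_def)
  have lk: "linked (live w) k k'" for k k' using lv by (simp add: linked_def)
  have "placed w 0 True \<one>"
    unfolding placed_def
  proof (intro conjI allI impI)
    fix t show "belt w 0 True t = \<phi> \<one> (r t)"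
      using r_pts by (simp add: belt_line(1)[OF l] \<phi>_one pts_def)
  next
    fix k b' assume "linked (live w) 0 k \<and> letter w k b' \<noteq> z"
    then have "b' = True" "r k \<noteq> z" using l by (cases b'; auto simp: is_line_def)+
    then show "\<exists>t. \<bar>t\<bar> \<le> D \<and> walk (live w) t (0, True) = (k, b')"
      using walk_everywhere[of "live w" k 0 True] lv r_support by (intro exI[of _ k]) auto
  qed
  then show ?thesis using l lk unfolding home_def is_line_def by blast
qed

lemma finite_support_\<psi>:
  assumes "g \<in> carrier G" shows "finite {i. \<psi> g r i \<noteq> z}"
proof -
  obtain R where R: "automaton R (\<psi> g)" using \<psi>_automaton assms by blast
  have "\<bar>i\<bar> \<le> D + R" if "\<psi> g r i \<noteq> z" for i
  proof (rule ccontr)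
    assume "\<not> \<bar>i\<bar> \<le> D + R"
    then have "r (k + i) = z" if "\<bar>k\<bar> \<le> R" for k
      using r_support[of "k + i"] that by force
    then have "\<psi> g (\<lambda>k. r (k + i)) 0 = \<psi> g (\<lambda>_. z) 0"
      using r_pts by (intro automaton_local[OF R]) auto
    then show False
      using that automaton_at[OF R r_pts, of i] R by (simp add: automaton_def)
  qed
  then have "{i. \<psi> g r i \<noteq> z} \<subseteq> {- (D + R)..D + R}" by (force simp: abs_le_iff)
  then show ?thesis using finite_subset by blast
qed

text \<open>
On the line with content \<open>\<psi> k r\<close>, the element \<open>h\<close> produces \<open>\<psi> (h k) r\<close>. The lamp at \<open>g\<close> sees home if the inverse
of \<open>g\<close> turns this into a slid and recoloured copy of \<open>r\<close>, which by \<open>free\<close> happens for \<open>g = h k\<close> only. The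
element \<open>(u, h)\<close> thus maps the line to \<open>\<omega> (u (h k)) (\<psi> (h k) r)\<close>; if this is \<open>\<psi> k r\<close> for \<open>k = 1\<close>, then \<open>free\<close>
yields \<open>h = 1\<close>.
\<close>

lemma act_faithful:
  assumes free: "\<And>g a j. g \<in> carrier G \<Longrightarrow> a \<in> carrier A \<Longrightarrow>
      \<psi> g r = (\<lambda>k. \<phi> a (r (k - j))) \<Longrightarrow> g = \<one>\<^bsub>G\<^esub>"
    and u: "u \<in> lamps" and h: "h \<in> carrier G"
    and id: "\<And>w. w \<in> configs \<Longrightarrow> act (u, h) w = w"
  shows "h = \<one>\<^bsub>G\<^esub> \<and> (\<forall>k\<in>carrier G. \<omega> (u k) r = r)"
proof -
  have key: "\<omega> (u (h \<otimes>\<^bsub>G\<^esub> k)) (\<psi> (h \<otimes>\<^bsub>G\<^esub> k) r) = \<psi> k r" if k: "k \<in> carrier G" for k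
  proof -
    define x where "x = \<psi> k r"
    define w where "w = line x"
    have x: "x \<in> pts" using \<psi>_pts[OF k r_pts] by (simp add: x_def)
    have w: "w \<in> configs" "is_line w x"
      using line_configs[OF x] is_line_line finite_support_\<psi>[OF k] by (simp_all add: w_def x_def)
    have Fw: "G_map h w \<in> configs" "is_line (G_map h w) (\<psi> h x)"
      using G_map_configs h w is_line_G_map x by auto
    have hk: "\<psi> h x = \<psi> (h \<otimes>\<^bsub>G\<^esub> k) r"
      using \<psi>_mult[OF h k r_pts] by (simp add: x_def)
    have hm: "home (G_map (inv\<^bsub>G\<^esub> g) (G_map h w)) i \<longleftrightarrow> g = h \<otimes>\<^bsub>G\<^esub> k" if g: "g \<in> carrier G" for g i
    proof -
      let ?v = "G_map (inv\<^bsub>G\<^esub> g) (G_map h w)" and ?q = "inv\<^bsub>G\<^esub> g \<otimes>\<^bsub>G\<^esub> (h \<otimes>\<^bsub>G\<^esub> k)"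
      have v: "is_line ?v (\<psi> ?q r)"
        using is_line_G_map[of "inv\<^bsub>G\<^esub> g", OF _ Fw(1) _ Fw(2)] g h k x \<psi>_pts hk
          \<psi>_mult[of "inv\<^bsub>G\<^esub> g" "h \<otimes>\<^bsub>G\<^esub> k" r] r_pts by simp
      have q: "?q = \<one>\<^bsub>G\<^esub> \<longleftrightarrow> g = h \<otimes>\<^bsub>G\<^esub> k"
        using g h k by (metis G.inv_closed G.inv_equality G.inv_inv G.l_inv G.m_closed)
      show ?thesis
      proof
        assume "home ?v i"
        then obtain a j where "a \<in> carrier A" "\<psi> ?q r = (\<lambda>k. \<phi> a (r (k - j)))"
          using home_line_imp[OF v] by blast
        then show "g = h \<otimes>\<^bsub>G\<^esub> k" using free[of ?q a j] g h k q by simp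
      next
        assume "g = h \<otimes>\<^bsub>G\<^esub> k"
        then have "is_line ?v r" using v q \<psi>_one[OF r_pts] by simp
        then show "home ?v i" by (rule home_line_r)
      qed
    qed
    have hkG: "h \<otimes>\<^bsub>G\<^esub> k \<in> carrier G" using h k by simp
    have ld: "load u (G_map h w) i = u (h \<otimes>\<^bsub>G\<^esub> k)" for i
    proof -
      have "{g \<in> carrier G. u g \<noteq> \<one> \<and> home (G_map (inv\<^bsub>G\<^esub> g) (G_map h w)) i}
          = (if u (h \<otimes>\<^bsub>G\<^esub> k) = \<one> then {} else {h \<otimes>\<^bsub>G\<^esub> k})"
        using hm hkG by auto
      then show ?thesis using lamps_closed[OF u hkG] by (simp add: load_def)
    qed
    have "is_line (act (u, h) w) (\<omega> (u (h \<otimes>\<^bsub>G\<^esub> k)) (\<psi> h x))"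
      unfolding act_def lamp_map_def
      using is_line_belt_map[OF Fw \<psi>_pts[OF h x] reversible_\<omega>[OF lamps_closed[OF u hkG]]] ld by simp
    then have "is_line w (\<omega> (u (h \<otimes>\<^bsub>G\<^esub> k)) (\<psi> h x))" using id[OF w(1)] by simp
    then have "\<omega> (u (h \<otimes>\<^bsub>G\<^esub> k)) (\<psi> h x) = x" using w(2) by (simp add: is_line_def fun_eq_iff)
    then show ?thesis unfolding hk unfolding x_def .
  qed
  have uh: "u h \<in> carrier A" using lamps_closed[OF u h] .
  have "\<omega> (u h) (\<psi> h r) = r"
    using key[of "\<one>\<^bsub>G\<^esub>"] h \<psi>_one[OF r_pts] by simp
  then have "\<psi> h r = \<omega> (inv (u h)) r"
    using \<omega>_mult[of "inv (u h)" "u h" "\<psi> h r"] uh \<psi>_pts[OF h r_pts] \<omega>_one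
    by (simp add: A.l_inv)
  then have "\<psi> h r = (\<lambda>k. \<phi> (inv (u h)) (r (k - \<delta> (u h))))"
    using uh by (simp add: \<omega>_def \<delta>_inv)
  then have h1: "h = \<one>\<^bsub>G\<^esub>" using free[OF h, of "inv (u h)"] uh by blast
  have "\<omega> (u k) r = r" if k: "k \<in> carrier G" for k
  proof -
    have uk: "u k \<in> carrier A" using lamps_closed[OF u k] .
    have "\<omega> (u k) (\<psi> k r) = \<psi> k r" using key[OF k] h1 k by simp
    then have "\<psi> k (\<omega> (u k) r) = \<psi> k r" using \<psi>_\<omega>[OF k uk r_pts] by simp
    then have "\<psi> (inv\<^bsub>G\<^esub> k) (\<psi> k (\<omega> (u k) r)) = \<psi> (inv\<^bsub>G\<^esub> k) (\<psi> k r)" by simp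
    then show ?thesis
      using \<psi>_mult[of "inv\<^bsub>G\<^esub> k" k] k \<omega>_pts[OF uk r_pts] r_pts \<psi>_one by (simp add: G.l_inv)
  qed
  then show ?thesis using h1 by blast
qed

lemma finite_cells: "finite cells"
proof -
  have "cells = PiE UNIV (\<lambda>_. S \<times> UNIV)" by (auto simp: cells_def PiE_iff mem_Times_iff)
  then show ?thesis using finite_S by (simp add: finite_PiE)
qed

lemma shift_action_act: "shift_action (wreath_product A G) cells act"
  unfolding shift_action_def carrier_wreath
proof (intro conjI ballI)
  fix p assume p: "p \<in> lamps \<times> carrier G"
  then show "window_local cells (act p)" using act_local by (simp add: mem_Times_iff)
next
  fix w assume w: "w \<in> points cells"
  then show "act \<one>\<^bsub>wreath_product A G\<^esub> w = w" by (simp add: one_wreath act_one configs_eq)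
  fix p assume p: "p \<in> lamps \<times> carrier G"
  show "act p w \<in> points cells" using act_configs[of p w] p w by (auto simp: configs_eq)
  show "act p (shift w) = shift (act p w)" by (rule act_shift)
  fix q assume q: "q \<in> lamps \<times> carrier G"
  show "act (p \<otimes>\<^bsub>wreath_product A G\<^esub> q) w = act p (act q w)"
    using p q w by (cases p; cases q) (simp add: mult_wreath act_mult configs_eq)
qed

end

section \<open>The embedding\<close>

text \<open>
Symbols receive a label in \<open>{0..K}\<close>, on which \<open>G\<close> acts trivially. Label \<open>0\<close> means that there is no marker,
and \<open>1..K\<close> are the possible labels of a marker. The point \<open>r\<close> is \<open>x\<close> with a marker at the origin. As \<open>G\<close>
does not move the marker, no element of \<open>G\<close> takes \<open>r\<close> to a proper translate of \<open>r\<close>, even if \<open>G\<close> contains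
the shift. A character with values in \<open>\<int>/n\<close> rotates the \<open>n\<close> labels of the marker; an integer valued
character slides belts, and then one label is enough.
\<close>

lemma wreath_action:
  fixes A :: "('a, 'm) monoid_scheme" and G :: "('g, 'n) monoid_scheme"
    and S :: "nat set" and z :: nat and n :: int and \<theta> :: "'a \<Rightarrow> int"
  assumes G: "group G" and A: "comm_group A"
    and fin: "finite S" and z: "z \<in> S" and act: "shift_action G S \<Phi>"
    and fix0: "\<And>g. g \<in> carrier G \<Longrightarrow> \<Phi> g (\<lambda>_. z) = (\<lambda>_. z)"
    and x: "x \<in> points S" "finite {i. x i \<noteq> z}"
    and free: "\<And>g. g \<in> carrier G \<Longrightarrow> \<Phi> g x = x \<Longrightarrow> g = \<one>\<^bsub>G\<^esub>"
    and n: "0 \<le> n" and \<theta>: "\<And>a b. a \<in> carrier A \<Longrightarrow> b \<in> carrier A \<Longrightarrow>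
        [\<theta> (a \<otimes>\<^bsub>A\<^esub> b) = \<theta> a + \<theta> b] (mod n)"
  shows "\<exists>(S' :: nat set) \<Psi>. finite S' \<and> S' \<noteq> {} \<and> shift_action (wreath_product A G) S' \<Psi> \<and>
    (\<forall>(u, h)\<in>action_kernel (wreath_product A G) S' \<Psi>. h = \<one>\<^bsub>G\<^esub> \<and> (\<forall>k\<in>carrier G. n dvd \<theta> (u k)))"
proof -
  interpret A: comm_group A by (rule A)
  interpret G: group G by (rule G)
  define K where "K = (if n = 0 then 1 else n)"
  have K: "0 < K" using n by (auto simp: K_def)
  define T where "T = S \<times> {0..K}"
  define \<delta> where "\<delta> a = (if n = 0 then \<theta> a else 0)" for a
  define \<phi> where "\<phi> a s = (fst s, if snd s = 0 then 0 else 1 + (snd s - 1 + \<theta> a) mod K)" for a and s :: "nat \<times> int"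
  define \<psi> where "\<psi> g y = (\<lambda>i. (\<Phi> g (\<lambda>i. fst (y i)) i, snd (y i)))" for g and y :: "int \<Rightarrow> nat \<times> int"
  define r where "r i = (x i, if i = 0 then 1 else 0 :: int)" for i :: int
  have \<theta>K: "[\<theta> (a \<otimes>\<^bsub>A\<^esub> b) = \<theta> a + \<theta> b] (mod K)" if "a \<in> carrier A" "b \<in> carrier A" for a b
    using \<theta>[OF that] by (auto simp: K_def)
  have \<theta>1: "[\<theta> \<one>\<^bsub>A\<^esub> = 0] (mod n)"
    using \<theta>[of "\<one>\<^bsub>A\<^esub>" "\<one>\<^bsub>A\<^esub>"] by (simp add: cong_iff_dvd_diff)
  interpret T: belts T "(z, 0)"
    by unfold_locales (use fin z K in \<open>simp_all add: T_def\<close>)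
  have pts: "y \<in> T.pts \<longleftrightarrow> (\<lambda>i. fst (y i)) \<in> points S \<and> (\<forall>i. snd (y i) \<in> {0..K})" for y
  proof -
    have "s \<in> T \<longleftrightarrow> fst s \<in> S \<and> snd s \<in> {0..K}" for s by (simp add: T_def mem_Times_iff)
    then show ?thesis unfolding T.pts_def mem_full_shift by blast
  qed
  have \<psi>_mult: "\<psi> (g \<otimes>\<^bsub>G\<^esub> h) y = \<psi> g (\<psi> h y)" if "g \<in> carrier G" "h \<in> carrier G" "y \<in> T.pts" for g h y
    using that act by (simp add: \<psi>_def shift_action_def pts)
  have \<psi>_one: "\<psi> \<one>\<^bsub>G\<^esub> y = y" if "y \<in> T.pts" for y
    using that act by (simp add: \<psi>_def shift_action_def pts)
  have \<psi>_automaton: "\<exists>R. T.automaton R (\<psi> g)" if g: "g \<in> carrier G" for g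
  proof -
    obtain M where M: "has_radius S (\<Phi> g) M"
      using shift_action_radius[OF act g] by blast
    have "\<psi> g (\<lambda>_. (z, 0)) = (\<lambda>_. (z, 0))" using fix0[OF g] by (simp add: \<psi>_def)
    moreover have "\<psi> g y \<in> T.pts" "\<psi> g (shift y) = shift (\<psi> g y)" if y: "y \<in> T.pts" for y
    proof -
      have y': "(\<lambda>i. fst (y i)) \<in> points S" using y by (simp add: pts)
      show "\<psi> g y \<in> T.pts" using y shift_action_maps[OF act g y'] by (simp add: pts \<psi>_def)
      have "\<Phi> g (shift (\<lambda>i. fst (y i))) = shift (\<Phi> g (\<lambda>i. fst (y i)))"
        using act g y' by (simp add: shift_action_def)
      then show "\<psi> g (shift y) = shift (\<psi> g y)" by (simp add: \<psi>_def shift_def)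
    qed
    moreover have "\<psi> g y 0 = \<psi> g y' 0"
      if "y \<in> T.pts" "y' \<in> T.pts" "\<forall>i. \<bar>i\<bar> \<le> M \<longrightarrow> y i = y' i" for y y'
      using that has_radius_nonneg[OF M] by (auto simp: \<psi>_def pts intro!: has_radiusD[OF M])
    ultimately have "T.automaton M (\<psi> g)" using has_radius_nonneg[OF M] unfolding T.automaton_def by blast
    then show ?thesis by blast
  qed
  have \<psi>_rev: "\<exists>R. T.reversible R (\<psi> g)" if g: "g \<in> carrier G" for g
  proof -
    obtain R where R: "T.automaton R (\<psi> g)" using \<psi>_automaton[OF g] by (rule exE)
    obtain R' where R': "T.automaton R' (\<psi> (inv\<^bsub>G\<^esub> g))"
      using \<psi>_automaton[OF G.inv_closed[OF g]] by (rule exE)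
    have "T.automaton (max R R') (\<psi> g)" "T.automaton (max R R') (\<psi> (inv\<^bsub>G\<^esub> g))"
      by (rule T.automaton_mono[OF R], simp) (rule T.automaton_mono[OF R'], simp)
    moreover have "\<psi> (inv\<^bsub>G\<^esub> g) (\<psi> g y) = y \<and> \<psi> g (\<psi> (inv\<^bsub>G\<^esub> g) y) = y" if "y \<in> T.pts" for y
      using \<psi>_mult[of "inv\<^bsub>G\<^esub> g" g y] \<psi>_mult[of g "inv\<^bsub>G\<^esub> g" y] \<psi>_one that g by simp
    ultimately show ?thesis unfolding T.reversible_def by blast
  qed
  define D where "D = Max (insert 0 (abs ` {i. x i \<noteq> z}))"
  have D: "\<bar>i\<bar> \<le> D" if "x i \<noteq> z" for i
    using x(2) that by (auto simp: D_def intro: Max_ge)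
  have D_nonneg: "0 \<le> D" using x(2) by (simp add: D_def)
  interpret W: wreath_belts T "(z, 0)" A G \<delta> \<phi> \<psi> r D
  proof (unfold_locales, goal_cases)
    case (1 a b)
    then show ?case using \<theta>[of a b] by (auto simp: \<delta>_def)
  next
    case (2 a b s)
    have "(snd s - 1 + \<theta> (a \<otimes>\<^bsub>A\<^esub> b)) mod K = (snd s - 1 + (\<theta> a + \<theta> b)) mod K"
      using \<theta>K[OF 2(1,2)] by (metis cong_def mod_add_right_eq)
    moreover have "1 + (snd s - 1 + \<theta> b) mod K \<noteq> 0" using K by (smt (verit) pos_mod_sign)
    moreover have "((snd s - 1 + \<theta> b) mod K + \<theta> a) mod K = (snd s - 1 + (\<theta> a + \<theta> b)) mod K"
      unfolding mod_add_left_eq by (simp add: algebra_simps)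
    ultimately show ?case by (simp add: \<phi>_def)
  next
    case (3 s)
    then have s: "0 \<le> snd s" "snd s \<le> K" by (auto simp: T_def)
    have "(snd s - 1 + \<theta> \<one>\<^bsub>A\<^esub>) mod K = (snd s - 1) mod K"
      using \<theta>1 by (cases "n = 0") (auto simp: K_def cong_iff_dvd_diff mod_eq_dvd_iff)
    then show ?case using s by (cases s) (auto simp: \<phi>_def)
  next
    case (4 a s)
    have "0 \<le> 1 + (snd s - 1 + \<theta> a) mod K" "1 + (snd s - 1 + \<theta> a) mod K \<le> K"
      using pos_mod_sign[OF K, of "snd s - 1 + \<theta> a"] pos_mod_bound[OF K, of "snd s - 1 + \<theta> a"]
      by linarith+
    then show ?case using 4 K by (auto simp: \<phi>_def T_def)
  next
    case (5 a)
    show ?case by (simp add: \<phi>_def)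
  next
    case (6 g)
    then show ?case by (rule \<psi>_rev)
  next
    case (7 g h y)
    then show ?case by (rule \<psi>_mult)
  next
    case (8 y)
    then show ?case by (rule \<psi>_one)
  next
    case (9 g a y)
    show ?case by (simp add: \<psi>_def \<phi>_def cong: if_cong)
  next
    case 10
    show ?case using x(1) K by (auto simp: pts r_def mem_full_shift)
  next
    case (11 t)
    then show ?case using D[of t] D_nonneg by (auto simp: r_def split: if_splits)
  next
    case 12
    show ?case by (simp add: r_def)
  qed
  have free': "g = \<one>\<^bsub>G\<^esub>"
    if g: "g \<in> carrier G" and a: "a \<in> carrier A" and eq: "\<psi> g r = (\<lambda>k. \<phi> a (r (k - j)))" for g a j
  proof -
    have "snd (\<psi> g r 0) = snd (\<phi> a (r (0 - j)))" using eq by simp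
    then have "j = 0" by (simp add: \<psi>_def r_def \<phi>_def split: if_splits)
    then have "\<Phi> g x = x" using eq by (simp add: \<psi>_def r_def \<phi>_def fun_eq_iff)
    then show ?thesis using free g by blast
  qed
  have trivial: "n dvd \<theta> a" if a: "a \<in> carrier A" and eq: "W.\<omega> a r = r" for a
  proof (cases "n = 0")
    case True
    have "snd (W.\<omega> a r (- \<theta> a)) = snd (r (- \<theta> a))" using eq by simp
    then show ?thesis using True by (simp add: W.\<omega>_def \<delta>_def r_def \<phi>_def K_def split: if_splits)
  next
    case False
    have "snd (W.\<omega> a r 0) = snd (r 0)" using eq by simp
    then show ?thesis using False by (simp add: W.\<omega>_def \<delta>_def r_def \<phi>_def K_def dvd_eq_mod_eq_0)
  qed
  have ker: "h = \<one>\<^bsub>G\<^esub> \<and> (\<forall>k\<in>carrier G. n dvd \<theta> (u k))"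
    if "(u, h) \<in> action_kernel (wreath_product A G) T.cells W.act" for u h
  proof -
    have uh: "u \<in> W.lamps" "h \<in> carrier G" and id: "\<And>w. w \<in> T.configs \<Longrightarrow> W.act (u, h) w = w"
      using that by (auto simp: action_kernel_def W.carrier_wreath T.configs_eq)
    have "h = \<one>\<^bsub>G\<^esub> \<and> (\<forall>k\<in>carrier G. W.\<omega> (u k) r = r)"
      by (rule W.act_faithful[OF free' uh id])
    then show ?thesis using trivial W.lamps_closed[OF uh(1)] by blast
  qed
  obtain S' :: "nat set" and \<Psi> where S': "finite S'" "card S' = card T.cells"
    "shift_action (wreath_product A G) S' \<Psi>"
    "action_kernel (wreath_product A G) S' \<Psi> \<subseteq> action_kernel (wreath_product A G) T.cells W.act"
    using shift_action_nat[OF W.finite_cells W.shift_action_act] by blast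
  have "(\<lambda>_. ((z, 0), True)) \<in> T.cells" using T.z_in_S by (simp add: T.cells_def)
  then have "S' \<noteq> {}" using S'(2) W.finite_cells by fastforce
  then show ?thesis using S' ker by blast
qed

text \<open>
Without characters, the wreath product acts through its quotient \<open>G\<close>, which is in the class. Each
character contributes one more factor to the alphabet.
\<close>

lemma wreath_action_characters:
  fixes A :: "('a, 'm) monoid_scheme" and G :: "('g, 'n) monoid_scheme"
  assumes classG: "class_G G" and pointy: "admits_pointy_action G"
    and A: "comm_group A" and cs: "\<forall>(n, \<theta>)\<in>set cs. 0 \<le> n \<and>
      (\<forall>a\<in>carrier A. \<forall>b\<in>carrier A. [\<theta> (a \<otimes>\<^bsub>A\<^esub> b) = \<theta> a + \<theta> b] (mod (n::int)))"
  shows "\<exists>(S :: nat set) \<Psi>. finite S \<and> 2 \<le> card S \<and> shift_action (wreath_product A G) S \<Psi> \<and>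
    (\<forall>(u, h)\<in>action_kernel (wreath_product A G) S \<Psi>.
       h = \<one>\<^bsub>G\<^esub> \<and> (\<forall>(n, \<theta>)\<in>set cs. \<forall>k\<in>carrier G. n dvd \<theta> (u k)))"
  using cs
proof (induction cs)
  case Nil
  interpret A: comm_group A by (rule A)
  have G: "group G" using classG by (simp add: class_G_def)
  interpret G: group G by (rule G)
  interpret W: wreath A G ..
  obtain S :: "nat set" and \<phi> where S: "finite S" "2 \<le> card S" and \<phi>: "\<phi> \<in> mon G (shift_aut S)"
    using classG unfolding class_G_def by blast
  have "\<phi> \<in> hom G (shift_aut S)" using \<phi> by (simp add: mon_def)
  then have act: "shift_action G S \<phi>" by (rule hom_shift_aut_action[OF G S(1)])
  define \<Psi> where "\<Psi> p = \<phi> (snd p)" for p :: "('g \<Rightarrow> 'a) \<times> 'g"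
  have "shift_action (wreath_product A G) S \<Psi>"
    using act unfolding shift_action_def \<Psi>_def W.carrier_wreath W.one_wreath
    by (auto simp: W.mult_wreath)
  moreover have "h = \<one>\<^bsub>G\<^esub>" if "(u, h) \<in> action_kernel (wreath_product A G) S \<Psi>" for u h
  proof -
    have h: "h \<in> carrier G" and id: "\<And>x. x \<in> points S \<Longrightarrow> \<phi> h x = x"
      using that by (auto simp: action_kernel_def \<Psi>_def W.carrier_wreath)
    have ext: "\<phi> g \<in> extensional (points S)" if "g \<in> carrier G" for g
      using \<phi> that by (auto simp: mon_def hom_def shift_aut_simps(1) Bij_def)
    have "\<phi> h = \<phi> \<one>\<^bsub>G\<^esub>"
      using id act h by (intro extensionalityI[OF ext ext]) (auto simp: shift_action_def)
    then show ?thesis using \<phi> h by (auto simp: mon_def inj_on_def)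
  qed
  ultimately show ?case using S by (intro exI[of _ S] exI[of _ \<Psi>]) auto
next
  case (Cons c cs)
  obtain n \<theta> where c: "c = (n, \<theta>)" by fastforce
  have G: "group G" using classG by (simp add: class_G_def)
  have n: "0 \<le> n" and \<theta>: "\<And>a b. a \<in> carrier A \<Longrightarrow> b \<in> carrier A \<Longrightarrow>
      [\<theta> (a \<otimes>\<^bsub>A\<^esub> b) = \<theta> a + \<theta> b] (mod n)"
    using Cons.prems c by auto
  obtain S1 :: "nat set" and \<Psi>1 where 1: "finite S1" "2 \<le> card S1"
    "shift_action (wreath_product A G) S1 \<Psi>1"
    "\<forall>(u, h)\<in>action_kernel (wreath_product A G) S1 \<Psi>1.
       h = \<one>\<^bsub>G\<^esub> \<and> (\<forall>(n, \<theta>)\<in>set cs. \<forall>k\<in>carrier G. n dvd \<theta> (u k))"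
    using Cons.IH Cons.prems by auto
  obtain S :: "nat set" and z \<phi> x where S: "finite S" "z \<in> S" and \<phi>: "\<phi> \<in> mon G (shift_aut0 S z)"
    and x: "x \<in> points S" "finite_point z x" and inj: "inj_on (\<lambda>h. h x) (\<phi> ` carrier G)"
    using pointy unfolding admits_pointy_action_def pointy_def by blast
  interpret G: group G by (rule G)
  have hom: "\<phi> \<in> hom G (shift_aut S)" and fix0: "\<And>g. g \<in> carrier G \<Longrightarrow> \<phi> g (\<lambda>_. z) = (\<lambda>_. z)"
    using \<phi> by (auto simp: mon_def hom_def shift_aut0_def)
  have act: "shift_action G S \<phi>" using hom_shift_aut_action[OF G S(1) hom] .
  have free: "g = \<one>\<^bsub>G\<^esub>" if g: "g \<in> carrier G" and gx: "\<phi> g x = x" for g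
  proof -
    have "\<phi> \<one>\<^bsub>G\<^esub> x = x" using act x(1) by (simp add: shift_action_def)
    then have "\<phi> g = \<phi> \<one>\<^bsub>G\<^esub>" using inj g gx by (auto simp: inj_on_def)
    then show ?thesis using \<phi> g by (auto simp: mon_def inj_on_def)
  qed
  obtain S2 :: "nat set" and \<Psi>2 where 2: "finite S2" "S2 \<noteq> {}"
    "shift_action (wreath_product A G) S2 \<Psi>2"
    "\<forall>(u, h)\<in>action_kernel (wreath_product A G) S2 \<Psi>2. h = \<one>\<^bsub>G\<^esub> \<and> (\<forall>k\<in>carrier G. n dvd \<theta> (u k))"
    using wreath_action[OF G A S act fix0 x(1) _ free n \<theta>] x(2) unfolding finite_point_def by blast
  obtain S3 :: "nat set" and \<Psi> where 3: "finite S3" "card S3 = card (S1 \<times> S2)"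
    "shift_action (wreath_product A G) S3 \<Psi>"
    "action_kernel (wreath_product A G) S3 \<Psi>
       \<subseteq> action_kernel (wreath_product A G) (S1 \<times> S2) (pair_action \<Psi>1 \<Psi>2)"
    using shift_action_nat[OF finite_cartesian_product[OF 1(1) 2(1)]
        shift_action_pair[OF 1(3) 2(3)]] by blast
  have S1: "S1 \<noteq> {}" using 1(2) by auto
  have ker: "action_kernel (wreath_product A G) S3 \<Psi>
      \<subseteq> action_kernel (wreath_product A G) S1 \<Psi>1 \<inter> action_kernel (wreath_product A G) S2 \<Psi>2"
    by (rule order_trans[OF 3(4) action_kernel_pair[OF S1 2(2)]])
  have "0 < card S2" using 2 by (simp add: card_gt_0_iff)
  then have "card S1 \<le> card S1 * card S2" by simp
  then have "2 \<le> card S3" using 1(2) unfolding 3(2) card_cartesian_product by (rule order_trans[rotated])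
  moreover have "h = \<one>\<^bsub>G\<^esub> \<and> (\<forall>(n, \<theta>)\<in>set (c # cs). \<forall>k\<in>carrier G. n dvd \<theta> (u k))"
    if "(u, h) \<in> action_kernel (wreath_product A G) S3 \<Psi>" for u h
  proof -
    have "(u, h) \<in> action_kernel (wreath_product A G) S1 \<Psi>1"
      "(u, h) \<in> action_kernel (wreath_product A G) S2 \<Psi>2" using ker that by blast+
    then have "\<forall>(n, \<theta>)\<in>set cs. \<forall>k\<in>carrier G. n dvd \<theta> (u k)"
      "h = \<one>\<^bsub>G\<^esub> \<and> (\<forall>k\<in>carrier G. n dvd \<theta> (u k))" using 1(4) 2(4) by blast+
    then show ?thesis using c by simp
  qed
  ultimately show ?case using 3(1,3) by blast
qed

theorem lemma3:
  fixes G :: "('g, 'm) monoid_scheme" and A :: "('a, 'n) monoid_scheme"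
  assumes "class_G G"
    and "admits_pointy_action G"
    and "comm_group A"
    and "finitely_generated A"
  shows "class_G (wreath_product A G)"
proof -
  interpret A: comm_group A by (rule assms(3))
  interpret G: group G using assms(1) by (simp add: class_G_def)
  interpret W: wreath A G ..
  obtain cs where cs: "separating A (carrier A) cs" using separating_characters assms by blast
  obtain S :: "nat set" and \<Psi> where S: "finite S" "2 \<le> card S"
    "shift_action (wreath_product A G) S \<Psi>"
    "\<forall>(u, h)\<in>action_kernel (wreath_product A G) S \<Psi>.
       h = \<one>\<^bsub>G\<^esub> \<and> (\<forall>(n, \<theta>)\<in>set cs. \<forall>k\<in>carrier G. n dvd \<theta> (u k))"
    using wreath_action_characters[OF assms(1,2,3), of cs] cs unfolding separating_def by blast
  have "p = \<one>\<^bsub>wreath_product A G\<^esub>" if p: "p \<in> action_kernel (wreath_product A G) S \<Psi>" for p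
  proof -
    obtain u h where uh: "p = (u, h)" by fastforce
    have u: "u \<in> W.lamps" using p by (auto simp: uh action_kernel_def W.carrier_wreath)
    have h: "h = \<one>\<^bsub>G\<^esub>" and d: "\<forall>(n, \<theta>)\<in>set cs. \<forall>k\<in>carrier G. n dvd \<theta> (u k)"
      using S(4) p unfolding uh by blast+
    have "u k = \<one>\<^bsub>A\<^esub>" if k: "k \<in> carrier G" for k
    proof -
      have "\<forall>(n, \<theta>)\<in>set cs. n dvd \<theta> (u k)" using d k by blast
      then show ?thesis using cs W.lamps_closed[OF u k] unfolding separating_def by blast
    qed
    then have "u = (\<lambda>g\<in>carrier G. \<one>\<^bsub>A\<^esub>)"
      using u by (intro W.lamps_ext[OF u W.one_lamps]) simp
    then show ?thesis using uh h by (simp add: W.one_wreath)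
  qed
  moreover have "\<one>\<^bsub>wreath_product A G\<^esub> \<in> action_kernel (wreath_product A G) S \<Psi>"
    using S(3) W.group_wreath[THEN group.is_monoid] unfolding action_kernel_def shift_action_def
    by (simp add: monoid.one_closed)
  ultimately have "action_kernel (wreath_product A G) S \<Psi> = {\<one>\<^bsub>wreath_product A G\<^esub>}" by blast
  then have "\<exists>\<phi>. \<phi> \<in> mon (wreath_product A G) (shift_aut S)"
    using shift_action_mon[OF W.group_wreath S(3)] by blast
  then show ?thesis using W.group_wreath S(1,2) unfolding class_G_def by blast
qed

end
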